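(* Let $n\ge2$ and let $T$ be any one of the following operators: $M$ or a $k$-fold iteration $M^k$ ($k\in\mathbb{N}$); $M_{L^{n',1}}$; $\mathcal M_{\mathbb{S}^{n-1}}$; $M_\Omega$ with $\Omega\in L^{n,\infty}(\mathbb{S}^{n-1})$; $T_\Omega$ or $T^\star_\Omega$ with $\Omega\in L^{n,\infty}(\mathbb{S}^{n-1})$ of mean zero on $\mathbb{S}^{n-1}$ (all these operators are defined in the context). Let $w$ be a weight. Then for any $\epsilon>0$ there is a constant $C$, independent of $f$, such that $$\|Tf\|_{L^{1,\infty}(w)}\le C\int_{\mathbb{R}^n}|\nabla f|\,M_1\big(M_{L(\log L)^\epsilon}w\big)\,dx$$ for any $f\in C_c^\infty(\mathbb{R}^n)$.
   Context: A weight is a nonnegative locally integrable function; $n'=\frac n{n-1}$; $Q$ denotes cubes with sides parallel to the axes and $\ell(Q)$ the side length. $\|f\|_{L^{1,\infty}(w)}=\sup_{t>0}t\,w(\{x:|f(x)|>t\})$ with $w(E)=\int_Ew\,dx$. $M_1g(x)=\sup_{Q\ni x}\ell(Q)\frac1{|Q|}\int_Q|g|$. For a Young function $\Phi$, $\|f\|_{L^\Phi(Q)}=\inf\{\lambda>0:\frac1{|Q|}\int_Q\Phi(|f|/\lambda)\le1\}$ and $M_{L^\Phi}f(x)=\sup_{Q\ni x}\|f\|_{L^\Phi(Q)}$; $M_{L(\log L)^\epsilon}$ denotes $M_{L^\Phi}$ with $\Phi(t)=t\log(\mathrm e+t)^\epsilon$. Notation for the operators: $\sigma$ is surface measure on $\mathbb{S}^{n-1}$;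 $\Omega$ is homogeneous of degree zero on $\mathbb{R}^n\setminus\{0\}$, and $\Omega\in L^{n,\infty}(\mathbb{S}^{n-1})$ means $\sup_{t>0}t\,\sigma(\{y'\in\mathbb{S}^{n-1}:|\Omega(y')|>t\})^{1/n}<\infty$. Operators: - Hardy–Littlewood maximal operator $Mf(x)=\sup_{Q\ni x}\frac1{|Q|}\int_Q|f|$, and $M^k$ its $k$-fold composition. - Lorentz maximal operator $M_{L^{n',1}}f(x)=\sup_{Q\ni x}\|f\|_{L^{n',1}(Q)}$, where $\|f\|_{L^{n',1}(Q)}=|Q|^{-1/n'}\,n'\int_0^\infty|\{y\in Q:|f(y)|>t\}|^{1/n'}\,dt$. - Spherical maximal operator $\mathcal M_{\mathbb{S}^{n-1}}f(x)=\sup_{t>0}\left|\int_{\mathbb{S}^{n-1}}f(x-ty')\,d\sigma(y')\right|$. - Rough maximal operator $M_\Omega f(x)=\sup_{t>0}\frac1{t^n}\int_{|y|<t}|\Omega(y)f(x-y)|\,dy$. - Rough singular integral $T_\Omega f(x)=\mathrm{p.v.}\int_{\mathbb{R}^n}\frac{\Omega(y)}{|y|^n}f(x-y)\,dy$. - Maximal rough singular integral $T^\star_\Omega f(x)=\sup_{t>0}\left|\int_{|y|>t}\frac{\Omega(y)}{|y|^n}f(x-y)\,dy\right|$. *)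

theory Defs
  imports "HOL-Analysis.Analysis"
begin

section \<open>Cubes, weights and norms\<close>

text \<open>The cube with lower corner \<open>a\<close> and side length \<open>l\<close>. Suprema over the cubes
  containing \<open>x\<close> run over pairs \<open>(a, l)\<close>, so that \<open>\<ell>(Q)\<close> is available directly.\<close>

definition cube :: "real^'n \<Rightarrow> real \<Rightarrow> (real^'n) set" where
  "cube a l = cbox a (a + vec l)"

definition cubes_at :: "real^'n \<Rightarrow> ((real^'n) \<times> real) set" where
  "cubes_at x = {(a, l). 0 < l \<and> x \<in> cube a l}"

definition weight :: "(real^'n \<Rightarrow> real) \<Rightarrow> bool" where
  "weight w \<longleftrightarrow> (\<forall>x. 0 \<le> w x) \<and> (\<forall>K. compact K \<longrightarrow> set_integrable lebesgue K w)"

text \<open>Size functions \<open>F = |f|\<close> take values in \<open>[0,\<infinity>]\<close>, since maximal functions may be infinite.\<close>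

definition weak_L1_norm :: "(real^'n \<Rightarrow> real) \<Rightarrow> (real^'n \<Rightarrow> ennreal) \<Rightarrow> ennreal" where
  "weak_L1_norm w F =
     (SUP t\<in>{0<..}. ennreal t * (\<integral>\<^sup>+x\<in>{x. ennreal t < F x}. ennreal (w x) \<partial>lebesgue))"

definition luxemburg_norm :: "(real \<Rightarrow> real) \<Rightarrow> (real^'n) set \<Rightarrow> (real^'n \<Rightarrow> real) \<Rightarrow> ennreal" where
  "luxemburg_norm \<Phi> Q f =
     Inf {ennreal r |r. 0 < r \<and>
       (\<integral>\<^sup>+y\<in>Q. ennreal (\<Phi> (\<bar>f y\<bar> / r)) \<partial>lebesgue) / emeasure lebesgue Q \<le> 1}"

definition LlogL_young :: "real \<Rightarrow> real \<Rightarrow> real" where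
  "LlogL_young \<epsilon> t = t * ln (exp 1 + t) powr \<epsilon>"

definition conj_exponent :: "'n::finite itself \<Rightarrow> real" where
  "conj_exponent _ = real CARD('n) / (real CARD('n) - 1)"

definition lorentz_norm :: "(real^'n) set \<Rightarrow> (real^'n \<Rightarrow> complex) \<Rightarrow> ennreal" where
  "lorentz_norm Q f =
    (let n' = conj_exponent TYPE('n) in
     ennreal (measure lebesgue Q powr (- 1 / n') * n') *
     (\<integral>\<^sup>+t\<in>{0<..}. ennreal (measure lebesgue {y\<in>Q. t < norm (f y)} powr (1 / n')) \<partial>lborel))"

section \<open>Maximal functions taken over cubes\<close>

definition hl_maximal :: "(real^'n \<Rightarrow> ennreal) \<Rightarrow> real^'n \<Rightarrow> ennreal" where
  "hl_maximal g x =
     (SUP (a, l)\<in>cubes_at x. (\<integral>\<^sup>+y\<in>cube a l. g y \<partial>lebesgue) / emeasure lebesgue (cube a l))"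

definition frac_maximal_1 :: "(real^'n \<Rightarrow> ennreal) \<Rightarrow> real^'n \<Rightarrow> ennreal" where
  "frac_maximal_1 g x =
     (SUP (a, l)\<in>cubes_at x.
        ennreal l * ((\<integral>\<^sup>+y\<in>cube a l. g y \<partial>lebesgue) / emeasure lebesgue (cube a l)))"

definition orlicz_maximal :: "(real \<Rightarrow> real) \<Rightarrow> (real^'n \<Rightarrow> real) \<Rightarrow> real^'n \<Rightarrow> ennreal" where
  "orlicz_maximal \<Phi> f x = (SUP (a, l)\<in>cubes_at x. luxemburg_norm \<Phi> (cube a l) f)"

definition iterated_maximal :: "nat \<Rightarrow> (real^'n \<Rightarrow> complex) \<Rightarrow> real^'n \<Rightarrow> ennreal" where
  "iterated_maximal k f = (hl_maximal ^^ k) (\<lambda>x. ennreal (norm (f x)))"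

definition lorentz_maximal :: "(real^'n \<Rightarrow> complex) \<Rightarrow> real^'n \<Rightarrow> ennreal" where
  "lorentz_maximal f x = (SUP (a, l)\<in>cubes_at x. lorentz_norm (cube a l) f)"

section \<open>Surface measure and rough kernels\<close>

text \<open>Surface measure on the unit sphere in polar coordinates:
  \<open>\<sigma>(E) = n |{r y : 0 < r < 1, y \<in> E}|\<close> for Borel \<open>E\<close>, completed so that measurability on
  the sphere is up to null sets.\<close>

definition sphere_measure :: "(real^'n) measure" where
  "sphere_measure = completion (scale_measure (of_nat CARD('n))
     (distr (restrict_space lborel (ball 0 1 - {0})) (restrict_space borel (sphere 0 1))
       (\<lambda>x. x /\<^sub>R norm x)))"

definition homogeneous_deg_0 :: "(real^'n \<Rightarrow> complex) \<Rightarrow> bool" where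
  "homogeneous_deg_0 \<Omega> \<longleftrightarrow> (\<forall>r x. 0 < r \<longrightarrow> x \<noteq> 0 \<longrightarrow> \<Omega> (r *\<^sub>R x) = \<Omega> x)"

definition in_weak_Ln_sphere :: "(real^'n \<Rightarrow> complex) \<Rightarrow> bool" where
  "in_weak_Ln_sphere \<Omega> \<longleftrightarrow> \<Omega> \<in> borel_measurable sphere_measure \<and>
     (SUP t\<in>{0<..}. ennreal (t * measure sphere_measure {y\<in>sphere 0 1. t < norm (\<Omega> y)}
        powr (1 / real CARD('n)))) < \<infinity>"

definition mean_zero_sphere :: "(real^'n \<Rightarrow> complex) \<Rightarrow> bool" where
  "mean_zero_sphere \<Omega> \<longleftrightarrow>
     integrable sphere_measure \<Omega> \<and> (LINT y|sphere_measure. \<Omega> y) = 0"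

definition spherical_maximal :: "(real^'n \<Rightarrow> complex) \<Rightarrow> real^'n \<Rightarrow> ennreal" where
  "spherical_maximal f x =
     (SUP t\<in>{0<..}. ennreal (norm (LINT y|sphere_measure. f (x - t *\<^sub>R y))))"

definition rough_maximal :: "(real^'n \<Rightarrow> complex) \<Rightarrow> (real^'n \<Rightarrow> complex) \<Rightarrow> real^'n \<Rightarrow> ennreal" where
  "rough_maximal \<Omega> f x =
     (SUP t\<in>{0<..}. ennreal (1 / t ^ CARD('n)) *
        (\<integral>\<^sup>+y\<in>ball 0 t. ennreal (norm (\<Omega> y * f (x - y))) \<partial>lebesgue))"

definition truncated_rough_integral ::
  "(real^'n \<Rightarrow> complex) \<Rightarrow> real \<Rightarrow> (real^'n \<Rightarrow> complex) \<Rightarrow> real^'n \<Rightarrow> complex" where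
  "truncated_rough_integral \<Omega> t f x =
     (LINT y:{y. t < norm y}|lebesgue. \<Omega> y / of_real (norm y ^ CARD('n)) * f (x - y))"

definition rough_singular_integral ::
  "(real^'n \<Rightarrow> complex) \<Rightarrow> (real^'n \<Rightarrow> complex) \<Rightarrow> real^'n \<Rightarrow> complex" where
  "rough_singular_integral \<Omega> f x =
     Lim (at_right 0) (\<lambda>t. truncated_rough_integral \<Omega> t f x)"

definition maximal_rough_singular_integral ::
  "(real^'n \<Rightarrow> complex) \<Rightarrow> (real^'n \<Rightarrow> complex) \<Rightarrow> real^'n \<Rightarrow> ennreal" where
  "maximal_rough_singular_integral \<Omega> f x =
     (SUP t\<in>{0<..}. ennreal (norm (truncated_rough_integral \<Omega> t f x)))"

section \<open>Test functions\<close>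

definition partial :: "'n \<Rightarrow> (real^'n \<Rightarrow> complex) \<Rightarrow> real^'n \<Rightarrow> complex" where
  "partial i f x = frechet_derivative f (at x) (axis i 1)"

definition gradient :: "(real^'n \<Rightarrow> complex) \<Rightarrow> real^'n \<Rightarrow> complex^'n" where
  "gradient f x = (\<chi> i. partial i f x)"

fun C_k :: "nat \<Rightarrow> (real^'n \<Rightarrow> complex) \<Rightarrow> bool" where
  "C_k 0 f \<longleftrightarrow> continuous_on UNIV f"
| "C_k (Suc k) f \<longleftrightarrow> (\<forall>x. f differentiable (at x)) \<and> (\<forall>i. C_k k (partial i f))"

definition test_function :: "(real^'n \<Rightarrow> complex) \<Rightarrow> bool" where
  "test_function f \<longleftrightarrow> (\<forall>k. C_k k f) \<and> compact (closure {x. f x \<noteq> 0})"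

section \<open>The operators\<close>

text \<open>Each operator is represented by \<open>f \<mapsto> |T f|\<close>, which is all that the weak norm sees.\<close>

inductive listed_operator :: "((real^'n \<Rightarrow> complex) \<Rightarrow> real^'n \<Rightarrow> ennreal) \<Rightarrow> bool" where
  hardy_littlewood: "listed_operator (\<lambda>f. hl_maximal (\<lambda>x. ennreal (norm (f x))))"
| iterated: "1 \<le> k \<Longrightarrow> listed_operator (iterated_maximal k)"
| lorentz: "listed_operator lorentz_maximal"
| spherical: "listed_operator spherical_maximal"
| rough_max: "homogeneous_deg_0 \<Omega> \<Longrightarrow> in_weak_Ln_sphere \<Omega> \<Longrightarrow> listed_operator (rough_maximal \<Omega>)"
| rough_singular: "homogeneous_deg_0 \<Omega> \<Longrightarrow> in_weak_Ln_sphere \<Omega> \<Longrightarrow> mean_zero_sphere \<Omega> \<Longrightarrow>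
    listed_operator (\<lambda>f x. ennreal (norm (rough_singular_integral \<Omega> f x)))"
| rough_singular_max: "homogeneous_deg_0 \<Omega> \<Longrightarrow> in_weak_Ln_sphere \<Omega> \<Longrightarrow> mean_zero_sphere \<Omega> \<Longrightarrow>
    listed_operator (maximal_rough_singular_integral \<Omega>)"

end

theory Submission
  imports Defs
begin

text \<open>All the listed operators are controlled pointwise by one object, the Riesz potential of order one of
the gradient: \<open>|T f(x)| \<le> C I(|\<nabla>f|)(x)\<close> with \<open>I g(x) = \<integral> g(z) |x - z|\<^bsup>1-n\<^esup> dz\<close>. The theorem then follows from
a weighted weak-type inequality for \<open>I\<close> alone, \<open>t w{I g > t} \<le> C \<integral> g M\<^sub>1(M\<^sub>\<Phi> w)\<close> with
\<open>\<Phi>(t) = t log(e + t)\<^bsup>\<epsilon>\<^esup>\<close>.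

The weak-type inequality (\<open>riesz_weak_type\<close>). By the one-third trick \<open>I\<close> is dominated by finitely many
dyadic potentials \<open>\<Sum>\<^sub>d a\<^sub>d(x)\<close>, where \<open>a\<^sub>d(x) = \<ell>(Q) \<langle>g\<rangle>\<^sub>Q\<close> for the dyadic cell \<open>Q\<close> of depth \<open>d\<close> around \<open>x\<close>.
Where some \<open>a\<^sub>d\<close> exceeds \<open>1\<close> the maximal such cells give the bound at once. Elsewhere the cells are
sorted by \<open>2\<^bsup>-k-1\<^esup> < a\<^sub>d \<le> 2\<^bsup>-k\<^esup>\<close>. In one such class the product \<open>\<ell>(Q) \<langle>g\<rangle>\<^sub>Q\<close> is essentially constant, so going
down \<open>j\<close> generations makes the average of \<open>g\<close> grow at least by \<open>2\<^bsup>j-1\<^esup>\<close>; hence the \<open>j\<close>-th generation inside \<open>Q\<close>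
occupies at most the fraction \<open>2\<^bsup>1-j\<^esup>\<close> of \<open>Q\<close>. The logarithm in \<open>\<Phi>\<close> turns this into
\<open>w(Q \<inter> G\<^bsub>2j\<^esub>) \<le> C j\<^bsup>-\<epsilon>\<^esup> \<parallel>w\<parallel>\<^bsub>\<Phi>,Q\<^esub> |Q|\<close> for cells of generation \<open>j\<close>, and since the sets
\<open>G\<^sub>j - G\<^bsub>j+2\<^esub>\<close> overlap at most twice, summing over all \<open>j \<ge> m\<close> costs only \<open>C m\<^bsup>-\<epsilon>\<^esup>\<close> times the integral of
\<open>M\<^sub>\<Phi> w\<close> over the top generation. This is where the composition \<open>M\<^sub>1 \<circ> M\<^sub>\<Phi>\<close>, rather than a single maximal
function, enters. The first \<open>2 m\<^sub>k\<close> generations of class \<open>k\<close>, with \<open>m\<^sub>k\<close> of size \<open>\<surd>2\<^bsup>k\<^esup>\<close>, are absorbed into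
the left-hand side because \<open>\<Sum>\<^sub>k 2\<^bsup>-k\<^esup> m\<^sub>k\<close> converges, and the rest is summable because \<open>\<Sum>\<^sub>k m\<^sub>k\<^bsup>-\<epsilon>\<^esup>\<close> does.

The pointwise bounds, with \<open>g = |\<nabla>f|\<close>. Averaging the fundamental theorem of calculus over segments from \<open>x\<close>
shows that the mean of \<open>|f(y) - f(x)|\<close> over a ball \<open>B\<close> about \<open>x\<close> is at most \<open>C I(g 1\<^sub>B)(x)\<close> (\<open>pointwise_poincare\<close>). This
yields \<open>|f| \<le> C I g\<close>, and as the kernel is an \<open>A\<^sub>1\<close> weight also \<open>M(I g) \<le> C I g\<close>, which settles \<open>M\<close> and its
iterates. The spherical means are integrals of radial derivatives. The other operators use the Lorentz-Poincare inequality
\<open>\<integral>\<^sub>0\<^bsup>\<infinity>\<^esup> |{B : |f - f\<^sub>B| > t}|\<^bsup>1/n'\<^esup> dt \<le> C \<integral>\<^sub>B g\<close> (\<open>lorentz_poincare\<close>). For it the weak-type argument for \<open>I\<close> is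
applied to the smooth truncations \<open>|f - f\<^sub>B|\<^sup>2 / (t\<^sup>2 + |f - f\<^sub>B|\<^sup>2)\<close>, whose gradients integrate in \<open>t\<close> to
at most a multiple of \<open>g\<close>. Paired with weak-\<open>L\<^sup>n\<close> kernels through the Lorentz Holder inequality it bounds
\<open>\<integral>\<^bsub>|y| \<le> s\<^esub> |\<Omega>(y)| |f(x - y) - c\<^sub>s| dy\<close> by \<open>C s \<integral>\<^bsub>B(x,s)\<^esub> g\<close>; averaging over the radius \<open>s\<close> against \<open>ds / s\<^bsup>n+1\<^esup>\<close>
rebuilds the singular kernel, the constants \<open>c\<^sub>s\<close> being removed by the mean-zero condition.\<close>

section \<open>Preliminaries\<close>

lemma ennreal_divide_mult_self:
  fixes X :: ennreal
  assumes "0 < p"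
  shows "X / ennreal p * ennreal p = X"
proof -
  have "X / ennreal p * ennreal p = X * ennreal (inverse p * p)"
    using assms by (simp add: divide_ennreal_def inverse_ennreal mult.assoc flip: ennreal_mult)
  then show ?thesis using assms by simp
qed

lemma ennreal_mult_mult:
  "0 \<le> p \<Longrightarrow> 0 \<le> q \<Longrightarrow> ennreal p * (ennreal q * X) = ennreal (p * q) * X"
  by (simp add: ennreal_mult mult.assoc)

lemma borel_set_lebesgue: "A \<in> sets borel \<Longrightarrow> A \<in> sets lebesgue"
  by (simp add: sets_completionI_sets)

lemma emeasure_cube:
  fixes c :: "real^'n"
  assumes "0 < l"
  shows "emeasure lborel (cube c l) = ennreal (l ^ CARD('n))"
    and "emeasure lborel (box c (c + vec l)) = ennreal (l ^ CARD('n))"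
proof -
  have "vec l \<bullet> b = l" if "b \<in> Basis" for b :: "real^'n"
    using that by (auto simp: Basis_vec_def inner_axis)
  then have 1: "(\<Prod>b\<in>Basis. (c + vec l - c :: real^'n) \<bullet> b) = l ^ CARD('n)"
    by simp
  have "\<forall>b\<in>Basis. c \<bullet> b \<le> (c + vec l) \<bullet> (b::real^'n)"
    using assms by (auto simp: Basis_vec_def inner_axis inner_add_left)
  then show "emeasure lborel (cube c l) = ennreal (l ^ CARD('n))"
     "emeasure lborel (box c (c + vec l)) = ennreal (l ^ CARD('n))"
    using 1 by (simp_all add: cube_def emeasure_lborel_cbox_eq emeasure_lborel_box_eq)
qed

section \<open>Dyadic cells\<close>

text \<open>Cells are described by integer parts, without reference to their corners, so that nesting and
constancy of cell-dependent quantities become statements about floors. Depth \<open>d\<close> means side \<open>L / 2\<^sup>d\<close>; there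
is a coarsest generation of side \<open>L\<close>, so every nonempty set of depths has a first element.\<close>

definition dyadic_cell :: "real^'n \<Rightarrow> real \<Rightarrow> nat \<Rightarrow> real^'n \<Rightarrow> (real^'n) set" where
  "dyadic_cell a L d x = {y. \<forall>i. \<lfloor>(y$i - a$i) * 2^d / L\<rfloor> = \<lfloor>(x$i - a$i) * 2^d / L\<rfloor>}"

definition dyadic_corner :: "real^'n \<Rightarrow> real \<Rightarrow> nat \<Rightarrow> real^'n \<Rightarrow> real^'n" where
  "dyadic_corner a L d x = (\<chi> i. a$i + L / 2^d * of_int \<lfloor>(x$i - a$i) * 2^d / L\<rfloor>)"

text \<open>The number \<open>\<ell>(Q) \<langle>g\<rangle>\<^sub>Q\<close> for the cell \<open>Q\<close> of depth \<open>d\<close> containing \<open>x\<close>. Summed over \<open>d\<close> it is the dyadic model of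
the Riesz potential; its supremum over \<open>d\<close> is the dyadic model of the fractional maximal function \<open>M\<^sub>1\<close>.\<close>

definition dyadic_level :: "real^'n \<Rightarrow> real \<Rightarrow> (real^'n \<Rightarrow> ennreal) \<Rightarrow> nat \<Rightarrow> real^'n \<Rightarrow> ennreal" where
  "dyadic_level a L g d x = ennreal (L / 2^d) *
     ((\<integral>\<^sup>+y\<in>dyadic_cell a L d x. g y \<partial>lebesgue) / ennreal ((L / 2^d) ^ CARD('n)))"

locale dyadic_grid =
  fixes a :: "real^'n" and L :: real
  assumes L_pos: "0 < L"
begin

abbreviation "cell \<equiv> dyadic_cell a L"
abbreviation "corner \<equiv> dyadic_corner a L"
abbreviation "level \<equiv> dyadic_level a L"
abbreviation "side d \<equiv> L / 2 ^ d"

lemma side_pos: "0 < side d"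
  using L_pos by simp

lemma cell_self: "x \<in> cell d x"
  by (simp add: dyadic_cell_def)

lemma cell_eq: "y \<in> cell d x \<Longrightarrow> cell d y = cell d x"
  by (simp add: dyadic_cell_def)

lemma floor_coarser:
  fixes u :: real
  shows "\<lfloor>u\<rfloor> = \<lfloor>2 * u\<rfloor> div 2"
  using floor_divide_real_eq_div[of 2 "2*u"] by simp

lemma cell_Suc_subset: "cell (Suc d) x \<subseteq> cell d x"
proof
  fix y assume y: "y \<in> cell (Suc d) x"
  have "\<lfloor>(y$i - a$i) * 2^d / L\<rfloor> = \<lfloor>(x$i - a$i) * 2^d / L\<rfloor>" for i
  proof -
    have *: "(z$i - a$i) * 2 ^ Suc d / L = 2 * ((z$i - a$i) * 2^d / L)" for z :: "real^'n"
      by simp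
    have "\<lfloor>(y$i - a$i) * 2 ^ Suc d / L\<rfloor> = \<lfloor>(x$i - a$i) * 2 ^ Suc d / L\<rfloor>"
      using y by (simp add: dyadic_cell_def)
    then show ?thesis
      unfolding * by (metis floor_coarser)
  qed
  then show "y \<in> cell d x" by (simp add: dyadic_cell_def)
qed

lemma cell_mono: "d \<le> e \<Longrightarrow> cell e x \<subseteq> cell d x"
  by (induction e rule: dec_induct) (use cell_Suc_subset in blast)+

lemma cell_eq_coarser: "y \<in> cell e x \<Longrightarrow> d \<le> e \<Longrightarrow> cell d y = cell d x"
  using cell_mono cell_eq by blast

lemma corner_eq: "y \<in> cell d x \<Longrightarrow> corner d y = corner d x"
  by (simp add: dyadic_corner_def dyadic_cell_def vec_eq_iff)

lemma level_eq: "y \<in> cell e x \<Longrightarrow> d \<le> e \<Longrightarrow> level g d y = level g d x"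
  using cell_eq_coarser by (simp add: dyadic_level_def)

lemma cell_iff:
  "y \<in> cell d x \<longleftrightarrow> (\<forall>i. corner d x $ i \<le> y$i \<and> y$i < corner d x $ i + side d)"
proof -
  have "(\<lfloor>(y$i - a$i) * 2^d / L\<rfloor> = k) \<longleftrightarrow>
    (a$i + L / 2^d * of_int k \<le> y$i \<and> y$i < a$i + L / 2^d * of_int k + side d)" for i k
    unfolding floor_eq_iff using L_pos by (simp add: field_simps)
  then show ?thesis by (simp add: dyadic_cell_def dyadic_corner_def)
qed

lemma cell_subset_cube: "cell d x \<subseteq> cube (corner d x) (side d)"
  by (auto simp: cell_iff cube_def mem_box_cart less_imp_le)

lemma box_subset_cell: "box (corner d x) (corner d x + vec (side d)) \<subseteq> cell d x"
  by (auto simp: cell_iff mem_box_cart less_imp_le)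

lemma cell_borel[measurable]: "cell d x \<in> sets borel"
proof -
  have "cell d x = (\<Inter>i. {y. corner d x $ i \<le> y$i \<and> y$i < corner d x $ i + side d})"
    by (auto simp: cell_iff)
  also have "\<dots> \<in> sets borel"
    by measurable
  finally show ?thesis .
qed

lemma cell_lebesgue[measurable]: "cell d x \<in> sets lebesgue"
  using cell_borel by (simp add: sets_completionI_sets)

text \<open>Cells are half open, while the maximal functions use closed cubes.\<close>

lemma cell_null_difference: "AE y in lborel. y \<in> cell d x \<longleftrightarrow> y \<in> cube (corner d x) (side d)"
proof -
  let ?Q = "cube (corner d x) (side d)" and ?B = "box (corner d x) (corner d x + vec (side d))"
  have fin: "emeasure lborel ?B \<noteq> \<infinity>"
    using emeasure_cube(2)[where 'n = 'n, OF side_pos] by simp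
  have "emeasure lborel (?Q - ?B) = emeasure lborel ?Q - emeasure lborel ?B"
    by (rule emeasure_Diff) (use fin box_subset_cbox in \<open>auto simp: cube_def\<close>)
  then have "?Q - ?B \<in> null_sets lborel"
    using emeasure_cube[where 'n = 'n, OF side_pos] by (auto simp: null_sets_def cube_def)
  then have "AE y in lborel. y \<notin> ?Q - ?B"
    by (rule AE_not_in)
  then show ?thesis
    by eventually_elim (use box_subset_cell[of d x] cell_subset_cube[of d x] in blast)
qed

lemma cell_integral_eq_cube:
  "(\<integral>\<^sup>+y\<in>cell d x. h y \<partial>lebesgue) = (\<integral>\<^sup>+y\<in>cube (corner d x) (side d). h y \<partial>lebesgue)"
proof -
  have "AE y in lebesgue. h y * indicator (cell d x) y = h y * indicator (cube (corner d x) (side d)) y"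
    using cell_null_difference[of d x, THEN AE_completion] by eventually_elim (auto simp: indicator_def)
  then show ?thesis by (rule nn_integral_cong_AE)
qed

lemma emeasure_cell: "emeasure lebesgue (cell d x) = ennreal (side d ^ CARD('n))"
proof -
  have "emeasure lborel (cell d x) = emeasure lborel (cube (corner d x) (side d))"
    by (rule emeasure_eq_AE) (use cell_null_difference in \<open>auto simp: cube_def\<close>)
  then show ?thesis using emeasure_cube[where 'n = 'n, OF side_pos] by simp
qed

lemma countable_cells: "countable {cell d x |d x. P d x}"
proof -
  define F :: "nat \<times> ('n \<Rightarrow> int) \<Rightarrow> (real^'n) set"
    where "F = (\<lambda>(d, m). {y. \<forall>i. \<lfloor>(y$i - a$i) * 2^d / L\<rfloor> = m i})"
  have "{cell d x |d x. P d x} \<subseteq> range F"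
    by (auto simp: F_def dyadic_cell_def image_iff)
  then show ?thesis
    by (rule countable_subset) simp
qed

lemma adapted_borel:
  assumes "\<And>x y. K x \<Longrightarrow> y \<in> cell d x \<Longrightarrow> K y"
  shows "{x. K x} \<in> sets borel"
proof -
  have "{x. K x} = \<Union>{cell d' x |d' x. d' = d \<and> K x}"
    using assms cell_self by blast
  also have "\<dots> \<in> sets borel"
    by (rule sets.countable_Union[OF countable_cells]) auto
  finally show ?thesis .
qed

text \<open>A predicate \<open>K d x\<close> that depends on \<open>x\<close> only through its cell of depth \<open>d\<close>, and holds for at most one \<open>d\<close> at each
point, selects a countable disjoint family of cells; integrals over its union can be compared cell by cell.
Maximal cells and the cells of a given generation are both of this form.\<close>

lemma cell_compare:
  fixes \<phi> \<psi> :: "real^'n \<Rightarrow> ennreal"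
  assumes adapted: "\<And>d x y. K d x \<Longrightarrow> y \<in> cell d x \<Longrightarrow> K d y"
    and unique: "\<And>d e x. K d x \<Longrightarrow> K e x \<Longrightarrow> d = e"
    and meas: "\<phi> \<in> borel_measurable lebesgue" "\<psi> \<in> borel_measurable lebesgue"
    and le: "\<And>d x. K d x \<Longrightarrow>
      (\<integral>\<^sup>+y\<in>cell d x. \<phi> y \<partial>lebesgue) \<le> (\<integral>\<^sup>+y\<in>cell d x. \<psi> y \<partial>lebesgue)"
  shows "(\<integral>\<^sup>+x\<in>{x. \<exists>d. K d x}. \<phi> x \<partial>lebesgue) \<le> (\<integral>\<^sup>+x\<in>{x. \<exists>d. K d x}. \<psi> x \<partial>lebesgue)"
proof -
  let ?C = "{cell d x |d x. K d x}"
  have U: "{x. \<exists>d. K d x} = \<Union>(id ` ?C)"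
    using adapted cell_self by fastforce
  have disj: "disjoint_family_on id ?C"
    unfolding disjoint_family_on_def
  proof (intro ballI impI)
    fix C D assume "C \<in> ?C" "D \<in> ?C" and ne: "C \<noteq> D"
    then obtain d x e y where K: "K d x" "K e y" and C: "C = cell d x" "D = cell e y" by blast
    have False if z: "z \<in> C" "z \<in> D" for z
    proof -
      have "d = e" using adapted K z C unique by blast
      then show False using z C ne cell_eq[of z d x] cell_eq[of z e y] by simp
    qed
    then show "id C \<inter> id D = {}" by auto
  qed
  have *: "(\<integral>\<^sup>+x\<in>{x. \<exists>d. K d x}. f x \<partial>lebesgue) =
      (\<integral>\<^sup>+C. (\<integral>\<^sup>+x\<in>C. f x \<partial>lebesgue) \<partial>count_space ?C)"
    if f: "f \<in> borel_measurable lebesgue" for f :: "real^'n \<Rightarrow> ennreal"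
  proof -
    have s: "id C \<in> sets (density lebesgue f)" if "C \<in> ?C" for C
      using that cell_lebesgue by auto
    have "emeasure (density lebesgue f) (\<Union>(id ` ?C)) =
        (\<integral>\<^sup>+C. emeasure (density lebesgue f) (id C) \<partial>count_space ?C)"
      by (rule emeasure_UN_countable[OF s countable_cells disj])
    moreover have "emeasure (density lebesgue f) (\<Union>(id ` ?C)) = (\<integral>\<^sup>+x\<in>{x. \<exists>d. K d x}. f x \<partial>lebesgue)"
      unfolding U using f s countable_cells by (subst emeasure_density) (auto intro!: sets.countable_Union)
    moreover have "(\<integral>\<^sup>+C. emeasure (density lebesgue f) (id C) \<partial>count_space ?C) =
      (\<integral>\<^sup>+C. (\<integral>\<^sup>+x\<in>C. f x \<partial>lebesgue) \<partial>count_space ?C)"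
      by (rule nn_integral_cong) (use s f in \<open>auto simp: emeasure_density\<close>)
    ultimately show ?thesis by simp
  qed
  show ?thesis
    unfolding *[OF meas(1)] *[OF meas(2)]
    by (rule nn_integral_mono) (use le in auto)
qed

end

section \<open>The logarithmic gain on small subsets\<close>

text \<open>Split \<open>w\<close> at height \<open>r s\<close>, where \<open>r\<close> is admissible in the Luxemburg norm. Below that height \<open>w\<close> contributes at
most \<open>r s |F|\<close>; above it, \<open>w / r\<close> is smaller than \<open>\<Phi>(w / r)\<close> by the factor \<open>log(e + s)\<^bsup>\<epsilon>\<^esup>\<close>.\<close>

lemma luxemburg_small_set:
  fixes w :: "real^'n \<Rightarrow> real" and Q F :: "(real^'n) set"
  assumes w: "\<And>x. 0 \<le> w x" "w \<in> borel_measurable lebesgue"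
    and Q: "Q \<in> sets lebesgue" "emeasure lebesgue Q = ennreal q" "0 < q"
    and F: "F \<in> sets lebesgue" "F \<subseteq> Q" and s: "0 \<le> s" and \<epsilon>: "0 < \<epsilon>"
  shows "(\<integral>\<^sup>+y\<in>F. ennreal (w y) \<partial>lebesgue) \<le>
    (ennreal s * emeasure lebesgue F + ennreal (1 / ln (exp 1 + s) powr \<epsilon>) * emeasure lebesgue Q)
      * luxemburg_norm (LlogL_young \<epsilon>) Q w"
proof -
  let ?K = "1 / ln (exp 1 + s) powr \<epsilon>" and ?I = "\<integral>\<^sup>+y\<in>F. ennreal (w y) \<partial>lebesgue"
  let ?N = "luxemburg_norm (LlogL_young \<epsilon>) Q w"
  note w(2)[measurable] Q(1)[measurable] F(1)[measurable]
  have ln1: "1 \<le> ln (exp 1 + t)" if "0 \<le> t" for t :: real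
    using that by (subst ln_ge_iff) (auto intro: add_pos_nonneg)
  have "emeasure lebesgue F \<le> ennreal q"
    using emeasure_mono[OF F(2) Q(1)] Q(2) by simp
  then obtain p where p: "emeasure lebesgue F = ennreal p" "0 \<le> p"
    by (metis ennreal_cases ennreal_neq_top top.extremum_unique)
  define c where "c = s * p + ?K * q"
  have K: "0 < ?K" using ln1[OF s] by simp
  have c: "0 < c" using s p K Q(3) by (auto simp: c_def intro!: add_nonneg_pos)
  have coef: "ennreal s * emeasure lebesgue F + ennreal ?K * emeasure lebesgue Q = ennreal c"
    unfolding c_def p(1) Q(2) using s p(2) less_imp_le[OF K] less_imp_le[OF Q(3)]
    by (simp only: ennreal_mult ennreal_plus mult_nonneg_nonneg)
  have meas: "(\<lambda>y. ennreal (LlogL_young \<epsilon> (\<bar>w y\<bar> / r))) \<in> borel_measurable lebesgue" for r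
    unfolding LlogL_young_def by measurable
  have "?I / ennreal c \<le> ?N"
    unfolding luxemburg_norm_def
  proof (rule Inf_greatest, safe)
    fix r :: real assume r: "0 < r"
      and adm: "(\<integral>\<^sup>+y\<in>Q. ennreal (LlogL_young \<epsilon> (\<bar>w y\<bar> / r)) \<partial>lebesgue) / emeasure lebesgue Q \<le> 1"
    let ?J = "\<integral>\<^sup>+y\<in>Q. ennreal (LlogL_young \<epsilon> (\<bar>w y\<bar> / r)) \<partial>lebesgue"
    have J: "?J \<le> ennreal q"
      using mult_right_mono[OF adm, of "ennreal q"] Q by (simp add: ennreal_divide_mult_self)
    have pt: "w y \<le> r * (s + ?K * LlogL_young \<epsilon> (\<bar>w y\<bar> / r))" for y
    proof -
      define u where "u = w y / r"
      have u: "0 \<le> u" "w y = r * u" "\<bar>w y\<bar> / r = u" using w(1)[of y] r by (auto simp: u_def)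
      have "u \<le> s + ?K * LlogL_young \<epsilon> u"
      proof (cases "u \<le> s")
        case True
        then show ?thesis using K u(1) ln1[OF u(1)]
          by (auto simp: LlogL_young_def intro!: add_increasing2 mult_nonneg_nonneg)
      next
        case False
        have "ln (exp 1 + s) powr \<epsilon> \<le> ln (exp 1 + u) powr \<epsilon>"
          using False s \<epsilon> ln1[OF s] by (intro powr_mono2) (auto simp: add_pos_nonneg intro: add_increasing2)
        then have "1 \<le> ?K * ln (exp 1 + u) powr \<epsilon>"
          using ln1[OF s] by (simp add: field_simps)
        then have "u * 1 \<le> u * (?K * ln (exp 1 + u) powr \<epsilon>)"
          using u(1) by (rule mult_left_mono)
        then show ?thesis using s by (simp add: LlogL_young_def mult_ac)
      qed
      then show ?thesis unfolding u(3) unfolding u(2) using r by (intro mult_left_mono) auto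
    qed
    have L0: "0 \<le> LlogL_young \<epsilon> (\<bar>w y\<bar> / r)" for y
      using r ln1[of "\<bar>w y\<bar> / r"] by (auto simp: LlogL_young_def)
    have "?I \<le> (\<integral>\<^sup>+y. ennreal (r * s) * indicator F y
        + ennreal (r * ?K) * (ennreal (LlogL_young \<epsilon> (\<bar>w y\<bar> / r)) * indicator Q y) \<partial>lebesgue)"
    proof (rule nn_integral_mono)
      fix y
      have "ennreal (w y) \<le> ennreal (r * s) + ennreal (r * ?K) * ennreal (LlogL_young \<epsilon> (\<bar>w y\<bar> / r))"
      proof -
        have nn: "0 \<le> r * s" "0 \<le> r * ?K" "0 \<le> r * ?K * LlogL_young \<epsilon> (\<bar>w y\<bar> / r)"
          using r s less_imp_le[OF K] L0[of y] by (intro mult_nonneg_nonneg; simp)+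
        have "w y \<le> r * s + r * ?K * LlogL_young \<epsilon> (\<bar>w y\<bar> / r)"
          using pt[of y] by (simp only: distrib_left mult.assoc)
        then show ?thesis
          by (simp only: ennreal_mult[OF nn(2) L0, symmetric] ennreal_plus[OF nn(1,3), symmetric] ennreal_leI)
      qed
      then show "ennreal (w y) * indicator F y \<le> ennreal (r * s) * indicator F y
        + ennreal (r * ?K) * (ennreal (LlogL_young \<epsilon> (\<bar>w y\<bar> / r)) * indicator Q y)"
        using F(2) by (auto simp: indicator_def)
    qed
    also have "\<dots> = ennreal (r * s) * emeasure lebesgue F + ennreal (r * ?K) * ?J"
      using meas by (simp add: nn_integral_add nn_integral_cmult)
    also have "\<dots> \<le> ennreal (r * s) * ennreal p + ennreal (r * ?K) * ennreal q"
      using J p by (intro add_mono mult_left_mono) auto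
    also have "\<dots> = ennreal r * ennreal c"
      using r s K p Q(3) by (simp add: c_def ennreal_plus[symmetric] ennreal_mult[symmetric] algebra_simps
        del: ennreal_plus)
    finally show "?I / ennreal c \<le> ennreal r"
      using c by (intro divide_le_posI_ennreal) (auto simp: mult.commute)
  qed
  then have "?I / ennreal c * ennreal c \<le> ?N * ennreal c" by (rule mult_right_mono) simp
  then show ?thesis unfolding coef ennreal_divide_mult_self[OF c] by (simp only: mult.commute)
qed

text \<open>With \<open>|F| \<le> 2\<^bsup>1-i\<^esup> |Q|\<close> the height \<open>s = 2\<^bsup>i/2\<^esup>\<close> balances the two terms of the preceding estimate: the first
decays exponentially in \<open>i\<close>, the second like \<open>i\<^bsup>-\<epsilon>\<^esup>\<close>.\<close>

lemma log_bump_gain: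
  fixes \<epsilon> :: real
  assumes "0 < \<epsilon>"
  obtains C where "0 < C"
    "\<And>i. 1 \<le> i \<Longrightarrow> 2 powr (real i / 2) * (2 / 2 ^ i) + 1 / ln (exp 1 + 2 powr (real i / 2)) powr \<epsilon>
       \<le> C * real i powr - \<epsilon>"
proof -
  define B where "B = 2 * \<epsilon> powr \<epsilon> * (ln 2 / 2) powr - \<epsilon>"
  have B: "real i powr \<epsilon> * (2 * 2 powr (- real i / 2)) \<le> B" if i: "1 \<le> i" for i
  proof -
    have "(ln (2 powr (real i / 2))) powr \<epsilon> \<le> \<epsilon> powr \<epsilon> * 2 powr (real i / 2)"
      by (rule ln_powr_bound2) (use i assms in auto)
    also have "ln (2 powr (real i / 2)) = (ln 2 / 2) * real i" by (simp add: ln_powr)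
    finally have "(ln 2 / 2) powr \<epsilon> * real i powr \<epsilon> \<le> \<epsilon> powr \<epsilon> * 2 powr (real i / 2)"
      by (simp only: powr_mult)
    then show ?thesis by (simp add: B_def powr_minus field_simps)
  qed
  define C where "C = B + (ln 2 / 2) powr - \<epsilon>"
  have C: "0 < C" by (simp add: C_def B_def add_nonneg_pos)
  moreover have "2 powr (real i / 2) * (2 / 2 ^ i) + 1 / ln (exp 1 + 2 powr (real i / 2)) powr \<epsilon>
       \<le> C * real i powr - \<epsilon>" if i: "1 \<le> i" for i :: nat
  proof -
    have e: "2 powr (real i / 2) * (2 / 2 ^ i) = 2 * 2 powr (- real i / 2)"
      by (simp add: powr_realpow[symmetric] field_simps flip: powr_add)
    have "2 * 2 powr (- real i / 2) \<le> B * real i powr - \<epsilon>"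
      using B[of i] i by (simp add: powr_minus field_simps)
    moreover have "(ln 2 / 2 * real i) powr \<epsilon> \<le> ln (exp 1 + 2 powr (real i / 2)) powr \<epsilon>"
    proof (rule powr_mono2)
      have "ln (2 powr (real i / 2)) \<le> ln (exp 1 + 2 powr (real i / 2))"
        by (subst ln_le_cancel_iff) (auto simp: add_pos_pos)
      then show "ln 2 / 2 * real i \<le> ln (exp 1 + 2 powr (real i / 2))"
        by (simp add: ln_powr mult.commute)
    qed (use assms in auto)
    then have "1 / ln (exp 1 + 2 powr (real i / 2)) powr \<epsilon> \<le> (ln 2 / 2 * real i) powr - \<epsilon>"
      using i by (simp add: powr_minus_divide frac_le)
    moreover have "(ln 2 / 2 * real i) powr - \<epsilon> = (ln 2 / 2) powr - \<epsilon> * real i powr - \<epsilon>"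
      by (rule powr_mult)
    ultimately show ?thesis unfolding e C_def distrib_right by linarith
  qed
  ultimately show ?thesis using that by blast
qed

section \<open>Strata of a dyadic potential and their generations\<close>

text \<open>The rank of an element of a set of naturals is the number of smaller elements; ranks below the size of an
initial segment are attained inside that segment.\<close>

lemma rank_exists:
  fixes P :: "nat \<Rightarrow> bool"
  assumes "i < card {e. e < D \<and> P e}"
  shows "\<exists>d<D. P d \<and> card {e. e < d \<and> P e} = i"
  using assms
proof (induction D)
  case (Suc D)
  have *: "{e. e < Suc D \<and> P e} = (if P D then insert D {e. e < D \<and> P e} else {e. e < D \<and> P e})"
    by (auto simp: less_Suc_eq)
  show ?case
  proof (cases "i < card {e. e < D \<and> P e}")
    case True
    then show ?thesis using Suc.IH less_SucI by blast
  next
    case False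
    then have "P D \<and> card {e. e < D \<and> P e} = i"
      using Suc.prems unfolding * by (auto split: if_splits)
    then show ?thesis by blast
  qed
qed simp

lemma count_le_ranks:
  fixes P :: "nat \<Rightarrow> bool"
  shows "(\<Sum>d. indicator {d. P d} d :: ennreal) \<le> (\<Sum>i. indicator {i. \<exists>d. P d \<and> card {e. e < d \<and> P e} = i} i)"
    (is "_ \<le> ?S")
proof (rule suminf_le_const)
  fix D
  let ?c = "card {e. e < D \<and> P e}"
  have "(\<Sum>d<D. indicator {d. P d} d :: ennreal) = of_nat (card ({..<D} \<inter> {d. P d}))"
    by (simp add: indicator_def sum.If_cases)
  also have "{..<D} \<inter> {d. P d} = {e. e < D \<and> P e}" by auto
  also have "of_nat ?c = (\<Sum>i<?c. 1 :: ennreal)" by simp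
  also have "\<dots> = (\<Sum>i<?c. indicator {i. \<exists>d. P d \<and> card {e. e < d \<and> P e} = i} i)"
    by (rule sum.cong) (use rank_exists[of _ D P] in \<open>auto simp: indicator_def\<close>)
  also have "\<dots> \<le> ?S" by (rule sum_le_suminf) auto
  finally show "(\<Sum>d<D. indicator {d. P d} d) \<le> ?S" .
qed simp

context dyadic_grid
begin

lemma level_integral:
  "level g d x * emeasure lebesgue (cell d x) = ennreal (side d) * (\<integral>\<^sup>+y\<in>cell d x. g y \<partial>lebesgue)"
proof -
  have p: "0 < side d ^ CARD('n)" using side_pos by simp
  show ?thesis
    unfolding emeasure_cell dyadic_level_def mult.assoc ennreal_divide_mult_self[OF p] ..
qed

text \<open>A cell \<open>Q'\<close> of depth at least \<open>d + m\<close> inside \<open>Q\<close> has \<open>\<ell>(Q') \<le> 2\<^bsup>-m\<^esup> \<ell>(Q)\<close>. If its level is at least half that of \<open>Q\<close>,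
then its average of \<open>g\<close> is at least \<open>2\<^bsup>m-1\<^esup>\<close> times that of \<open>Q\<close>, and comparing integrals of \<open>g\<close> over the maximal
such cells bounds their total measure. This is the sparseness of the generations introduced below.\<close>

lemma small_descendants:
  assumes g: "g \<in> borel_measurable lebesgue" and lev: "level g d x \<le> ennreal (1 / 2 ^ k)"
  shows "emeasure lebesgue {y \<in> cell d x. \<exists>e\<ge>d+m. ennreal (1 / 2 ^ Suc k) < level g e y}
    \<le> ennreal (2 / 2 ^ m) * emeasure lebesgue (cell d x)" (is "emeasure _ ?F \<le> _")
proof -
  let ?Q = "cell d x"
  define c where "c = ennreal (1 / 2 ^ Suc k)"
  define K where "K e y \<longleftrightarrow> y \<in> ?Q \<and> d + m \<le> e \<and> c < level g e y \<and>
    (\<forall>e'. d + m \<le> e' \<and> e' < e \<longrightarrow> \<not> c < level g e' y)" for e y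
  have F: "?F = {y. \<exists>e. K e y}"
  proof (intro set_eqI iffI)
    fix y assume "y \<in> ?F"
    then have y: "y \<in> ?Q" and ex: "\<exists>e. d + m \<le> e \<and> c < level g e y" by (auto simp: c_def)
    from LeastI_ex[OF ex] not_less_Least[of _ "\<lambda>e. d + m \<le> e \<and> c < level g e y"] y
    have "K (LEAST e. d + m \<le> e \<and> c < level g e y) y" unfolding K_def by blast
    then show "y \<in> {y. \<exists>e. K e y}" by blast
  qed (auto simp: K_def c_def)
  have adapted: "K e z" if "K e y" "z \<in> cell e y" for e y z
  proof -
    have "d \<le> e" and y: "cell d y = ?Q" using that(1) by (auto simp: K_def cell_eq)
    then have "z \<in> ?Q" using cell_self[of z d] cell_eq_coarser[OF that(2)] by simp
    moreover have "level g e' z = level g e' y" if "e' \<le> e" for e'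
      using level_eq \<open>z \<in> cell e y\<close> that .
    ultimately show ?thesis using that(1) by (simp add: K_def)
  qed
  have unique: "e = e'" if "K e y" "K e' y" for e e' y
  proof -
    have *: False if "K e y" "K e' y" "e < e'" for e e' using that unfolding K_def by blast
    show ?thesis using *[of e e'] *[of e' e] that by (cases e e' rule: linorder_cases) auto
  qed
  define C where "C = ennreal (2 ^ Suc k * (side d / 2 ^ m))"
  have percell: "(\<integral>\<^sup>+z\<in>cell e y. 1 \<partial>lebesgue) \<le> (\<integral>\<^sup>+z\<in>cell e y. C * g z \<partial>lebesgue)" if K: "K e y" for e y
  proof -
    let ?I = "\<integral>\<^sup>+z\<in>cell e y. g z \<partial>lebesgue"
    have "c * emeasure lebesgue (cell e y) \<le> ennreal (side e) * ?I"
      unfolding level_integral[symmetric] using K by (intro mult_right_mono) (auto simp: K_def)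
    then have "ennreal (2 ^ Suc k) * (c * emeasure lebesgue (cell e y)) \<le> ennreal (2 ^ Suc k) * (ennreal (side e) * ?I)"
      by (rule mult_left_mono) simp
    also have "ennreal (2 ^ Suc k) * (c * emeasure lebesgue (cell e y)) = emeasure lebesgue (cell e y)"
      unfolding c_def by (subst ennreal_mult_mult) simp_all
    also have "side e \<le> side d / 2 ^ m"
      using K L_pos by (auto simp: K_def power_add[symmetric] intro!: divide_left_mono power_increasing)
    then have "2 ^ Suc k * side e \<le> 2 ^ Suc k * (side d / 2 ^ m)" by (intro mult_left_mono) auto
    then have "ennreal (2 ^ Suc k) * ennreal (side e) \<le> C"
      unfolding C_def using L_pos by (subst ennreal_mult[symmetric]) (auto intro: ennreal_leI)
    then have "ennreal (2 ^ Suc k) * (ennreal (side e) * ?I) \<le> C * ?I"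
      unfolding mult.assoc[symmetric] by (rule mult_right_mono) simp
    also have "C * ?I = (\<integral>\<^sup>+z. C * (g z * indicator (cell e y) z) \<partial>lebesgue)"
      using g by (intro nn_integral_cmult[symmetric] borel_measurable_times_ennreal borel_measurable_indicator cell_lebesgue)
    finally show ?thesis
      using cell_lebesgue by (simp add: mult.assoc)
  qed
  have Fs: "?F \<in> sets lebesgue"
  proof -
    have "{y. \<exists>e. K e y} = (\<Union>e. {y. K e y})" by auto
    also have "\<dots> \<in> sets borel" using adapted by (intro sets.countable_UN) (auto intro: adapted_borel)
    finally show ?thesis unfolding F by (simp add: sets_completionI_sets)
  qed
  have "emeasure lebesgue ?F = (\<integral>\<^sup>+y\<in>?F. 1 \<partial>lebesgue)"
    unfolding mult_1 nn_integral_indicator[OF Fs] ..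
  also have "\<dots> \<le> (\<integral>\<^sup>+y\<in>?F. C * g y \<partial>lebesgue)"
    unfolding F
  proof (rule cell_compare[where K = K])
    show "(\<lambda>y. C * g y) \<in> borel_measurable lebesgue"
      using g by (rule borel_measurable_times_ennreal[OF borel_measurable_const])
  qed (fact adapted, fact unique, simp, fact percell)
  also have "\<dots> \<le> (\<integral>\<^sup>+y. C * (g y * indicator ?Q y) \<partial>lebesgue)"
    by (rule nn_integral_mono) (auto simp: indicator_def)
  also have "\<dots> = C * (\<integral>\<^sup>+y\<in>?Q. g y \<partial>lebesgue)"
    using g by (intro nn_integral_cmult borel_measurable_times_ennreal borel_measurable_indicator cell_lebesgue)
  also have "C = ennreal (2 ^ Suc k / 2 ^ m) * ennreal (side d)"
    using L_pos unfolding C_def by (subst ennreal_mult[symmetric]) simp_all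
  also have "\<dots> * (\<integral>\<^sup>+y\<in>?Q. g y \<partial>lebesgue) = ennreal (2 ^ Suc k / 2 ^ m) * (level g d x * emeasure lebesgue ?Q)"
    unfolding level_integral mult.assoc ..
  also have "\<dots> \<le> ennreal (2 ^ Suc k / 2 ^ m) * (ennreal (1 / 2 ^ k) * emeasure lebesgue ?Q)"
    by (intro mult_left_mono mult_right_mono lev) auto
  also have "\<dots> = ennreal (2 / 2 ^ m) * emeasure lebesgue ?Q"
    by (subst ennreal_mult_mult) simp_all
  finally show ?thesis .
qed

definition stratum :: "(real^'n \<Rightarrow> ennreal) \<Rightarrow> nat \<Rightarrow> nat \<Rightarrow> real^'n \<Rightarrow> bool" where
  "stratum g k d x \<longleftrightarrow> ennreal (1 / 2 ^ Suc k) < level g d x \<and> level g d x \<le> ennreal (1 / 2 ^ k)"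

text \<open>Only ancestors in the same stratum are counted. Consecutive generations may be many scales apart,
but a point that lies in \<open>N\<close> cells of the stratum lies in one cell of each of the generations \<open>0, ..., N - 1\<close>.\<close>

definition generation :: "(real^'n \<Rightarrow> ennreal) \<Rightarrow> nat \<Rightarrow> nat \<Rightarrow> nat \<Rightarrow> real^'n \<Rightarrow> bool" where
  "generation g k i d x \<longleftrightarrow> stratum g k d x \<and> card {e. e < d \<and> stratum g k e x} = i"

definition generation_set :: "(real^'n \<Rightarrow> ennreal) \<Rightarrow> nat \<Rightarrow> nat \<Rightarrow> (real^'n) set" where
  "generation_set g k i = {x. \<exists>d. generation g k i d x}"

lemma stratum_adapted: "y \<in> cell e x \<Longrightarrow> d \<le> e \<Longrightarrow> stratum g k d y = stratum g k d x"
  by (simp add: stratum_def level_eq)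

lemma generation_adapted: "generation g k i d x \<Longrightarrow> y \<in> cell d x \<Longrightarrow> generation g k i d y"
proof -
  assume "generation g k i d x" "y \<in> cell d x"
  moreover from this have "{e. e < d \<and> stratum g k e y} = {e. e < d \<and> stratum g k e x}"
    using stratum_adapted by (metis order_less_imp_le)
  ultimately show ?thesis by (simp add: generation_def stratum_adapted)
qed

text \<open>Each generation step costs at least one dyadic scale.\<close>

lemma generation_depth:
  assumes d: "generation g k i d x" and e: "generation g k j e x" and "i < j"
  shows "d + (j - i) \<le> e"
proof -
  have "{l. l < e \<and> stratum g k l x} \<subseteq> {l. l < d \<and> stratum g k l x} \<union> {d..<e}" by auto
  then have "card {l. l < e \<and> stratum g k l x} \<le> card ({l. l < d \<and> stratum g k l x} \<union> {d..<e})"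
    by (intro card_mono) auto
  also have "\<dots> \<le> card {l. l < d \<and> stratum g k l x} + card {d..<e}"
    by (rule card_Un_le)
  finally show ?thesis using assms by (auto simp: generation_def)
qed

lemma generation_unique:
  assumes d: "generation g k i d x" and e: "generation g k i e x"
  shows "d = e"
proof -
  have *: False if "generation g k i d x" "generation g k i e x" "d < e" for d e
  proof -
    have "{l. l < d \<and> stratum g k l x} \<subset> {l. l < e \<and> stratum g k l x}"
      using that by (auto simp: generation_def)
    then have "card {l. l < d \<and> stratum g k l x} < card {l. l < e \<and> stratum g k l x}"
      by (intro psubset_card_mono) auto
    then show False using that by (simp add: generation_def)
  qed
  show ?thesis using *[of d e] *[of e d] d e by (meson linorder_neqE_nat)
qed

lemma generation_set_borel: "generation_set g k i \<in> sets borel"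
proof -
  have "generation_set g k i = (\<Union>d. {x. generation g k i d x})" by (auto simp: generation_set_def)
  also have "\<dots> \<in> sets borel"
    by (intro sets.countable_UN) (auto intro: adapted_borel generation_adapted)
  finally show ?thesis .
qed

lemma generation_set_lebesgue: "generation_set g k i \<in> sets lebesgue"
  using generation_set_borel by (simp add: sets_completionI_sets)

lemma generation_set_antimono: "i \<le> j \<Longrightarrow> generation_set g k j \<subseteq> generation_set g k i"
proof
  fix x assume "i \<le> j" "x \<in> generation_set g k j"
  then obtain d where d: "generation g k j d x" by (auto simp: generation_set_def)
  show "x \<in> generation_set g k i"
  proof (cases "i = j")
    case False
    then have "i < card {e. e < d \<and> stratum g k e x}" using \<open>i \<le> j\<close> d by (simp add: generation_def)
    from rank_exists[OF this] show ?thesis by (auto simp: generation_set_def generation_def)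
  qed (use \<open>x \<in> _\<close> in simp)
qed

lemma generation_set_small:
  assumes g: "g \<in> borel_measurable lebesgue" and gen: "generation g k i d x" and "i < j"
  shows "emeasure lebesgue (cell d x \<inter> generation_set g k j) \<le> ennreal (2 / 2 ^ (j - i)) * emeasure lebesgue (cell d x)"
proof -
  let ?F = "{y \<in> cell d x. \<exists>e\<ge>d+(j-i). ennreal (1 / 2 ^ Suc k) < level g e y}"
  have "cell d x \<inter> generation_set g k j \<subseteq> ?F"
  proof safe
    fix y assume y: "y \<in> cell d x" "y \<in> generation_set g k j"
    then obtain e where e: "generation g k j e y" by (auto simp: generation_set_def)
    have "d + (j - i) \<le> e"
      using generation_depth[OF generation_adapted[OF gen y(1)] e \<open>i < j\<close>] .
    then show "\<exists>e\<ge>d+(j-i). ennreal (1 / 2 ^ Suc k) < level g e y"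
      using e by (auto simp: generation_def stratum_def)
  qed
  moreover have "?F \<in> sets lebesgue"
  proof -
    have "?F = cell d x \<inter> (\<Union>e\<in>{d+(j-i)..}. {y. ennreal (1 / 2 ^ Suc k) < level g e y})" by auto
    moreover have "{y. ennreal (1 / 2 ^ Suc k) < level g e y} \<in> sets borel" for e
    proof (rule adapted_borel[where d = e])
      fix x y assume "ennreal (1 / 2 ^ Suc k) < level g e x" "y \<in> cell e x"
      then show "ennreal (1 / 2 ^ Suc k) < level g e y" using level_eq[of y e x e g] by simp
    qed
    ultimately have "?F \<in> sets borel"
      by (simp only:) (intro sets.Int cell_borel sets.countable_UN'' countableI_type)
    then show ?thesis by (rule borel_set_lebesgue)
  qed
  ultimately have "emeasure lebesgue (cell d x \<inter> generation_set g k j) \<le> emeasure lebesgue ?F"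
    by (rule emeasure_mono)
  also have "\<dots> \<le> ennreal (2 / 2 ^ (j - i)) * emeasure lebesgue (cell d x)"
    using gen by (intro small_descendants[OF g]) (simp add: generation_def stratum_def)
  finally show ?thesis .
qed

text \<open>The sets \<open>G\<^sub>i\<close> decrease, so a point lies in \<open>G\<^sub>i - G\<^bsub>i+2\<^esub>\<close> for at most two indices.\<close>

lemma sum_gen_differences:
  "(\<Sum>i. indicator (generation_set g k (i + m) - generation_set g k (i + m + 2)) x :: ennreal) \<le> 2 * indicator (generation_set g k 0) x"
proof (cases "\<exists>i. x \<in> generation_set g k (i + m) - generation_set g k (i + m + 2)")
  case True
  define P where "P i \<longleftrightarrow> x \<in> generation_set g k (i + m) - generation_set g k (i + m + 2)" for i
  define i0 where "i0 = (LEAST i. P i)"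
  have "\<exists>i. P i" using True by (simp only: P_def)
  then have i0: "P i0" unfolding i0_def by (rule LeastI_ex)
  have near: "i \<in> {i0, Suc i0}" if "P i" for i
  proof -
    have "i0 \<le> i" unfolding i0_def using that by (rule Least_le)
    moreover have "i < i0 + 2"
    proof (rule ccontr)
      assume "\<not> i < i0 + 2"
      then have "generation_set g k (i + m) \<subseteq> generation_set g k (i0 + m + 2)" by (intro generation_set_antimono) simp
      then show False using that i0 by (auto simp: P_def)
    qed
    ultimately show ?thesis by auto
  qed
  have "(\<Sum>i. indicator (generation_set g k (i + m) - generation_set g k (i + m + 2)) x :: ennreal) \<le> 2"
  proof (rule suminf_le_const)
    fix N
    have "(\<Sum>i<N. indicator (generation_set g k (i + m) - generation_set g k (i + m + 2)) x :: ennreal)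
        = of_nat (card ({..<N} \<inter> {i. P i}))"
      by (simp add: indicator_def sum.If_cases P_def)
    also have "\<dots> \<le> of_nat (card {i0, Suc i0})"
      by (intro of_nat_mono card_mono) (use near in auto)
    finally show "(\<Sum>i<N. indicator (generation_set g k (i + m) - generation_set g k (i + m + 2)) x :: ennreal) \<le> 2" by simp
  qed simp
  moreover have "x \<in> generation_set g k 0" using i0 generation_set_antimono[of 0 "i0 + m" g k] by (auto simp: P_def)
  ultimately show ?thesis by simp
next
  case False
  then have "indicator (generation_set g k (i + m) - generation_set g k (i + m + 2)) x = (0 :: ennreal)" for i
    by (intro indicator_simps(2)) blast
  then show ?thesis by (simp only: suminf_zero zero_le)
qed

text \<open>The measure estimate compares generation \<open>i\<close> with generation \<open>2 i\<close>, so only even generations are kept, at the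
cost of a factor two; the first \<open>2 m\<close> generations are split off.\<close>

lemma sum_gen_even:
  "(\<Sum>i. indicator (generation_set g k i) x :: ennreal) \<le>
    of_nat (2 * m) + 2 * (\<Sum>i. indicator (generation_set g k (2 * (i + m))) x)"
proof -
  let ?f = "\<lambda>i. indicator (generation_set g k i) x :: ennreal"
  have "(\<Sum>i. ?f i) \<le> (\<Sum>i. 2 * ?f (2 * i))"
  proof (rule suminf_le_const)
    fix N
    have odd: "?f (Suc (2 * i)) \<le> ?f (2 * i)" for i
      using generation_set_antimono[of "2*i" "Suc (2*i)" g k] by (auto simp: indicator_def)
    have "sum ?f {..<2*N} \<le> (\<Sum>i<N. 2 * ?f (2 * i))"
    proof (induction N)
      case (Suc N)
      have "sum ?f {..<2 * Suc N} = sum ?f {..<2*N} + ?f (2 * N) + ?f (Suc (2 * N))" by simp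
      also have "\<dots> \<le> (\<Sum>i<N. 2 * ?f (2 * i)) + ?f (2*N) + ?f (2*N)"
        by (intro add_mono Suc.IH odd order_refl)
      finally show ?case by (simp add: mult_2 add.assoc)
    qed simp
    moreover have "sum ?f {..<N} \<le> sum ?f {..<2*N}" by (rule sum_mono2) auto
    moreover have "(\<Sum>i<N. 2 * ?f (2 * i)) \<le> (\<Sum>i. 2 * ?f (2 * i))" by (rule sum_le_suminf) auto
    ultimately show "sum ?f {..<N} \<le> (\<Sum>i. 2 * ?f (2 * i))" by order
  qed simp
  also have "\<dots> = 2 * ((\<Sum>i. ?f (2 * (i + m))) + (\<Sum>i<m. ?f (2 * i)))"
    by (subst ennreal_suminf_cmult, subst suminf_offset[of _ m]) auto
  also have "(\<Sum>i<m. ?f (2 * i)) \<le> (\<Sum>i<m. 1)" by (intro sum_mono) (simp add: indicator_def)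
  then have "2 * ((\<Sum>i. ?f (2 * (i + m))) + (\<Sum>i<m. ?f (2 * i))) \<le> 2 * ((\<Sum>i. ?f (2 * (i + m))) + of_nat m)"
    by (intro mult_left_mono add_left_mono) auto
  finally show ?thesis by (simp add: distrib_left add.commute)
qed

text \<open>Where all levels are at most \<open>1\<close>, every nonzero level lies in exactly one stratum, and counting the members of a
stratum is the same as counting the generation sets containing \<open>x\<close>.\<close>

lemma sum_levels_le:
  assumes "\<And>d. level g d x \<le> 1"
  shows "(\<Sum>d. level g d x) \<le> (\<Sum>k. ennreal (1 / 2 ^ k) * (\<Sum>i. indicator (generation_set g k i) x))"
proof -
  have one: "level g d x \<le> (\<Sum>k. ennreal (1 / 2 ^ k) * indicator {d. stratum g k d x} d)" for d
  proof (cases "level g d x = 0")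
    case False
    obtain l where l0: "level g d x = ennreal l" "0 \<le> l"
      using assms[of d] by (cases "level g d x") (auto simp: top_unique)
    then have l: "level g d x = ennreal l" "0 < l" "l \<le> 1"
      using False assms[of d] by (auto simp: ennreal_le_1 less_le)
    have ex: "\<exists>k. 1 / 2 ^ Suc k < l"
    proof -
      obtain k where "(1/2::real) ^ k < l" using real_arch_pow_inv[of l "1/2"] l by auto
      moreover have "1 / 2 ^ Suc k \<le> (1/2::real) ^ k" by (simp add: power_one_over field_simps)
      ultimately show ?thesis by (intro exI[of _ k]) linarith
    qed
    define k where "k = (LEAST k. 1 / 2 ^ Suc k < l)"
    have k1: "1 / 2 ^ Suc k < l" unfolding k_def using ex by (rule LeastI_ex)
    have k2: "l \<le> 1 / 2 ^ k"
    proof (cases k)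
      case (Suc j)
      then have "\<not> 1 / 2 ^ Suc j < l" using not_less_Least[of j "\<lambda>k. 1 / 2 ^ Suc k < l"] by (simp add: k_def)
      then show ?thesis using Suc by simp
    qed (use l in simp)
    have "stratum g k d x" using k1 k2 l by (auto simp: stratum_def ennreal_less_iff intro: ennreal_leI)
    then have "level g d x \<le> (\<Sum>k\<in>{k}. ennreal (1 / 2 ^ k) * indicator {d. stratum g k d x} d)"
      by (simp add: stratum_def)
    also have "\<dots> \<le> (\<Sum>k. ennreal (1 / 2 ^ k) * indicator {d. stratum g k d x} d)"
      by (rule sum_le_suminf) auto
    finally show ?thesis .
  qed simp
  have "(\<Sum>d. level g d x) \<le> (\<Sum>d. \<Sum>k. ennreal (1 / 2 ^ k) * indicator {d. stratum g k d x} d)"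
    by (intro suminf_le one) auto
  also have "\<dots> = (\<Sum>k. \<Sum>d. ennreal (1 / 2 ^ k) * indicator {d. stratum g k d x} d)"
  proof -
    have "(\<Sum>d. \<Sum>k. f d k) = (\<Sum>k. \<Sum>d. f d k)" for f :: "nat \<Rightarrow> nat \<Rightarrow> ennreal"
    proof -
      have "(\<Sum>d. \<Sum>k. f d k) = (\<integral>\<^sup>+d. (\<Sum>k. f d k) \<partial>count_space UNIV)"
        by (simp add: nn_integral_count_space_nat)
      also have "\<dots> = (\<Sum>k. \<integral>\<^sup>+d. f d k \<partial>count_space UNIV)"
        by (rule nn_integral_suminf) simp
      finally show ?thesis by (simp add: nn_integral_count_space_nat)
    qed
    then show ?thesis .
  qed
  also have "\<dots> \<le> (\<Sum>k. ennreal (1 / 2 ^ k) * (\<Sum>i. indicator (generation_set g k i) x))"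
  proof (intro suminf_le)
    fix k
    have "(\<Sum>d. indicator {d. stratum g k d x} d :: ennreal) \<le> (\<Sum>i. indicator (generation_set g k i) x)"
      using count_le_ranks[of "\<lambda>d. stratum g k d x"]
      by (simp add: generation_set_def generation_def indicator_def)
    then show "(\<Sum>d. ennreal (1 / 2 ^ k) * indicator {d. stratum g k d x} d)
      \<le> ennreal (1 / 2 ^ k) * (\<Sum>i. indicator (generation_set g k i) x)"
      unfolding ennreal_suminf_cmult by (rule mult_left_mono) simp
  qed auto
  finally show ?thesis .
qed

end

section \<open>The weighted weak-type inequality for a dyadic potential\<close>

lemma (in dyadic_grid) adapted_measurable:
  assumes "\<And>x y. y \<in> cell d x \<Longrightarrow> f y = f x"
  shows "f \<in> borel_measurable borel"
proof (rule measurableI)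
  fix A
  have "{x. f x \<in> A} \<in> sets borel"
    by (rule adapted_borel[where d = d]) (use assms in auto)
  then show "f -` A \<inter> space borel \<in> sets borel" by (simp add: vimage_def)
qed simp

lemma ennreal_half_split:
  assumes "0 \<le> r" "ennreal r = a + b" "a \<le> ennreal (1 / 2) * ennreal r"
  shows "ennreal r \<le> 2 * b"
proof -
  have "a \<noteq> top" "b \<noteq> top" using assms(2) by auto
  then obtain \<alpha> \<beta> where ab: "a = ennreal \<alpha>" "0 \<le> \<alpha>" "b = ennreal \<beta>" "0 \<le> \<beta>"
    by (metis ennreal_cases)
  have "r = \<alpha> + \<beta>"
    using assms(1,2) ab by (metis add_nonneg_nonneg ennreal_inj ennreal_plus)
  moreover have "\<alpha> \<le> 1 / 2 * r"
    using assms(1,3) ab by (simp only: ennreal_mult[symmetric] ennreal_le_iff zero_le_divide_1_iff zero_le_numeral mult_nonneg_nonneg)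
  ultimately have "ennreal r \<le> ennreal (2 * \<beta>)" by (intro ennreal_leI) simp
  then show ?thesis using ab by (simp add: ennreal_mult)
qed

lemma borel_lebesgue: "f \<in> borel_measurable borel \<Longrightarrow> f \<in> borel_measurable lebesgue"
  by (rule measurable_completion) simp

text \<open>The constant \<open>C\<close>, with the inequality obtained for it from the logarithmic gain, is a parameter because it must
not depend on the grid: it is fixed once, from \<open>\<epsilon>\<close>, and shared by all grids.\<close>

locale weighted_dyadic_grid = dyadic_grid a L for a :: "real^'n" and L :: real +
  fixes w :: "real^'n \<Rightarrow> real" and \<epsilon> C :: real
  assumes w_nonneg: "0 \<le> w x"
    and w_measurable[measurable]: "w \<in> borel_measurable lebesgue"
    and w_finite: "(\<integral>\<^sup>+x\<in>cball 0 R. ennreal (w x) \<partial>lebesgue) < \<infinity>"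
    and eps_pos: "0 < \<epsilon>"
    and gain: "1 \<le> i \<Longrightarrow> 2 powr (real i / 2) * (2 / 2 ^ i) + 1 / ln (exp 1 + 2 powr (real i / 2)) powr \<epsilon>
       \<le> C * real i powr - \<epsilon>"
begin

definition cell_norm :: "nat \<Rightarrow> real^'n \<Rightarrow> ennreal" where
  "cell_norm d x = luxemburg_norm (LlogL_young \<epsilon>) (cube (corner d x) (side d)) w"

text \<open>A Borel minorant of the Orlicz maximal function that is large enough for the proof. Working with it
avoids every question about the measurability of the maximal functions over all cubes.\<close>

definition dyadic_orlicz :: "real^'n \<Rightarrow> ennreal" where
  "dyadic_orlicz x = (SUP d. cell_norm d x)"

definition dyadic_frac :: "real^'n \<Rightarrow> ennreal" where
  "dyadic_frac x = (SUP d. level dyadic_orlicz d x)"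

lemma C_pos: "0 < C"
proof -
  have "0 < 2 powr (real 1 / 2) * (2 / 2 ^ 1) + 1 / ln (exp 1 + 2 powr (real 1 / 2)) powr \<epsilon>"
    by (intro add_pos_nonneg) auto
  also have "\<dots> \<le> C * real 1 powr - \<epsilon>" by (rule gain) simp
  finally show ?thesis by simp
qed

lemma cell_norm_eq: "y \<in> cell d x \<Longrightarrow> cell_norm d y = cell_norm d x"
  by (simp add: cell_norm_def corner_eq)

lemma dyadic_orlicz_measurable: "dyadic_orlicz \<in> borel_measurable borel"
proof -
  have "cell_norm d \<in> borel_measurable borel" for d
    by (rule adapted_measurable[where d = d]) (rule cell_norm_eq)
  then show ?thesis unfolding dyadic_orlicz_def[abs_def] by measurable
qed

lemma dyadic_frac_measurable: "dyadic_frac \<in> borel_measurable borel"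
proof -
  have "level dyadic_orlicz d \<in> borel_measurable borel" for d
    by (rule adapted_measurable[where d = d]) (rule level_eq, assumption, simp)
  then show ?thesis unfolding dyadic_frac_def[abs_def] by measurable
qed

lemma dyadic_orlicz_le: "dyadic_orlicz x \<le> orlicz_maximal (LlogL_young \<epsilon>) w x"
  unfolding dyadic_orlicz_def orlicz_maximal_def
proof (rule SUP_least)
  fix d
  have "(corner d x, side d) \<in> cubes_at x"
    using cell_self[of x d] cell_subset_cube[of d x] side_pos[of d] by (auto simp: cubes_at_def)
  then show "cell_norm d x \<le> (SUP (c, l)\<in>cubes_at x. luxemburg_norm (LlogL_young \<epsilon>) (cube c l) w)"
    by (rule SUP_upper2) (simp add: cell_norm_def)
qed

lemma dyadic_frac_le: "dyadic_frac x \<le> frac_maximal_1 (orlicz_maximal (LlogL_young \<epsilon>) w) x"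
  unfolding dyadic_frac_def frac_maximal_1_def
proof (rule SUP_least)
  fix d
  let ?Q = "cube (corner d x) (side d)" and ?M = "orlicz_maximal (LlogL_young \<epsilon>) w"
  have "(corner d x, side d) \<in> cubes_at x"
    using cell_self[of x d] cell_subset_cube[of d x] side_pos[of d] by (auto simp: cubes_at_def)
  moreover have "level dyadic_orlicz d x \<le> ennreal (side d) * ((\<integral>\<^sup>+y\<in>?Q. ?M y \<partial>lebesgue) / emeasure lebesgue ?Q)"
  proof -
    have "emeasure lebesgue ?Q = ennreal (side d ^ CARD('n))"
      using emeasure_cube[where 'n = 'n, OF side_pos] by (simp add: cube_def)
    then show ?thesis unfolding dyadic_level_def cell_integral_eq_cube
      by (simp only:) (intro mult_left_mono divide_right_mono_ennreal nn_integral_mono mult_right_mono dyadic_orlicz_le zero_le)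
  qed
  ultimately show "level dyadic_orlicz d x \<le> (SUP (c, l)\<in>cubes_at x. ennreal l *
      ((\<integral>\<^sup>+y\<in>cube c l. ?M y \<partial>lebesgue) / emeasure lebesgue (cube c l)))"
    by (intro SUP_upper2[where i = "(corner d x, side d)"]) simp_all
qed

lemma emeasure_cell_cube: "emeasure lebesgue (cube (corner d x) (side d)) = emeasure lebesgue (cell d x)"
  using emeasure_cube[where 'n = 'n, OF side_pos] emeasure_cell by (simp add: cube_def)

lemma cube_lebesgue: "cube c l \<in> sets lebesgue"
  unfolding cube_def by (rule borel_set_lebesgue) simp

lemma weight_small_subset:
  assumes F: "F \<subseteq> cell d x" "F \<in> sets lebesgue" and i: "1 \<le> i"
    and small: "emeasure lebesgue F \<le> ennreal (2 / 2 ^ i) * emeasure lebesgue (cell d x)"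
  shows "(\<integral>\<^sup>+y\<in>F. ennreal (w y) \<partial>lebesgue) \<le>
    ennreal (C * real i powr - \<epsilon>) * (cell_norm d x * emeasure lebesgue (cell d x))"
proof -
  let ?s = "2 powr (real i / 2)" and ?Q = "emeasure lebesgue (cell d x)"
  let ?K = "1 / ln (exp 1 + ?s) powr \<epsilon>"
  have "(\<integral>\<^sup>+y\<in>F. ennreal (w y) \<partial>lebesgue) \<le>
      (ennreal ?s * emeasure lebesgue F + ennreal ?K * ?Q) * cell_norm d x"
    unfolding cell_norm_def emeasure_cell_cube[symmetric]
    by (rule luxemburg_small_set[where q = "side d ^ CARD('n)"])
       (use w_nonneg w_measurable cube_lebesgue F eps_pos side_pos[of d] cell_subset_cube[of d x] emeasure_cell[of d x]
         in \<open>auto simp: emeasure_cell_cube\<close>)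
  also have "\<dots> \<le> (ennreal ?s * (ennreal (2 / 2 ^ i) * ?Q) + ennreal ?K * ?Q) * cell_norm d x"
    by (intro mult_right_mono add_mono mult_left_mono small) auto
  also have "ennreal ?s * (ennreal (2 / 2 ^ i) * ?Q) + ennreal ?K * ?Q = ennreal (?s * (2 / 2 ^ i) + ?K) * ?Q"
    by (subst ennreal_mult_mult, simp, simp, subst ennreal_plus) (auto simp: distrib_right)
  also have "\<dots> * cell_norm d x \<le> ennreal (C * real i powr - \<epsilon>) * ?Q * cell_norm d x"
    by (intro mult_right_mono ennreal_leI gain i) auto
  finally show ?thesis by (simp only: mult_ac)
qed

lemma weight_cell: "(\<integral>\<^sup>+y\<in>cell d x. ennreal (w y) \<partial>lebesgue) \<le> cell_norm d x * emeasure lebesgue (cell d x)"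
proof -
  have "(\<integral>\<^sup>+y\<in>cell d x. ennreal (w y) \<partial>lebesgue) \<le>
      (ennreal 0 * emeasure lebesgue (cell d x) +
       ennreal (1 / ln (exp 1 + 0) powr \<epsilon>) * emeasure lebesgue (cube (corner d x) (side d))) * cell_norm d x"
    unfolding cell_norm_def
    by (rule luxemburg_small_set[where q = "side d ^ CARD('n)"])
       (use w_nonneg w_measurable cube_lebesgue eps_pos side_pos[of d] cell_subset_cube[of d x] emeasure_cell[of d x]
          cell_lebesgue in \<open>auto simp: emeasure_cell_cube\<close>)
  then show ?thesis unfolding emeasure_cell_cube by (simp add: mult.commute)
qed

lemma cell_norm_le_orlicz:
  assumes A: "A \<in> sets lebesgue" "A \<subseteq> cell d x"
  shows "cell_norm d x * emeasure lebesgue A \<le> (\<integral>\<^sup>+y\<in>A. dyadic_orlicz y \<partial>lebesgue)"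
proof -
  have "cell_norm d x * emeasure lebesgue A = (\<integral>\<^sup>+y. cell_norm d x * indicator A y \<partial>lebesgue)"
    using A by (simp only: nn_integral_cmult_indicator)
  also have "\<dots> \<le> (\<integral>\<^sup>+y\<in>A. dyadic_orlicz y \<partial>lebesgue)"
  proof (rule nn_integral_mono)
    fix y
    have "cell_norm d x \<le> dyadic_orlicz y" if "y \<in> A"
      using that A(2) cell_norm_eq[of y d x] unfolding dyadic_orlicz_def by (metis SUP_upper UNIV_I subsetD)
    then show "cell_norm d x * indicator A y \<le> dyadic_orlicz y * indicator A y"
      by (auto simp: indicator_def)
  qed
  finally show ?thesis .
qed

text \<open>On a selected cell \<open>P\<close> one has \<open>c \<integral>\<^sub>P v \<le> \<ell>(P) \<langle>g\<rangle>\<^sub>P \<integral>\<^sub>P v = \<integral>\<^sub>P g \<cdot> \<ell>(P) \<langle>v\<rangle>\<^sub>P\<close>, and the last factor is at most the fractional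
maximal function of \<open>v\<close> at each point of \<open>P\<close>. This is the step in which \<open>M\<^sub>1\<close> is applied on top of \<open>M\<^sub>\<Phi>\<close>.\<close>

lemma selected_cells_bound:
  assumes adapted: "\<And>d x y. K d x \<Longrightarrow> y \<in> cell d x \<Longrightarrow> K d y"
    and unique: "\<And>d e x. K d x \<Longrightarrow> K e x \<Longrightarrow> d = e"
    and g: "g \<in> borel_measurable lebesgue"
    and large: "\<And>d x. K d x \<Longrightarrow> c \<le> level g d x"
  shows "c * (\<integral>\<^sup>+x\<in>{x. \<exists>d. K d x}. dyadic_orlicz x \<partial>lebesgue) \<le> (\<integral>\<^sup>+x. g x * dyadic_frac x \<partial>lebesgue)"
proof -
  note [measurable] = borel_lebesgue[OF dyadic_orlicz_measurable] borel_lebesgue[OF dyadic_frac_measurable]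
  have X: "{x. \<exists>d. K d x} \<in> sets lebesgue"
  proof (rule borel_set_lebesgue)
    have "{x. \<exists>d. K d x} = (\<Union>d. {x. K d x})" by auto
    also have "\<dots> \<in> sets borel" using adapted by (intro sets.countable_UN) (auto intro: adapted_borel)
    finally show "{x. \<exists>d. K d x} \<in> sets borel" .
  qed
  have "c * (\<integral>\<^sup>+x\<in>{x. \<exists>d. K d x}. dyadic_orlicz x \<partial>lebesgue) = (\<integral>\<^sup>+x\<in>{x. \<exists>d. K d x}. c * dyadic_orlicz x \<partial>lebesgue)"
    unfolding mult.assoc
    by (intro nn_integral_cmult[symmetric] borel_measurable_times_ennreal borel_measurable_indicator X
        borel_lebesgue dyadic_orlicz_measurable)
  also have "\<dots> \<le> (\<integral>\<^sup>+x\<in>{x. \<exists>d. K d x}. g x * dyadic_frac x \<partial>lebesgue)"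
  proof (rule cell_compare[where K = K])
    show "(\<lambda>x. c * dyadic_orlicz x) \<in> borel_measurable lebesgue"
      "(\<lambda>x. g x * dyadic_frac x) \<in> borel_measurable lebesgue"
      by (intro borel_measurable_times_ennreal borel_measurable_const g borel_lebesgue
          dyadic_orlicz_measurable dyadic_frac_measurable)+
    fix d x assume K: "K d x"
    let ?Ig = "\<integral>\<^sup>+y\<in>cell d x. g y \<partial>lebesgue" and ?Iv = "\<integral>\<^sup>+y\<in>cell d x. dyadic_orlicz y \<partial>lebesgue"
    have "(\<integral>\<^sup>+y\<in>cell d x. c * dyadic_orlicz y \<partial>lebesgue) = c * ?Iv"
      unfolding mult.assoc
      by (intro nn_integral_cmult borel_measurable_times_ennreal borel_measurable_indicator cell_lebesgue
          borel_lebesgue dyadic_orlicz_measurable)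
    also have "\<dots> \<le> level g d x * ?Iv"
      by (intro mult_right_mono large K) simp
    also have "\<dots> = level dyadic_orlicz d x * ?Ig"
      by (simp add: dyadic_level_def divide_ennreal_def mult_ac)
    also have "\<dots> = (\<integral>\<^sup>+y. level dyadic_orlicz d x * (g y * indicator (cell d x) y) \<partial>lebesgue)"
      by (intro nn_integral_cmult[symmetric] borel_measurable_times_ennreal borel_measurable_indicator cell_lebesgue g)
    also have "\<dots> \<le> (\<integral>\<^sup>+y\<in>cell d x. g y * dyadic_frac y \<partial>lebesgue)"
    proof (rule nn_integral_mono)
      fix y
      have "level dyadic_orlicz d x \<le> dyadic_frac y" if "y \<in> cell d x"
        using level_eq[OF that order_refl, of dyadic_orlicz] unfolding dyadic_frac_def by (metis SUP_upper UNIV_I)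
      then show "level dyadic_orlicz d x * (g y * indicator (cell d x) y) \<le> g y * dyadic_frac y * indicator (cell d x) y"
        by (auto simp: indicator_def mult.commute intro: mult_left_mono)
    qed
    finally show "(\<integral>\<^sup>+y\<in>cell d x. c * dyadic_orlicz y \<partial>lebesgue) \<le> (\<integral>\<^sup>+y\<in>cell d x. g y * dyadic_frac y \<partial>lebesgue)" .
  qed (fact adapted, fact unique)
  also have "\<dots> \<le> (\<integral>\<^sup>+x. g x * dyadic_frac x \<partial>lebesgue)"
    by (rule nn_integral_mono) (auto simp: indicator_def)
  finally show ?thesis .
qed

text \<open>On a cell \<open>Q\<close> of generation \<open>i\<close>, the set \<open>G\<^bsub>2i\<^esub>\<close> is exponentially small in \<open>i\<close>, so the Orlicz estimate gives
\<open>w(Q \<inter> G\<^bsub>2i\<^esub>) \<le> C i\<^bsup>-\<epsilon>\<^esup> |Q| \<parallel>w\<parallel>\<^bsub>\<Phi>,Q\<^esub>\<close>. Moreover \<open>G\<^bsub>i+2\<^esub>\<close> fills at most half of \<open>Q\<close>, so \<open>|Q|\<close> may be replaced by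
\<open>2 |Q - G\<^bsub>i+2\<^esub>|\<close>; these sets overlap boundedly in \<open>i\<close>.\<close>

lemma generation_estimate:
  assumes g: "g \<in> borel_measurable lebesgue" and i: "1 \<le> i"
  shows "(\<integral>\<^sup>+x\<in>generation_set g k (2 * i). ennreal (w x) \<partial>lebesgue) \<le>
    ennreal (2 * C * real i powr - \<epsilon>) * (\<integral>\<^sup>+x\<in>generation_set g k i - generation_set g k (i + 2). dyadic_orlicz x \<partial>lebesgue)"
proof -
  let ?G = "generation_set g k" and ?c = "ennreal (2 * C * real i powr - \<epsilon>)"
  have Gi: "{x. \<exists>d. generation g k i d x} = ?G i" by (simp add: generation_set_def)
  have "(\<integral>\<^sup>+x\<in>?G (2 * i). ennreal (w x) \<partial>lebesgue) =
      (\<integral>\<^sup>+x\<in>{x. \<exists>d. generation g k i d x}. ennreal (w x) * indicator (?G (2 * i)) x \<partial>lebesgue)"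
    unfolding Gi using generation_set_antimono[of i "2*i" g k] by (intro nn_integral_cong) (auto simp: indicator_def)
  also have "\<dots> \<le> (\<integral>\<^sup>+x\<in>{x. \<exists>d. generation g k i d x}. ?c * (dyadic_orlicz x * indicator (- ?G (i + 2)) x) \<partial>lebesgue)"
  proof (rule cell_compare[where K = "generation g k i"])
    have m: "- ?G (i + 2) \<in> sets lebesgue" using generation_set_lebesgue by (metis Compl_in_sets_lebesgue)
    show "(\<lambda>x. ennreal (w x) * indicator (?G (2 * i)) x) \<in> borel_measurable lebesgue"
      by (intro borel_measurable_times_ennreal borel_measurable_indicator generation_set_lebesgue) measurable
    show "(\<lambda>x. ?c * (dyadic_orlicz x * indicator (- ?G (i + 2)) x)) \<in> borel_measurable lebesgue"
      by (intro borel_measurable_times_ennreal borel_measurable_indicator borel_measurable_const m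
         borel_lebesgue dyadic_orlicz_measurable)
    fix d x assume gen: "generation g k i d x"
    let ?Q = "cell d x"
    have half: "emeasure lebesgue ?Q \<le> 2 * emeasure lebesgue (?Q - ?G (i + 2))"
    proof -
      have "emeasure lebesgue (?Q \<inter> ?G (i + 2)) \<le> ennreal (2 / 2 ^ (i + 2 - i)) * emeasure lebesgue ?Q"
        by (rule generation_set_small[OF g gen]) simp
      then have s: "emeasure lebesgue (?Q \<inter> ?G (i + 2)) \<le> ennreal (1 / 2) * emeasure lebesgue ?Q"
        by (simp add: power2_eq_square)
      have sp: "emeasure lebesgue ?Q = emeasure lebesgue (?Q \<inter> ?G (i + 2)) + emeasure lebesgue (?Q - ?G (i + 2))"
        by (subst plus_emeasure) (auto simp: Int_Diff_Un generation_set_lebesgue cell_lebesgue sets.Int sets.Diff)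
      show ?thesis
        using ennreal_half_split[of "side d ^ CARD('n)"] s sp side_pos[of d] unfolding emeasure_cell by simp
    qed
    have "(\<integral>\<^sup>+y\<in>?Q. ennreal (w y) * indicator (?G (2 * i)) y \<partial>lebesgue) = (\<integral>\<^sup>+y\<in>?Q \<inter> ?G (2 * i). ennreal (w y) \<partial>lebesgue)"
      by (rule nn_integral_cong) (auto simp: indicator_def)
    also have "\<dots> \<le> ennreal (C * real i powr - \<epsilon>) * (cell_norm d x * emeasure lebesgue ?Q)"
    proof (rule weight_small_subset)
      have "emeasure lebesgue (?Q \<inter> ?G (2 * i)) \<le> ennreal (2 / 2 ^ (2 * i - i)) * emeasure lebesgue ?Q"
        by (rule generation_set_small[OF g gen]) (use i in simp)
      then show "emeasure lebesgue (?Q \<inter> ?G (2 * i)) \<le> ennreal (2 / 2 ^ i) * emeasure lebesgue ?Q" by simp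
      show "?Q \<inter> ?G (2 * i) \<in> sets lebesgue" by (intro sets.Int generation_set_lebesgue cell_lebesgue)
    qed (use i in auto)
    also have "\<dots> \<le> ennreal (C * real i powr - \<epsilon>) * (cell_norm d x * (2 * emeasure lebesgue (?Q - ?G (i + 2))))"
      by (intro mult_left_mono half) auto
    also have "\<dots> = ?c * (cell_norm d x * emeasure lebesgue (?Q - ?G (i + 2)))"
    proof -
      have "?c = 2 * ennreal (C * real i powr - \<epsilon>)"
        by (subst ennreal_numeral[symmetric], subst ennreal_mult[symmetric]) (auto simp: C_pos less_imp_le mult.assoc)
      then show ?thesis by (simp only: mult_ac)
    qed
    also have "\<dots> \<le> ?c * (\<integral>\<^sup>+y\<in>?Q - ?G (i + 2). dyadic_orlicz y \<partial>lebesgue)"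
      by (intro mult_left_mono cell_norm_le_orlicz) (auto intro: cell_lebesgue generation_set_lebesgue)
    also have "\<dots> = (\<integral>\<^sup>+y. ?c * (dyadic_orlicz y * indicator (?Q - ?G (i + 2)) y) \<partial>lebesgue)"
      by (intro nn_integral_cmult[symmetric] borel_measurable_times_ennreal borel_measurable_indicator
          sets.Diff cell_lebesgue generation_set_lebesgue borel_lebesgue dyadic_orlicz_measurable)
    also have "\<dots> = (\<integral>\<^sup>+y\<in>?Q. ?c * (dyadic_orlicz y * indicator (- ?G (i + 2)) y) \<partial>lebesgue)"
      by (rule nn_integral_cong) (auto simp: indicator_def)
    finally show "(\<integral>\<^sup>+y\<in>?Q. ennreal (w y) * indicator (?G (2 * i)) y \<partial>lebesgue)
      \<le> (\<integral>\<^sup>+y\<in>?Q. ?c * (dyadic_orlicz y * indicator (- ?G (i + 2)) y) \<partial>lebesgue)" .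
  qed (fact generation_adapted, fact generation_unique)
  also have "\<dots> = (\<integral>\<^sup>+y. ?c * (dyadic_orlicz y * indicator (?G i - ?G (i + 2)) y) \<partial>lebesgue)"
    unfolding Gi by (rule nn_integral_cong) (auto simp: indicator_def)
  also have "\<dots> = ?c * (\<integral>\<^sup>+y\<in>?G i - ?G (i + 2). dyadic_orlicz y \<partial>lebesgue)"
    by (intro nn_integral_cmult borel_measurable_times_ennreal borel_measurable_indicator
        sets.Diff generation_set_lebesgue borel_lebesgue dyadic_orlicz_measurable)
  finally show ?thesis .
qed

text \<open>Summing the previous estimate over all generations beyond \<open>2 m\<close> loses nothing, as the right-hand sides
overlap at most twice inside the top generation.\<close>

lemma stratum_sum_estimate:
  assumes g: "g \<in> borel_measurable lebesgue" and m: "1 \<le> m"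
  shows "ennreal (1 / 2 ^ k) * (2 * (\<Sum>i. \<integral>\<^sup>+x\<in>generation_set g k (2 * (i + m)). ennreal (w x) \<partial>lebesgue)) \<le>
    ennreal (16 * C * real m powr - \<epsilon>) * (\<integral>\<^sup>+x. g x * dyadic_frac x \<partial>lebesgue)"
proof -
  let ?c = "ennreal (2 * C * real m powr - \<epsilon>)" and ?v = dyadic_orlicz
  let ?D = "\<lambda>i. generation_set g k (i + m) - generation_set g k (i + m + 2)"
  have vm: "?v \<in> borel_measurable lebesgue" by (intro borel_lebesgue dyadic_orlicz_measurable)
  have D: "?D i \<in> sets lebesgue" for i by (intro sets.Diff generation_set_lebesgue)
  have "(\<Sum>i. \<integral>\<^sup>+x\<in>generation_set g k (2 * (i + m)). ennreal (w x) \<partial>lebesgue) \<le> (\<Sum>i. ?c * (\<integral>\<^sup>+x\<in>?D i. ?v x \<partial>lebesgue))"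
  proof (intro suminf_le)
    fix i
    have "(\<integral>\<^sup>+x\<in>generation_set g k (2 * (i + m)). ennreal (w x) \<partial>lebesgue) \<le>
      ennreal (2 * C * real (i + m) powr - \<epsilon>) * (\<integral>\<^sup>+x\<in>?D i. ?v x \<partial>lebesgue)"
      by (rule generation_estimate[OF g]) (use m in simp)
    also have "\<dots> \<le> ?c * (\<integral>\<^sup>+x\<in>?D i. ?v x \<partial>lebesgue)"
    proof (intro mult_right_mono ennreal_leI mult_left_mono)
      show "real (i + m) powr - \<epsilon> \<le> real m powr - \<epsilon>"
        using m eps_pos by (intro powr_mono2') auto
    qed (use C_pos in auto)
    finally show "(\<integral>\<^sup>+x\<in>generation_set g k (2 * (i + m)). ennreal (w x) \<partial>lebesgue) \<le> ?c * (\<integral>\<^sup>+x\<in>?D i. ?v x \<partial>lebesgue)" .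
  qed auto
  also have "\<dots> = ?c * (\<integral>\<^sup>+x. (\<Sum>i. ?v x * indicator (?D i) x) \<partial>lebesgue)"
  proof -
    have "(\<Sum>i. \<integral>\<^sup>+x\<in>?D i. ?v x \<partial>lebesgue) = (\<integral>\<^sup>+x. (\<Sum>i. ?v x * indicator (?D i) x) \<partial>lebesgue)"
      by (intro nn_integral_suminf[symmetric] borel_measurable_times_ennreal borel_measurable_indicator D vm)
    then show ?thesis by (simp only: ennreal_suminf_cmult[of ?c])
  qed
  also have "\<dots> \<le> ?c * (\<integral>\<^sup>+x. 2 * (?v x * indicator (generation_set g k 0) x) \<partial>lebesgue)"
  proof (intro mult_left_mono nn_integral_mono)
    fix x
    have "(\<Sum>i. ?v x * indicator (?D i) x) = ?v x * (\<Sum>i. indicator (?D i) x)" by simp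
    also have "\<dots> \<le> ?v x * (2 * indicator (generation_set g k 0) x)"
      by (intro mult_left_mono sum_gen_differences) simp
    finally show "(\<Sum>i. ?v x * indicator (?D i) x) \<le> 2 * (?v x * indicator (generation_set g k 0) x)"
      by (simp only: mult_ac)
  qed simp
  also have "\<dots> = ?c * (2 * (\<integral>\<^sup>+x\<in>generation_set g k 0. ?v x \<partial>lebesgue))"
    by (subst nn_integral_cmult) (intro borel_measurable_times_ennreal borel_measurable_indicator generation_set_lebesgue vm, simp)
  finally have 1: "(\<Sum>i. \<integral>\<^sup>+x\<in>generation_set g k (2 * (i + m)). ennreal (w x) \<partial>lebesgue)
      \<le> ?c * (2 * (\<integral>\<^sup>+x\<in>generation_set g k 0. ?v x \<partial>lebesgue))" .
  have 2: "ennreal (1 / 2 ^ Suc k) * (\<integral>\<^sup>+x\<in>generation_set g k 0. ?v x \<partial>lebesgue) \<le> (\<integral>\<^sup>+x. g x * dyadic_frac x \<partial>lebesgue)"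
    unfolding generation_set_def
  proof (rule selected_cells_bound[where K = "generation g k 0"])
    show "ennreal (1 / 2 ^ Suc k) \<le> level g d x" if "generation g k 0 d x" for d x
      using that by (simp only: generation_def stratum_def less_imp_le)
  qed (fact generation_adapted, fact generation_unique, fact g)
  have "ennreal (1 / 2 ^ k) * (2 * (\<Sum>i. \<integral>\<^sup>+x\<in>generation_set g k (2 * (i + m)). ennreal (w x) \<partial>lebesgue))
      \<le> ennreal (1 / 2 ^ k) * (2 * (?c * (2 * (\<integral>\<^sup>+x\<in>generation_set g k 0. ?v x \<partial>lebesgue))))"
    by (intro mult_left_mono 1) auto
  also have "\<dots> = ennreal (16 * C * real m powr - \<epsilon>) * (ennreal (1 / 2 ^ Suc k) * (\<integral>\<^sup>+x\<in>generation_set g k 0. ?v x \<partial>lebesgue))"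
    (is "_ = _ * (_ * ?I)")
  proof -
    have c0: "0 \<le> 2 * C * real m powr - \<epsilon>" using C_pos by simp
    have "ennreal (1 / 2 ^ k) * (2 * (?c * (2 * ?I))) = ennreal (1 / 2 ^ k) * (ennreal 2 * (?c * (ennreal 2 * ?I)))"
      by simp
    also have "\<dots> = ennreal (1 / 2 ^ k * (2 * (2 * C * real m powr - \<epsilon> * 2))) * ?I"
      using c0 by (simp only: ennreal_mult_mult mult_nonneg_nonneg zero_le_numeral zero_le_divide_1_iff zero_le_power)
    also have "1 / 2 ^ k * (2 * (2 * C * real m powr - \<epsilon> * 2)) = 16 * C * real m powr - \<epsilon> * (1 / 2 ^ Suc k)"
      by simp
    also have "ennreal \<dots> * ?I = ennreal (16 * C * real m powr - \<epsilon>) * (ennreal (1 / 2 ^ Suc k) * ?I)"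
      using C_pos by (subst ennreal_mult_mult) auto
    finally show ?thesis .
  qed
  also have "\<dots> \<le> ennreal (16 * C * real m powr - \<epsilon>) * (\<integral>\<^sup>+x. g x * dyadic_frac x \<partial>lebesgue)"
    by (intro mult_left_mono 2) simp
  finally show ?thesis .
qed

text \<open>The maximal cells with \<open>\<ell>(P) \<langle>g\<rangle>\<^sub>P > 1\<close> are selected, with \<open>v = M\<^sub>\<Phi> w\<close>; on each of them \<open>w(P) \<le> \<parallel>w\<parallel>\<^bsub>\<Phi>,P\<^esub> |P|\<close>, which is at
most the integral of \<open>v\<close> over \<open>P\<close>.\<close>

lemma large_level_bound:
  assumes g: "g \<in> borel_measurable lebesgue"
  shows "(\<integral>\<^sup>+x\<in>{x. \<exists>d. 1 < level g d x}. ennreal (w x) \<partial>lebesgue) \<le> (\<integral>\<^sup>+x. g x * dyadic_frac x \<partial>lebesgue)"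
proof -
  define K where "K d x \<longleftrightarrow> 1 < level g d x \<and> (\<forall>e<d. \<not> 1 < level g e x)" for d x
  have X: "{x. \<exists>d. 1 < level g d x} = {x. \<exists>d. K d x}"
  proof (intro set_eqI iffI)
    fix x assume "x \<in> {x. \<exists>d. 1 < level g d x}"
    then have ex: "\<exists>d. 1 < level g d x" by simp
    from LeastI_ex[OF ex] not_less_Least[of _ "\<lambda>d. 1 < level g d x"]
    have "K (LEAST d. 1 < level g d x) x" unfolding K_def by blast
    then show "x \<in> {x. \<exists>d. K d x}" by blast
  qed (auto simp: K_def)
  have adapted: "K d y" if "K d x" "y \<in> cell d x" for d x y
    using that level_eq[OF that(2), of _ g] unfolding K_def by simp
  have unique: "d = e" if "K d x" "K e x" for d e x
    using that unfolding K_def by (cases d e rule: linorder_cases) auto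
  have "(\<integral>\<^sup>+x\<in>{x. \<exists>d. K d x}. ennreal (w x) \<partial>lebesgue) \<le> (\<integral>\<^sup>+x\<in>{x. \<exists>d. K d x}. dyadic_orlicz x \<partial>lebesgue)"
  proof (rule cell_compare[where K = K])
    show "(\<integral>\<^sup>+y\<in>cell d x. ennreal (w y) \<partial>lebesgue) \<le> (\<integral>\<^sup>+y\<in>cell d x. dyadic_orlicz y \<partial>lebesgue)" for d x
      using weight_cell cell_norm_le_orlicz[OF cell_lebesgue order_refl] by (rule order_trans)
  qed (fact adapted, fact unique, measurable, intro borel_lebesgue dyadic_orlicz_measurable)
  also have "\<dots> \<le> (\<integral>\<^sup>+x. g x * dyadic_frac x \<partial>lebesgue)"
    using selected_cells_bound[where K = K and c = 1, OF adapted unique g]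
    by (simp add: K_def less_imp_le)
  finally show ?thesis unfolding X .
qed

lemma level_borel: "level g d \<in> borel_measurable borel"
  by (rule adapted_measurable[where d = d]) (rule level_eq, assumption, simp)

text \<open>Chebyshev's inequality against \<open>w\<close> on the set \<open>E\<close> where the potential is large and all levels are at most \<open>1\<close>. In
stratum \<open>k\<close> the first \<open>2 m\<^sub>k\<close> generations contribute at most \<open>2\<^bsup>-k\<^esup> 2 m\<^sub>k w(E)\<close>, in total \<open>S w(E)\<close>, which the threshold
\<open>1 + S\<close> absorbs. Absorption needs \<open>w(E) < \<infinity>\<close>, so the argument is run on bounded parts of \<open>E\<close>.\<close>

theorem dyadic_weak_type:
  fixes m :: "nat \<Rightarrow> nat" and S T :: real
  assumes g: "g \<in> borel_measurable lebesgue" and m: "\<And>k. 1 \<le> m k"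
    and S: "(\<Sum>k. ennreal (1 / 2 ^ k) * of_nat (2 * m k)) = ennreal S"
    and T: "(\<Sum>k. ennreal (16 * C * real (m k) powr - \<epsilon>)) \<le> ennreal T"
  shows "(\<integral>\<^sup>+x\<in>{x. 1 + ennreal S < (\<Sum>d. level g d x)}. ennreal (w x) \<partial>lebesgue) \<le>
    (1 + ennreal T) * (\<integral>\<^sup>+x. g x * dyadic_frac x \<partial>lebesgue)"
proof -
  let ?X = "\<integral>\<^sup>+x. g x * dyadic_frac x \<partial>lebesgue"
  let ?B = "{x. \<exists>d. 1 < level g d x}" and ?A = "{x. 1 + ennreal S < (\<Sum>d. level g d x)}"
  define E where "E = ?A - ?B"
  have lm[measurable]: "level g d \<in> borel_measurable lborel" for d
    using level_borel[of g d] by simp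
  have B: "?B \<in> sets lebesgue" by (rule sets_completionI_sets) measurable
  have A: "?A \<in> sets lebesgue" by (rule sets_completionI_sets) measurable
  have E: "E \<in> sets lebesgue" unfolding E_def using A B by (rule sets.Diff)
  define \<mu> where "\<mu> = density lebesgue (\<lambda>x. ennreal (w x))"
  have \<mu>: "emeasure \<mu> F = (\<integral>\<^sup>+x\<in>F. ennreal (w x) \<partial>lebesgue)" if "F \<in> sets lebesgue" for F
    unfolding \<mu>_def using that by (subst emeasure_density) auto
  have sets_\<mu>: "sets \<mu> = sets lebesgue" by (simp add: \<mu>_def)
  have bounded: "emeasure \<mu> (E \<inter> cball 0 R) \<le> ennreal T * ?X" for R
  proof -
    let ?E = "E \<inter> cball 0 R" and ?\<omega> = "emeasure \<mu> (E \<inter> cball 0 R)"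
    let ?u = "\<lambda>x. ennreal (w x) * indicator (E \<inter> cball 0 R) x"
    have ER: "?E \<in> sets lebesgue" using E by (intro sets.Int) auto
    have \<omega>: "?\<omega> = (\<integral>\<^sup>+x. ?u x \<partial>lebesgue)" using \<mu>[OF ER] .
    have um: "?u \<in> borel_measurable lebesgue"
      by (intro borel_measurable_times_ennreal borel_measurable_indicator ER) measurable
    have "?\<omega> \<le> (\<integral>\<^sup>+x\<in>cball 0 R. ennreal (w x) \<partial>lebesgue)"
      unfolding \<omega> by (rule nn_integral_mono) (auto simp: indicator_def)
    then have fin: "?\<omega> \<noteq> \<infinity>" using w_finite[of R] by auto
    have Gm: "(\<lambda>x. ?u x * indicator (generation_set g k i) x) \<in> borel_measurable lebesgue" for k i
      by (intro borel_measurable_times_ennreal borel_measurable_indicator generation_set_lebesgue um)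
    have "(1 + ennreal S) * ?\<omega> = (\<integral>\<^sup>+x. (1 + ennreal S) * ?u x \<partial>lebesgue)"
      unfolding \<omega> by (rule nn_integral_cmult[symmetric, OF um])
    also have "\<dots> \<le> (\<integral>\<^sup>+x. (\<Sum>k. ennreal (1 / 2 ^ k) *
       (of_nat (2 * m k) * ?u x + 2 * (\<Sum>i. ?u x * indicator (generation_set g k (2 * (i + m k))) x))) \<partial>lebesgue)"
    proof (rule nn_integral_mono)
      fix x
      let ?S = "\<lambda>k. of_nat (2 * m k) + 2 * (\<Sum>i. indicator (generation_set g k (2 * (i + m k))) x) :: ennreal"
      show "(1 + ennreal S) * ?u x \<le> (\<Sum>k. ennreal (1 / 2 ^ k) *
       (of_nat (2 * m k) * ?u x + 2 * (\<Sum>i. ?u x * indicator (generation_set g k (2 * (i + m k))) x)))"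
      proof (cases "x \<in> ?E")
        case True
        then have "1 + ennreal S \<le> (\<Sum>d. level g d x)" and "\<And>d. level g d x \<le> 1"
          by (auto simp: E_def not_less)
        note this(1)
        also have "(\<Sum>d. level g d x) \<le> (\<Sum>k. ennreal (1 / 2 ^ k) * (\<Sum>i. indicator (generation_set g k i) x))"
          by (rule sum_levels_le) fact
        also have "\<dots> \<le> (\<Sum>k. ennreal (1 / 2 ^ k) * ?S k)"
          by (intro suminf_le mult_left_mono sum_gen_even) auto
        finally have "(1 + ennreal S) * ?u x \<le> (\<Sum>k. ennreal (1 / 2 ^ k) * ?S k) * ?u x"
          by (rule mult_right_mono) simp
        also have "\<dots> = (\<Sum>k. ennreal (1 / 2 ^ k) * ?S k * ?u x)" by (rule ennreal_suminf_multc[symmetric])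
        also have "(\<lambda>k. ennreal (1 / 2 ^ k) * ?S k * ?u x) = (\<lambda>k. ennreal (1 / 2 ^ k) *
         (of_nat (2 * m k) * ?u x + 2 * (\<Sum>i. ?u x * indicator (generation_set g k (2 * (i + m k))) x)))"
        proof -
          have "c * (P + 2 * s) * u = c * (P * u + 2 * (u * s))" for c P s u :: ennreal
            by (simp add: distrib_left distrib_right mult_ac)
          then show ?thesis by (intro ext) (simp only: ennreal_suminf_cmult)
        qed
        finally show ?thesis .
      qed simp
    qed
    also have "\<dots> = (\<Sum>k. \<integral>\<^sup>+x. ennreal (1 / 2 ^ k) *
       (of_nat (2 * m k) * ?u x + 2 * (\<Sum>i. ?u x * indicator (generation_set g k (2 * (i + m k))) x)) \<partial>lebesgue)"
      by (intro nn_integral_suminf borel_measurable_times_ennreal borel_measurable_const borel_measurable_add um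
          borel_measurable_suminf_order Gm)
    also have "\<dots> = (\<Sum>k. ennreal (1 / 2 ^ k) * of_nat (2 * m k) * ?\<omega> +
        ennreal (1 / 2 ^ k) * (2 * (\<Sum>i. \<integral>\<^sup>+x. ?u x * indicator (generation_set g k (2 * (i + m k))) x \<partial>lebesgue)))"
    proof -
      have lin: "(\<integral>\<^sup>+x. c * (p * u x + 2 * (\<Sum>i. h i x)) \<partial>lebesgue) =
          c * p * (\<integral>\<^sup>+x. u x \<partial>lebesgue) + c * (2 * (\<Sum>i. \<integral>\<^sup>+x. h i x \<partial>lebesgue))"
        if "u \<in> borel_measurable lebesgue" "\<And>i. h i \<in> borel_measurable lebesgue"
        for c p :: ennreal and u :: "real^'n \<Rightarrow> ennreal" and h
        using that by (simp add: nn_integral_cmult nn_integral_add nn_integral_suminf distrib_left mult.assoc)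
      show ?thesis unfolding \<omega> by (intro arg_cong[where f = suminf] ext lin um Gm)
    qed
    also have "\<dots> \<le> (\<Sum>k. ennreal (1 / 2 ^ k) * of_nat (2 * m k) * ?\<omega> + ennreal (16 * C * real (m k) powr - \<epsilon>) * ?X)"
    proof (intro suminf_le add_left_mono)
      fix k
      have "ennreal (1 / 2 ^ k) * (2 * (\<Sum>i. \<integral>\<^sup>+x. ?u x * indicator (generation_set g k (2 * (i + m k))) x \<partial>lebesgue)) \<le>
        ennreal (1 / 2 ^ k) * (2 * (\<Sum>i. \<integral>\<^sup>+x\<in>generation_set g k (2 * (i + m k)). ennreal (w x) \<partial>lebesgue))"
        by (intro mult_left_mono suminf_le nn_integral_mono) (auto simp: indicator_def)
      also have "\<dots> \<le> ennreal (16 * C * real (m k) powr - \<epsilon>) * ?X"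
        by (rule stratum_sum_estimate[OF g m])
      finally show "ennreal (1 / 2 ^ k) * (2 * (\<Sum>i. \<integral>\<^sup>+x. ?u x * indicator (generation_set g k (2 * (i + m k))) x \<partial>lebesgue))
        \<le> ennreal (16 * C * real (m k) powr - \<epsilon>) * ?X" .
    qed auto
    also have "\<dots> = ennreal S * ?\<omega> + (\<Sum>k. ennreal (16 * C * real (m k) powr - \<epsilon>)) * ?X"
      unfolding S[symmetric] by (subst suminf_add[symmetric]) auto
    also have "\<dots> \<le> ennreal S * ?\<omega> + ennreal T * ?X"
      by (intro add_left_mono mult_right_mono T) simp
    finally have "ennreal S * ?\<omega> + ?\<omega> \<le> ennreal S * ?\<omega> + ennreal T * ?X"
      by (simp add: distrib_right add.commute)
    moreover have "ennreal S * ?\<omega> \<noteq> \<infinity>" using fin by (simp add: ennreal_mult_eq_top_iff)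
    ultimately show ?thesis by (simp add: ennreal_add_left_cancel_le)
  qed
  have "emeasure \<mu> E = (SUP n. emeasure \<mu> (E \<inter> cball 0 (real n)))"
  proof -
    have "(\<Union>n. E \<inter> cball 0 (real n)) = E" by (auto intro: real_arch_simple)
    moreover have "(SUP n. emeasure \<mu> (E \<inter> cball 0 (real n))) = emeasure \<mu> (\<Union>n. E \<inter> cball 0 (real n))"
      by (rule SUP_emeasure_incseq) (auto simp: sets_\<mu> incseq_def intro!: sets.Int E)
    ultimately show ?thesis by simp
  qed
  also have "\<dots> \<le> ennreal T * ?X" by (rule SUP_least) (rule bounded)
  finally have "emeasure \<mu> E \<le> ennreal T * ?X" .
  moreover have "emeasure \<mu> ?B \<le> ?X" unfolding \<mu>[OF B] by (rule large_level_bound[OF g])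
  moreover have "emeasure \<mu> ?A \<le> emeasure \<mu> (?B \<union> E)"
    by (rule emeasure_mono) (use B E sets_\<mu> in \<open>auto simp: E_def\<close>)
  moreover have "emeasure \<mu> (?B \<union> E) \<le> emeasure \<mu> ?B + emeasure \<mu> E"
    by (rule emeasure_subadditive) (use B E sets_\<mu> in auto)
  ultimately have "emeasure \<mu> ?A \<le> ?X + ennreal T * ?X"
    by (meson add_mono order_trans)
  then show ?thesis unfolding \<mu>[OF A] by (simp add: distrib_right)
qed

end

section \<open>From dyadic potentials to the Riesz potential\<close>

definition riesz :: "(real^'n \<Rightarrow> ennreal) \<Rightarrow> real^'n \<Rightarrow> ennreal" where
  "riesz g x = (\<integral>\<^sup>+z. g z * ennreal (1 / norm (x - z) ^ (CARD('n) - 1)) \<partial>lborel)"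

lemma weight_measurable:
  fixes w :: "real^'n \<Rightarrow> real"
  assumes "weight w"
  shows "w \<in> borel_measurable lebesgue"
proof (rule borel_measurable_LIMSEQ_real)
  fix n
  have "set_integrable lebesgue (cball 0 (real n)) w" using assms by (simp add: weight_def)
  then show "(\<lambda>x. indicator (cball 0 (real n)) x *\<^sub>R w x) \<in> borel_measurable lebesgue"
    unfolding set_integrable_def by (rule borel_measurable_integrable)
next
  fix x :: "real^'n"
  obtain N where N: "norm x \<le> real N" using real_arch_simple by blast
  have "\<forall>\<^sub>F n in sequentially. indicator (cball 0 (real n)) x *\<^sub>R w x = w x"
    using eventually_ge_at_top[of N] by eventually_elim (use N in \<open>auto simp: indicator_def\<close>)
  then show "(\<lambda>n. indicator (cball 0 (real n)) x *\<^sub>R w x) \<longlonglongrightarrow> w x" by (rule tendsto_eventually)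
qed

lemma weight_ball_finite:
  fixes w :: "real^'n \<Rightarrow> real"
  assumes "weight w"
  shows "(\<integral>\<^sup>+x\<in>cball 0 R. ennreal (w x) \<partial>lebesgue) < \<infinity>"
proof -
  have "set_integrable lebesgue (cball 0 R) w" using assms by (simp add: weight_def)
  then have "(\<integral>\<^sup>+x. ennreal (norm (indicator (cball 0 R) x *\<^sub>R w x)) \<partial>lebesgue) < \<infinity>"
    unfolding set_integrable_def integrable_iff_bounded by simp
  moreover have "(\<integral>\<^sup>+x\<in>cball 0 R. ennreal (w x) \<partial>lebesgue) =
      (\<integral>\<^sup>+x. ennreal (norm (indicator (cball 0 R) x *\<^sub>R w x)) \<partial>lebesgue)"
    using assms by (intro nn_integral_cong) (auto simp: weight_def indicator_def)
  ultimately show ?thesis by simp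
qed

text \<open>The lattices \<open>\<int>\<close> and \<open>\<int> + 2\<^sup>d / 3\<close> are at distance at least \<open>1 / 3\<close> because \<open>3\<close> does not divide \<open>2\<^sup>d\<close>. Hence at most one
of them separates two points closer than \<open>1 / 3\<close>. One and the same shift, \<open>L / 3\<close> before rescaling, serves all
scales at once.\<close>

lemma one_third_shift:
  fixes u v :: real
  assumes "\<bar>u - v\<bar> < 1 / 3" "\<lfloor>u\<rfloor> \<noteq> \<lfloor>v\<rfloor>"
  shows "\<lfloor>u - 2 ^ d / 3\<rfloor> = \<lfloor>v - 2 ^ d / 3\<rfloor>"
proof -
  have *: "\<lfloor>u - 2 ^ d / 3\<rfloor> = \<lfloor>v - 2 ^ d / 3\<rfloor>"
    if uv: "v - u < 1 / 3" "u < v" "\<lfloor>u\<rfloor> \<noteq> \<lfloor>v\<rfloor>" for u v :: real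
  proof (rule ccontr)
    assume ne: "\<lfloor>u - 2 ^ d / 3\<rfloor> \<noteq> \<lfloor>v - 2 ^ d / 3\<rfloor>"
    have split: "\<exists>p::int. x < of_int p \<and> of_int p \<le> y" if "x < y" "\<lfloor>x\<rfloor> \<noteq> \<lfloor>y\<rfloor>" for x y :: real
      using that by (intro exI[of _ "\<lfloor>y\<rfloor>"]) linarith
    obtain p :: int where p: "u < of_int p" "of_int p \<le> v" using split uv by blast
    obtain q :: int where q: "u - 2 ^ d / 3 < of_int q" "of_int q \<le> v - 2 ^ d / 3"
      using split[of "u - 2 ^ d / 3" "v - 2 ^ d / 3"] uv ne by auto
    have "\<bar>of_int (3 * (p - q) - 2 ^ d) :: real\<bar> < 1"
      using p q uv by (simp add: abs_less_iff)
    then have "\<bar>3 * (p - q) - 2 ^ d\<bar> < 1" by linarith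
    then have "(2::int) ^ d = 3 * (p - q)" by linarith
    then have "(3::int) dvd 2 ^ d" by simp
    then have "(3::int) dvd 2" by (rule prime_dvd_power[rotated]) simp
    then show False by simp
  qed
  show ?thesis using *[of u v] *[of v u] assms by (cases u v rule: linorder_cases) auto
qed

definition third_shift :: "real \<Rightarrow> 'n set \<Rightarrow> real^'n" where
  "third_shift L I = (\<chi> i. if i \<in> I then L / 3 else 0)"

lemma common_shifted_cell:
  fixes x z :: "real^'n"
  assumes L: "0 < L" and near: "\<And>i. \<bar>x$i - z$i\<bar> < L / 2 ^ d / 3"
  shows "\<exists>I. z \<in> dyadic_cell (third_shift L I) L d x"
proof -
  define I where "I = {i. \<lfloor>z$i * 2^d / L\<rfloor> \<noteq> \<lfloor>x$i * 2^d / L\<rfloor>}"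
  have "\<lfloor>(z$i - third_shift L I $ i) * 2^d / L\<rfloor> = \<lfloor>(x$i - third_shift L I $ i) * 2^d / L\<rfloor>" for i
  proof (cases "i \<in> I")
    case True
    have e: "(y - L / 3) * 2^d / L = y * 2^d / L - 2^d / 3" for y
      using L by (simp add: field_simps)
    have "z$i * 2^d / L - x$i * 2^d / L = (z$i - x$i) * (2^d / L)"
      by (simp add: left_diff_distrib diff_divide_distrib)
    then have "\<bar>z$i * 2^d / L - x$i * 2^d / L\<bar> = \<bar>x$i - z$i\<bar> * (2^d / L)"
      using L by (simp add: abs_mult abs_minus_commute)
    also have "\<dots> < L / 2 ^ d / 3 * (2^d / L)"
      by (rule mult_strict_right_mono[OF near]) (use L in simp)
    also have "\<dots> = 1 / 3" using L by simp
    finally show ?thesis using True one_third_shift by (simp add: third_shift_def I_def e)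
  qed (simp add: third_shift_def I_def)
  then show ?thesis unfolding dyadic_cell_def by auto
qed

lemma dyadic_scale_exists:
  fixes s L :: real
  assumes "0 < s" "s < L"
  shows "\<exists>d. L / 2 ^ Suc d \<le> s \<and> s < L / 2 ^ d"
proof -
  have ex: "\<exists>d. L / 2 ^ Suc d \<le> s"
  proof -
    obtain d where "(1/2::real) ^ d < s / L" using real_arch_pow_inv[of "s / L" "1/2"] assms by auto
    then have "L / 2 ^ d < s" using assms by (simp add: power_one_over field_simps)
    moreover have "L / 2 ^ Suc d \<le> L / 2 ^ d" using assms by (intro divide_left_mono) auto
    ultimately show ?thesis by (intro exI[of _ d]) linarith
  qed
  define d where "d = (LEAST d. L / 2 ^ Suc d \<le> s)"
  have 1: "L / 2 ^ Suc d \<le> s" unfolding d_def using ex by (rule LeastI_ex)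
  have 2: "s < L / 2 ^ d"
  proof (cases d)
    case (Suc e)
    then have "\<not> L / 2 ^ Suc e \<le> s"
      using not_less_Least[of e "\<lambda>d. L / 2 ^ Suc d \<le> s"] by (simp add: d_def)
    then show ?thesis using Suc by simp
  qed (use assms in simp)
  show ?thesis using 1 2 by blast
qed

text \<open>Choose the scale comparable to \<open>|x - z|\<^sub>\<infinity>\<close> and, in each coordinate, the grid that does not separate the two
points.\<close>

lemma kernel_le_dyadic:
  fixes x z :: "real^'n"
  assumes L: "0 < L" and n: "2 \<le> CARD('n)" and near: "\<And>i. \<bar>x$i - z$i\<bar> < L / 3"
  shows "ennreal (1 / norm (x - z) ^ (CARD('n) - 1)) \<le>
    (\<Sum>I\<in>UNIV. \<Sum>d. ennreal (6 ^ (CARD('n) - 1) * (L / 2 ^ d / (L / 2 ^ d) ^ CARD('n))) *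
       indicator (dyadic_cell (third_shift L I) L d x) z)"
    (is "?K \<le> (\<Sum>I\<in>UNIV. \<Sum>d. ?t I d)")
proof (cases "x = z")
  case True
  then show ?thesis using n by (simp add: power_0_left)
next
  case False
  define s where "s = Max (range (\<lambda>i. \<bar>x$i - z$i\<bar>))"
  have s_ge: "\<bar>x$i - z$i\<bar> \<le> s" for i by (simp add: s_def)
  have "s \<in> range (\<lambda>i. \<bar>x$i - z$i\<bar>)" unfolding s_def by (rule Max_in) auto
  then obtain i0 where i0: "s = \<bar>x$i0 - z$i0\<bar>" by blast
  obtain i where "x$i \<noteq> z$i" using False by (auto simp: vec_eq_iff)
  then have "0 < s" using s_ge[of i] by linarith
  moreover have "s < L / 3" using near i0 by simp
  ultimately obtain d where d: "L / 3 / 2 ^ Suc d \<le> s" "s < L / 3 / 2 ^ d"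
    using dyadic_scale_exists by blast
  have "\<bar>x$i - z$i\<bar> < L / 2 ^ d / 3" for i
  proof -
    have "L / 3 / 2 ^ d = L / 2 ^ d / 3" by simp
    then show ?thesis using le_less_trans[OF s_ge[of i] d(2)] by (simp only:)
  qed
  then obtain I where I: "z \<in> dyadic_cell (third_shift L I) L d x"
    using common_shifted_cell[OF L] by blast
  let ?l = "L / 2 ^ d"
  have l: "0 < ?l" using L by simp
  have "s \<le> norm (x - z)" using component_le_norm_cart[of "x - z" i0] i0 by simp
  then have "L / 3 / 2 ^ Suc d \<le> norm (x - z)" using d(1) by (rule order_trans[rotated])
  moreover have "L / 3 / 2 ^ Suc d = ?l / 6" by simp
  ultimately have nz: "?l / 6 \<le> norm (x - z)" by (simp only:)
  have "1 / norm (x - z) ^ (CARD('n) - 1) \<le> 1 / (?l / 6) ^ (CARD('n) - 1)"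
    using nz l by (intro divide_left_mono power_mono zero_less_power mult_pos_pos) (auto intro: less_le_trans)
  also have "\<dots> = 6 ^ (CARD('n) - 1) * (?l / ?l ^ CARD('n))"
  proof -
    have "?l ^ CARD('n) = ?l * ?l ^ (CARD('n) - 1)"
      using n by (simp add: power_eq_if)
    then show ?thesis using l L by (simp add: power_divide)
  qed
  finally have "?K \<le> ?t I d" using I by (simp add: ennreal_leI)
  have single: "sum f {y} = f y" for f :: "'c \<Rightarrow> ennreal" and y by simp
  note \<open>?K \<le> ?t I d\<close>
  also have "?t I d = sum (?t I) {d}" by (rule single[symmetric])
  also have "\<dots> \<le> (\<Sum>d. ?t I d)" by (rule sum_le_suminf) auto
  also have "\<dots> = (\<Sum>I\<in>{I}. \<Sum>d. ?t I d)" by (rule single[symmetric])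
  also have "\<dots> \<le> (\<Sum>I\<in>UNIV. \<Sum>d. ?t I d)" by (rule sum_mono2) auto
  finally show ?thesis .
qed

lemma truncated_riesz_le_dyadic:
  fixes x :: "real^'n" and g :: "real^'n \<Rightarrow> ennreal"
  assumes L: "0 < L" and n: "2 \<le> CARD('n)" and g: "g \<in> borel_measurable borel"
  shows "(\<integral>\<^sup>+z\<in>{z. \<forall>i. \<bar>x$i - z$i\<bar> < L / 3}. g z * ennreal (1 / norm (x - z) ^ (CARD('n) - 1)) \<partial>lborel) \<le>
    ennreal (6 ^ (CARD('n) - 1)) * (\<Sum>I\<in>UNIV. \<Sum>d. dyadic_level (third_shift L I) L g d x)"
proof -
  let ?c = "\<lambda>d. ennreal (6 ^ (CARD('n) - 1) * (L / 2 ^ d / (L / 2 ^ d) ^ CARD('n)))"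
  have cell: "dyadic_cell a L d x \<in> sets borel" for a :: "real^'n" and d x
  proof -
    interpret dyadic_grid a L by unfold_locales (fact L)
    show ?thesis by simp
  qed
  have gi: "(\<lambda>z. g z * indicator (dyadic_cell (third_shift L I) L d x) z) \<in> borel_measurable lborel" for I d
    using g cell by (auto intro!: borel_measurable_times_ennreal borel_measurable_indicator)
  have "(\<integral>\<^sup>+z\<in>{z. \<forall>i. \<bar>x$i - z$i\<bar> < L / 3}. g z * ennreal (1 / norm (x - z) ^ (CARD('n) - 1)) \<partial>lborel) \<le>
    (\<integral>\<^sup>+z. (\<Sum>I\<in>UNIV. \<Sum>d. ?c d * (g z * indicator (dyadic_cell (third_shift L I) L d x) z)) \<partial>lborel)"
  proof (rule nn_integral_mono)
    fix z
    show "g z * ennreal (1 / norm (x - z) ^ (CARD('n) - 1)) * indicator {z. \<forall>i. \<bar>x$i - z$i\<bar> < L / 3} z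
      \<le> (\<Sum>I\<in>UNIV. \<Sum>d. ?c d * (g z * indicator (dyadic_cell (third_shift L I) L d x) z))"
    proof (cases "\<forall>i. \<bar>x$i - z$i\<bar> < L / 3")
      case True
      have "g z * ennreal (1 / norm (x - z) ^ (CARD('n) - 1)) \<le> g z *
        (\<Sum>I\<in>UNIV. \<Sum>d. ?c d * indicator (dyadic_cell (third_shift L I) L d x) z)"
        using True by (intro mult_left_mono kernel_le_dyadic[OF L n]) auto
      also have "\<dots> = (\<Sum>I\<in>UNIV. \<Sum>d. g z * (?c d * indicator (dyadic_cell (third_shift L I) L d x) z))"
        by (simp only: sum_distrib_left ennreal_suminf_cmult)
      finally show ?thesis using True by (simp only: mult.left_commute) simp
    qed simp
  qed
  also have "\<dots> = (\<Sum>I\<in>UNIV. \<Sum>d. ?c d * (\<integral>\<^sup>+z\<in>dyadic_cell (third_shift L I) L d x. g z \<partial>lborel))"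
    using gi by (simp add: nn_integral_sum nn_integral_suminf nn_integral_cmult)
  also have "\<dots> = (\<Sum>I\<in>UNIV. \<Sum>d. ennreal (6 ^ (CARD('n) - 1)) * dyadic_level (third_shift L I) L g d x)"
  proof (intro sum.cong refl arg_cong[where f = suminf] ext)
    fix I d
    let ?l = "L / 2 ^ d" and ?J = "\<integral>\<^sup>+z\<in>dyadic_cell (third_shift L I) L d x. g z \<partial>lborel"
    have l: "0 < ?l" using L by simp
    have "?c d * ?J = ennreal (6 ^ (CARD('n) - 1)) * (ennreal ?l * (ennreal (inverse (?l ^ CARD('n))) * ?J))"
      using l by (subst ennreal_mult_mult, simp, simp, subst ennreal_mult_mult) (auto simp: divide_inverse)
    also have "ennreal (inverse (?l ^ CARD('n))) * ?J = ?J / ennreal (?l ^ CARD('n))"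
      using l by (simp only: divide_ennreal_def inverse_ennreal zero_less_power mult.commute)
    finally show "?c d * ?J = ennreal (6 ^ (CARD('n) - 1)) * dyadic_level (third_shift L I) L g d x"
      by (simp only: dyadic_level_def nn_integral_completion)
  qed
  also have "\<dots> = ennreal (6 ^ (CARD('n) - 1)) * (\<Sum>I\<in>UNIV. \<Sum>d. dyadic_level (third_shift L I) L g d x)"
    by (simp only: sum_distrib_left ennreal_suminf_cmult)
  finally show ?thesis .
qed

lemma level_cmult:
  assumes "0 < L" "g \<in> borel_measurable borel"
  shows "dyadic_level a L (\<lambda>x. c * g x) d x = c * dyadic_level a L g d x"
proof -
  interpret dyadic_grid a L by unfold_locales fact
  have "(\<integral>\<^sup>+y\<in>cell d x. c * g y \<partial>lebesgue) = c * (\<integral>\<^sup>+y\<in>cell d x. g y \<partial>lebesgue)"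
    unfolding mult.assoc nn_integral_completion
    using assms(2) by (intro nn_integral_cmult borel_measurable_times_ennreal borel_measurable_indicator) auto
  then show ?thesis by (simp only: dyadic_level_def divide_ennreal_def mult_ac)
qed

lemma geometric_ennreal_finite:
  fixes r c :: real
  assumes "0 \<le> c" "0 \<le> r" "r < 1"
  shows "(\<Sum>k. ennreal (c * r ^ k)) < \<infinity>"
proof -
  have "(\<Sum>k. ennreal (c * r ^ k)) = ennreal (\<Sum>k. c * r ^ k)"
    by (rule suminf_ennreal2) (use assms in \<open>auto intro!: summable_mult summable_geometric\<close>)
  then show ?thesis by simp
qed

text \<open>The choice \<open>m\<^sub>k = \<lceil>\<surd>2\<^bsup>k\<^esup>\<rceil>\<close> grows slowly enough for \<open>\<Sum>\<^sub>k 2\<^bsup>-k\<^esup> m\<^sub>k\<close> and fast enough for \<open>\<Sum>\<^sub>k m\<^sub>k\<^bsup>-\<epsilon>\<^esup>\<close> to converge.\<close>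

lemma layer_counts:
  fixes \<epsilon> C :: real
  assumes "0 < \<epsilon>" "0 < C"
  obtains m :: "nat \<Rightarrow> nat" and S T where "\<And>k. 1 \<le> m k" "0 \<le> S" "0 \<le> T"
    "(\<Sum>k. ennreal (1 / 2 ^ k) * of_nat (2 * m k)) = ennreal S"
    "(\<Sum>k. ennreal (16 * C * real (m k) powr - \<epsilon>)) \<le> ennreal T"
proof -
  define m where "m k = nat \<lceil>sqrt 2 ^ k\<rceil>" for k
  have q: "1 \<le> sqrt 2 ^ k" for k by (rule one_le_power) simp
  have m: "sqrt 2 ^ k \<le> real (m k)" "real (m k) \<le> 2 * sqrt 2 ^ k" "1 \<le> m k" for k
    using q[of k] unfolding m_def by linarith+
  have "(\<Sum>k. ennreal (1 / 2 ^ k) * of_nat (2 * m k)) \<le> (\<Sum>k. ennreal (4 * (sqrt 2 / 2) ^ k))"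
  proof (intro suminf_le)
    fix k
    have "ennreal (1 / 2 ^ k) * of_nat (2 * m k) = ennreal (1 / 2 ^ k * real (2 * m k))"
      unfolding ennreal_of_nat_eq_real_of_nat by (rule ennreal_mult[symmetric]) auto
    also have "\<dots> \<le> ennreal (4 * (sqrt 2 / 2) ^ k)"
      using m(2)[of k] by (intro ennreal_leI) (simp add: power_divide field_simps)
    finally show "ennreal (1 / 2 ^ k) * of_nat (2 * m k) \<le> ennreal (4 * (sqrt 2 / 2) ^ k)" .
  qed auto
  also have "\<dots> < \<infinity>" by (rule geometric_ennreal_finite) (auto simp: real_less_lsqrt sqrt2_less_2)
  finally obtain S where S: "0 \<le> S" "(\<Sum>k. ennreal (1 / 2 ^ k) * of_nat (2 * m k)) = ennreal S"
    by (cases "\<Sum>k. ennreal (1 / 2 ^ k) * of_nat (2 * m k)") (auto simp only: infinity_ennreal_def less_irrefl)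
  have "(\<Sum>k. ennreal (16 * C * real (m k) powr - \<epsilon>)) \<le> (\<Sum>k. ennreal (16 * C * (sqrt 2 powr - \<epsilon>) ^ k))"
  proof (intro suminf_le ennreal_leI mult_left_mono)
    fix k
    have "real (m k) powr - \<epsilon> \<le> (sqrt 2 ^ k) powr - \<epsilon>"
      using m(1)[of k] assms by (intro powr_mono2') auto
    also have "\<dots> = (sqrt 2 powr - \<epsilon>) ^ k"
      by (simp add: powr_realpow[symmetric] powr_powr mult.commute)
    finally show "real (m k) powr - \<epsilon> \<le> (sqrt 2 powr - \<epsilon>) ^ k" .
  qed (use assms in auto)
  also have "\<dots> < \<infinity>"
    using assms by (intro geometric_ennreal_finite) (auto simp: powr_less_one)
  finally obtain T where T: "0 \<le> T" "(\<Sum>k. ennreal (16 * C * real (m k) powr - \<epsilon>)) = ennreal T"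
    by (cases "\<Sum>k. ennreal (16 * C * real (m k) powr - \<epsilon>)") (auto simp only: infinity_ennreal_def less_irrefl)
  show ?thesis by (rule that[OF m(3) S(1) T(1) S(2)]) (simp add: T(2))
qed

text \<open>After truncating the kernel at distance \<open>L / 3\<close>, the potential is dominated by the \<open>2\<^sup>n\<close> dyadic potentials of
the shifted grids of top side \<open>L\<close>, with constants that do not depend on \<open>L\<close>. Fatou's lemma then lets \<open>L\<close> tend
to infinity; scaling \<open>g\<close> reduces the level \<open>t\<close> to the fixed threshold of the dyadic estimate.\<close>

theorem riesz_weak_type:
  fixes w :: "real^'n \<Rightarrow> real"
  assumes n: "2 \<le> CARD('n)" and w: "weight w" and \<epsilon>: "0 < \<epsilon>"
  shows "\<exists>C>0. \<forall>g\<in>borel_measurable borel. \<forall>t>0.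
    ennreal t * (\<integral>\<^sup>+x\<in>{x. ennreal t < riesz g x}. ennreal (w x) \<partial>lebesgue) \<le>
    ennreal C * (\<integral>\<^sup>+x. g x * frac_maximal_1 (orlicz_maximal (LlogL_young \<epsilon>) w) x \<partial>lebesgue)"
proof -
  obtain G where G: "0 < G" "\<And>i. 1 \<le> i \<Longrightarrow>
      2 powr (real i / 2) * (2 / 2 ^ i) + 1 / ln (exp 1 + 2 powr (real i / 2)) powr \<epsilon> \<le> G * real i powr - \<epsilon>"
    using log_bump_gain[OF \<epsilon>] by blast
  obtain m S T where m: "\<And>k. 1 \<le> m k" and S0: "0 \<le> S" and T0: "0 \<le> T"
    and S: "(\<Sum>k. ennreal (1 / 2 ^ k) * of_nat (2 * m k)) = ennreal S"
    and T: "(\<Sum>k. ennreal (16 * G * real (m k) powr - \<epsilon>)) \<le> ennreal T"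
    using layer_counts[OF \<epsilon> G(1)] by blast
  define \<Lambda> where "\<Lambda> = 1 + S"
  have \<Lambda>: "1 \<le> \<Lambda>" using S0 by (simp add: \<Lambda>_def)
  let ?M = "frac_maximal_1 (orlicz_maximal (LlogL_young \<epsilon>) w)"
  let ?K = "6 ^ (CARD('n) - 1) * 2 ^ CARD('n) :: real"
  define C where "C = 2 ^ CARD('n) * (1 + T) * (\<Lambda> * ?K)"
  have wm: "w \<in> borel_measurable lebesgue" by (rule weight_measurable[OF w])
  have "ennreal t * (\<integral>\<^sup>+x\<in>{x. ennreal t < riesz g x}. ennreal (w x) \<partial>lebesgue) \<le>
    ennreal C * (\<integral>\<^sup>+x. g x * ?M x \<partial>lebesgue)"
    if g: "g \<in> borel_measurable borel" and t: "0 < t" for g t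
  proof -
    \<comment> \<open>Multiplying \<open>g\<close> by \<open>c\<close> sends the level \<open>t\<close> to \<open>?K * \<Lambda>\<close>: the threshold \<open>\<Lambda>\<close> in each of the \<open>2\<^sup>n\<close> grids,
      times the constant \<open>6\<^bsup>n-1\<^esup>\<close> in the bound of the kernel.\<close>
    define c where "c = \<Lambda> * ?K / t"
    have c: "0 < c" using \<Lambda> t by (simp add: c_def)
    let ?X = "\<integral>\<^sup>+x. g x * ?M x \<partial>lebesgue"
    define A where "A N I = {x. ennreal \<Lambda> < (\<Sum>d. dyadic_level (third_shift (real (Suc N)) I) (real (Suc N)) (\<lambda>x. ennreal c * g x) d x)}"
      for N and I :: "'n set"
    define U where "U N = (\<Union>I. A N I)" for N
    have gc: "(\<lambda>x. ennreal c * g x) \<in> borel_measurable borel" using g by simp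
    have A_meas: "A N I \<in> sets lebesgue" for N I
    proof -
      interpret weighted_dyadic_grid "third_shift (real (Suc N)) I" "real (Suc N)" w \<epsilon> G
        using w wm G(2) \<epsilon> weight_ball_finite[OF w] by unfold_locales (auto simp: weight_def)
      have [measurable]: "level (\<lambda>x. ennreal c * g x) d \<in> borel_measurable borel" for d by (rule level_borel)
      show ?thesis unfolding A_def by (rule borel_set_lebesgue) measurable
    qed
    have A_le: "(\<integral>\<^sup>+x\<in>A N I. ennreal (w x) \<partial>lebesgue) \<le> ennreal ((1 + T) * c) * ?X" for N I
    proof -
      interpret weighted_dyadic_grid "third_shift (real (Suc N)) I" "real (Suc N)" w \<epsilon> G
        using w wm G(2) \<epsilon> weight_ball_finite[OF w] by unfold_locales (auto simp: weight_def)
      have \<Lambda>e: "ennreal \<Lambda> = 1 + ennreal S" using S0 by (simp add: \<Lambda>_def)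
      have "(\<integral>\<^sup>+x\<in>A N I. ennreal (w x) \<partial>lebesgue) \<le> (1 + ennreal T) * (\<integral>\<^sup>+x. ennreal c * g x * dyadic_frac x \<partial>lebesgue)"
        unfolding A_def \<Lambda>e by (rule dyadic_weak_type[OF borel_lebesgue[OF gc] m S T])
      also have "\<dots> \<le> (1 + ennreal T) * (\<integral>\<^sup>+x. ennreal c * (g x * dyadic_frac x) \<partial>lebesgue)"
        by (simp only: mult.assoc order_refl)
      also have "(\<integral>\<^sup>+x. ennreal c * (g x * dyadic_frac x) \<partial>lebesgue) = ennreal c * (\<integral>\<^sup>+x. g x * dyadic_frac x \<partial>lebesgue)"
        by (intro nn_integral_cmult borel_measurable_times_ennreal borel_lebesgue g dyadic_frac_measurable)
      also have "(1 + ennreal T) * (ennreal c * (\<integral>\<^sup>+x. g x * dyadic_frac x \<partial>lebesgue)) \<le> (1 + ennreal T) * (ennreal c * ?X)"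
        by (intro mult_left_mono nn_integral_mono dyadic_frac_le) auto
      also have "1 + ennreal T = ennreal (1 + T)" using T0 by simp
      also have "ennreal (1 + T) * (ennreal c * ?X) = ennreal ((1 + T) * c) * ?X"
        using T0 c by (intro ennreal_mult_mult) auto
      finally show ?thesis .
    qed
    have U_meas: "U N \<in> sets lebesgue" for N unfolding U_def using A_meas by auto
    have U_le: "(\<integral>\<^sup>+x\<in>U N. ennreal (w x) \<partial>lebesgue) \<le> ennreal (2 ^ CARD('n) * ((1 + T) * c)) * ?X" for N
    proof -
      have "(\<integral>\<^sup>+x\<in>U N. ennreal (w x) \<partial>lebesgue) \<le> (\<integral>\<^sup>+x. (\<Sum>I\<in>UNIV. ennreal (w x) * indicator (A N I) x) \<partial>lebesgue)"
      proof (rule nn_integral_mono)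
        fix x
        show "ennreal (w x) * indicator (U N) x \<le> (\<Sum>I\<in>UNIV. ennreal (w x) * indicator (A N I) x)"
        proof (cases "x \<in> U N")
          case True
          then obtain I where "x \<in> A N I" by (auto simp: U_def)
          then have "ennreal (w x) * indicator (U N) x = (\<Sum>I\<in>{I}. ennreal (w x) * indicator (A N I) x)"
            using True by simp
          also have "\<dots> \<le> (\<Sum>I\<in>UNIV. ennreal (w x) * indicator (A N I) x)" by (rule sum_mono2) auto
          finally show ?thesis .
        qed simp
      qed
      also have "\<dots> = (\<Sum>I\<in>UNIV. \<integral>\<^sup>+x\<in>A N I. ennreal (w x) \<partial>lebesgue)"
        using wm A_meas by (intro nn_integral_sum borel_measurable_times_ennreal borel_measurable_indicator) auto
      also have "\<dots> \<le> (\<Sum>I\<in>(UNIV :: 'n set set). ennreal ((1 + T) * c) * ?X)" by (intro sum_mono A_le)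
      also have "\<dots> = ennreal (2 ^ CARD('n)) * (ennreal ((1 + T) * c) * ?X)"
        by (simp add: card_UNIV_set ennreal_power[symmetric] card_Pow flip: Pow_UNIV)
      also have "\<dots> = ennreal (2 ^ CARD('n) * ((1 + T) * c)) * ?X"
        using T0 c by (intro ennreal_mult_mult) auto
      finally show ?thesis .
    qed
    have ev: "\<forall>\<^sub>F N in sequentially. x \<in> U N" if x: "ennreal t < riesz g x" for x
    proof -
      let ?f = "\<lambda>N z. g z * ennreal (1 / norm (x - z) ^ (CARD('n) - 1)) * indicator {z. \<forall>i. \<bar>x$i - z$i\<bar> < real (Suc N) / 3} z"
      have m: "?f N \<in> borel_measurable lborel" for N
        using g by measurable
      have inc: "incseq ?f"
        by (rule incseq_SucI) (auto simp: le_fun_def indicator_def intro: less_trans)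
      have "riesz g x = (\<integral>\<^sup>+z. (SUP N. ?f N z) \<partial>lborel)"
        unfolding riesz_def
      proof (rule nn_integral_cong)
        fix z
        obtain N where N: "norm (x - z) * 3 < real N" using reals_Archimedean2 by blast
        have "\<bar>x$i - z$i\<bar> < real (Suc N) / 3" for i
          using component_le_norm_cart[of "x - z" i] N by simp
        then have "?f N z = g z * ennreal (1 / norm (x - z) ^ (CARD('n) - 1))" by simp
        then show "g z * ennreal (1 / norm (x - z) ^ (CARD('n) - 1)) = (SUP N. ?f N z)"
          by (intro antisym SUP_upper2[of N] SUP_least) (auto simp: indicator_def)
      qed
      also have "\<dots> = (SUP N. \<integral>\<^sup>+z. ?f N z \<partial>lborel)"
        by (rule nn_integral_monotone_convergence_SUP[OF inc m])
      finally obtain N0 where N0: "ennreal t < (\<integral>\<^sup>+z. ?f N0 z \<partial>lborel)"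
        using x by (auto simp: less_SUP_iff)
      have "x \<in> U N" if N: "N0 \<le> N" for N
      proof (rule ccontr)
        assume "x \<notin> U N"
        then have no: "(\<Sum>d. dyadic_level (third_shift (real (Suc N)) I) (real (Suc N)) (\<lambda>x. ennreal c * g x) d x) \<le> ennreal \<Lambda>" for I
          by (simp add: U_def A_def not_less)
        have "ennreal c * ennreal t < ennreal c * (\<integral>\<^sup>+z. ?f N0 z \<partial>lborel)"
          using N0 c by (intro ennreal_mult_strict_left_mono) auto
        also have "\<dots> \<le> ennreal c * (\<integral>\<^sup>+z. ?f N z \<partial>lborel)"
          by (intro mult_left_mono nn_integral_mono le_funD[OF incseqD[OF inc N]] zero_le)
        also have "\<dots> \<le> ennreal c * (ennreal (6 ^ (CARD('n) - 1)) *
          (\<Sum>I\<in>UNIV. \<Sum>d. dyadic_level (third_shift (real (Suc N)) I) (real (Suc N)) g d x))"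
          by (intro mult_left_mono truncated_riesz_le_dyadic n g) auto
        also have "\<dots> = ennreal (6 ^ (CARD('n) - 1)) *
          (\<Sum>I\<in>UNIV. \<Sum>d. dyadic_level (third_shift (real (Suc N)) I) (real (Suc N)) (\<lambda>x. ennreal c * g x) d x)"
          using g by (simp only: level_cmult of_nat_0_less_iff zero_less_Suc ennreal_suminf_cmult sum_distrib_left[symmetric] mult.left_commute)
        also have "\<dots> \<le> ennreal (6 ^ (CARD('n) - 1)) * (\<Sum>I\<in>(UNIV :: 'n set set). ennreal \<Lambda>)"
          by (intro mult_left_mono sum_mono no) auto
        also have "\<dots> = ennreal (6 ^ (CARD('n) - 1)) * (ennreal (2 ^ CARD('n)) * ennreal \<Lambda>)"
          by (simp add: card_UNIV_set ennreal_power[symmetric] card_Pow flip: Pow_UNIV)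
        also have "\<dots> = ennreal (?K * \<Lambda>)" using \<Lambda> by (simp add: ennreal_mult mult.assoc)
        also have "?K * \<Lambda> = c * t" using t by (simp add: c_def)
        also have "ennreal (c * t) = ennreal c * ennreal t" using c t by (intro ennreal_mult) auto
        finally show False by simp
      qed
      then show ?thesis by (auto simp: eventually_sequentially)
    qed
    have "(\<integral>\<^sup>+x\<in>{x. ennreal t < riesz g x}. ennreal (w x) \<partial>lebesgue) \<le>
      (\<integral>\<^sup>+x. liminf (\<lambda>N. ennreal (w x) * indicator (U N) x) \<partial>lebesgue)"
    proof (rule nn_integral_mono)
      fix x
      show "ennreal (w x) * indicator {x. ennreal t < riesz g x} x \<le> liminf (\<lambda>N. ennreal (w x) * indicator (U N) x)"
      proof (cases "ennreal t < riesz g x")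
        case True
        have "\<forall>\<^sub>F N in sequentially. ennreal (w x) \<le> ennreal (w x) * indicator (U N) x"
          using ev[OF True] by eventually_elim simp
        then have "ennreal (w x) \<le> liminf (\<lambda>N. ennreal (w x) * indicator (U N) x)"
          by (rule Liminf_bounded)
        then show ?thesis using True by simp
      qed simp
    qed
    also have "\<dots> \<le> liminf (\<lambda>N. \<integral>\<^sup>+x\<in>U N. ennreal (w x) \<partial>lebesgue)"
      using wm U_meas by (intro nn_integral_liminf borel_measurable_times_ennreal borel_measurable_indicator) auto
    also have "\<dots> \<le> ennreal (2 ^ CARD('n) * ((1 + T) * c)) * ?X"
    proof -
      have "liminf (\<lambda>N. \<integral>\<^sup>+x\<in>U N. ennreal (w x) \<partial>lebesgue) \<le> limsup (\<lambda>N. \<integral>\<^sup>+x\<in>U N. ennreal (w x) \<partial>lebesgue)"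
        by (rule Liminf_le_Limsup) simp
      also have "\<dots> \<le> ennreal (2 ^ CARD('n) * ((1 + T) * c)) * ?X"
        by (rule Limsup_bounded) (simp add: U_le)
      finally show ?thesis .
    qed
    finally have "ennreal t * (\<integral>\<^sup>+x\<in>{x. ennreal t < riesz g x}. ennreal (w x) \<partial>lebesgue) \<le>
      ennreal t * (ennreal (2 ^ CARD('n) * ((1 + T) * c)) * ?X)"
      by (rule mult_left_mono) simp
    also have "\<dots> = ennreal (t * (2 ^ CARD('n) * ((1 + T) * c))) * ?X"
      using t T0 c by (intro ennreal_mult_mult) auto
    also have "t * (2 ^ CARD('n) * ((1 + T) * c)) = C"
      using t by (simp add: C_def c_def)
    finally show ?thesis .
  qed
  moreover have "0 < C" using \<Lambda> T0 by (simp add: C_def add_pos_nonneg)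
  ultimately show ?thesis by blast
qed

section \<open>Integrals of the Riesz kernel\<close>

lemma nn_integral_affine:
  fixes f :: "real^'n \<Rightarrow> ennreal"
  assumes f: "f \<in> borel_measurable borel" and c: "c \<noteq> 0"
  shows "(\<integral>\<^sup>+z. f z \<partial>lborel) = ennreal (\<bar>c\<bar> ^ CARD('n)) * (\<integral>\<^sup>+y. f (t + c *\<^sub>R y) \<partial>lborel)"
proof -
  have "(\<integral>\<^sup>+z. f z \<partial>lborel) =
      (\<integral>\<^sup>+z. f z \<partial>density (distr lborel borel (\<lambda>y. t + c *\<^sub>R y)) (\<lambda>_. ennreal (\<bar>c\<bar> ^ CARD('n))))"
    using lborel_affine[OF c, of t] by simp
  also have "\<dots> = ennreal (\<bar>c\<bar> ^ CARD('n)) * (\<integral>\<^sup>+y. f (t + c *\<^sub>R y) \<partial>lborel)"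
    using f by (simp add: nn_integral_density nn_integral_distr nn_integral_cmult)
  finally show ?thesis .
qed

lemma nn_integral_reflect:
  fixes f :: "real^'n \<Rightarrow> ennreal"
  assumes f: "f \<in> borel_measurable borel"
  shows "(\<integral>\<^sup>+z. f (x - z) \<partial>lborel) = (\<integral>\<^sup>+z. f z \<partial>lborel)"
  using nn_integral_affine[OF f, of "-1" x] by simp

text \<open>Writing the inverse power \<open>\<rho>\<^bsup>-k\<^esup>\<close> as the integral of \<open>k s\<^bsup>-k-1\<^esup>\<close> over the radii \<open>s \<ge> \<rho>\<close> and interchanging the order
of integration takes the place of polar coordinates.\<close>

lemma nn_integral_tail:
  fixes \<rho> :: real
  assumes \<rho>: "0 < \<rho>" and k: "1 \<le> k"
  shows "(\<integral>\<^sup>+s. ennreal (1 / s ^ Suc k) * indicator {\<rho>..} s \<partial>lborel) = ennreal (1 / (real k * \<rho> ^ k))"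
proof -
  define F where "F s = - (1 / (real k * s ^ k))" for s :: real
  have D: "DERIV F s :> 1 / s ^ Suc k" if "\<rho> \<le> s" for s
  proof -
    have s: "s \<noteq> 0" using that \<rho> by simp
    obtain j where j: "k = Suc j" using k by (cases k) auto
    have "DERIV (\<lambda>s. - (1 / real k) * inverse (s ^ k)) s :>
        - (1 / real k) * - (inverse (s ^ k) * (real k * s ^ (k - Suc 0)) * inverse (s ^ k))"
      by (rule DERIV_cmult[OF DERIV_inverse'[OF DERIV_pow]]) (use s in simp)
    moreover have "s ^ (k - Suc 0) * inverse (s ^ k) = inverse s"
      using s by (simp add: j)
    then have "- (1 / real k) * - (inverse (s ^ k) * (real k * s ^ (k - Suc 0)) * inverse (s ^ k)) = 1 / s ^ Suc k"
      using k by (simp add: divide_inverse)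
    moreover have "F = (\<lambda>s. - (1 / real k) * inverse (s ^ k))"
      by (simp add: F_def[abs_def] divide_inverse)
    ultimately show ?thesis by simp
  qed
  have lim: "(F \<longlongrightarrow> 0) at_top"
  proof -
    have "filterlim (\<lambda>s::real. real k * s ^ k) at_top at_top"
      using k by (intro filterlim_tendsto_pos_mult_at_top[OF tendsto_const] filterlim_pow_at_top filterlim_ident) auto
    then have "((\<lambda>s. inverse (real k * s ^ k)) \<longlongrightarrow> 0) at_top"
      by (rule tendsto_inverse_0_at_top)
    from tendsto_minus[OF this] show ?thesis by (simp add: F_def[abs_def] inverse_eq_divide)
  qed
  have "(\<integral>\<^sup>+s. ennreal (1 / s ^ Suc k) * indicator {\<rho>..} s \<partial>lborel) = ennreal (0 - F \<rho>)"
    by (rule nn_integral_FTC_atLeast[OF _ D _ lim]) (use \<rho> in auto)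
  then show ?thesis by (simp add: F_def)
qed

text \<open>Decompose the ball into dyadic annuli: the annulus of radius \<open>R 2\<^bsup>-j\<^esup>\<close> contributes a constant times \<open>R 2\<^bsup>-j\<^esup>\<close>. Only the
growth of the density \<open>H\<close> on centred balls matters, so that the estimate covers \<open>H = 1\<close> as well as \<open>H = |\<Omega>|\<close>.\<close>

lemma singular_integral_ball:
  fixes H :: "real^'n \<Rightarrow> ennreal"
  assumes H: "H \<in> borel_measurable lebesgue" and R: "0 < R" and c: "0 \<le> c" and n: "2 \<le> CARD('n)"
    and growth: "\<And>r. 0 < r \<Longrightarrow> r \<le> R \<Longrightarrow> (\<integral>\<^sup>+z\<in>ball 0 r. H z \<partial>lebesgue) \<le> ennreal (c * r ^ CARD('n))"
  shows "(\<integral>\<^sup>+z\<in>ball 0 R. H z * ennreal (1 / norm z ^ (CARD('n) - 1)) \<partial>lebesgue) \<le> ennreal (2 ^ CARD('n) * c * R)"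
proof -
  let ?n = "CARD('n)"
  let ?b = "\<lambda>j. ennreal ((2 ^ Suc j / R) ^ (?n - 1))"
  have Hm: "(\<lambda>z. H z * indicator (ball 0 (R / 2 ^ j)) z) \<in> borel_measurable lebesgue" for j
    by (intro borel_measurable_times_ennreal H borel_measurable_indicator borel_set_lebesgue) simp
  have "(\<integral>\<^sup>+z\<in>ball 0 R. H z * ennreal (1 / norm z ^ (?n - 1)) \<partial>lebesgue) \<le>
      (\<integral>\<^sup>+z. (\<Sum>j. ?b j * (H z * indicator (ball 0 (R / 2 ^ j)) z)) \<partial>lebesgue)"
  proof (rule nn_integral_mono)
    fix z :: "real^'n"
    show "H z * ennreal (1 / norm z ^ (?n - 1)) * indicator (ball 0 R) z \<le> (\<Sum>j. ?b j * (H z * indicator (ball 0 (R / 2 ^ j)) z))"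
    proof (cases "z = 0 \<or> R \<le> norm z")
      case True
      then show ?thesis using n by (auto simp: power_0_left)
    next
      case False
      then obtain j where j: "R / 2 ^ Suc j \<le> norm z" "norm z < R / 2 ^ j"
        using dyadic_scale_exists[of "norm z" R] by auto
      have "0 < norm z" "0 < R / 2 ^ Suc j" using False R by auto
      then have "1 / norm z ^ (?n - 1) \<le> 1 / (R / 2 ^ Suc j) ^ (?n - 1)"
        using j(1) by (intro divide_left_mono power_mono mult_pos_pos zero_less_power) auto
      also have "\<dots> = (2 ^ Suc j / R) ^ (?n - 1)"
        by (simp only: power_divide divide_divide_eq_right mult_1)
      finally have "H z * ennreal (1 / norm z ^ (?n - 1)) \<le> H z * ?b j"
        by (intro mult_left_mono ennreal_leI) auto
      then have "H z * ennreal (1 / norm z ^ (?n - 1)) * indicator (ball 0 R) z \<le> sum (\<lambda>j. ?b j * (H z * indicator (ball 0 (R / 2 ^ j)) z)) {j}"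
        using j False by (simp add: mult.commute)
      also have "\<dots> \<le> (\<Sum>j. ?b j * (H z * indicator (ball 0 (R / 2 ^ j)) z))" by (rule sum_le_suminf) auto
      finally show ?thesis .
    qed
  qed
  also have "\<dots> = (\<Sum>j. \<integral>\<^sup>+z. ?b j * (H z * indicator (ball 0 (R / 2 ^ j)) z) \<partial>lebesgue)"
    by (intro nn_integral_suminf borel_measurable_times_ennreal[OF borel_measurable_const] Hm)
  also have "\<dots> = (\<Sum>j. ?b j * (\<integral>\<^sup>+z\<in>ball 0 (R / 2 ^ j). H z \<partial>lebesgue))"
    by (intro arg_cong[where f = suminf] ext nn_integral_cmult Hm)
  also have "\<dots> \<le> (\<Sum>j. ?b j * ennreal (c * (R / 2 ^ j) ^ ?n))"
  proof (intro suminf_le mult_left_mono growth)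
    fix j
    show "0 < R / 2 ^ j" using R by simp
    show "R / 2 ^ j \<le> R" using R by (simp add: divide_le_eq mult_le_cancel_left1)
  qed auto
  also have "\<dots> = (\<Sum>j. ennreal (2 ^ (?n - 1) * c * R * (1 / 2) ^ j))"
  proof (intro arg_cong[where f = suminf] ext)
    fix j
    obtain k where k: "?n = Suc k" using n by (cases "?n") auto
    have "(2 ^ Suc j / R) ^ k * (c * (R / 2 ^ j) ^ Suc k) = 2 ^ k * c * R * (1 / 2) ^ j"
      using R by (simp add: power_mult_distrib power_divide field_simps)
    then show "?b j * ennreal (c * (R / 2 ^ j) ^ ?n) = ennreal (2 ^ (?n - 1) * c * R * (1 / 2) ^ j)"
      unfolding k using c R by (subst ennreal_mult[symmetric]) auto
  qed
  also have "\<dots> = ennreal (\<Sum>j. 2 ^ (?n - 1) * c * R * (1 / 2) ^ j)"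
    using c R by (intro suminf_ennreal2) (auto intro!: summable_mult summable_geometric)
  also have "(\<Sum>j. 2 ^ (?n - 1) * c * R * (1 / 2) ^ j) = 2 ^ ?n * c * R"
  proof -
    obtain k where k: "?n = Suc k" using n by (cases "?n") auto
    have "(\<Sum>j. 2 ^ (?n - 1) * c * R * (1 / 2) ^ j) = 2 ^ (?n - 1) * c * R * (\<Sum>j. (1 / 2) ^ j)"
      by (rule suminf_mult) (simp add: summable_geometric)
    then show ?thesis using suminf_geometric[of "1/2::real"] by (simp add: k)
  qed
  finally show ?thesis .
qed

definition kernel_const :: "'n::finite itself \<Rightarrow> real" where
  "kernel_const _ = 2 ^ CARD('n) * unit_ball_vol (real CARD('n)) + 1"

lemma kernel_const_pos: "1 \<le> kernel_const TYPE('n::finite)"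
  unfolding kernel_const_def by (simp add: unit_ball_vol_nonneg)

text \<open>Among sets of given measure the ball centred at \<open>x\<close> is worst: inside the ball of radius \<open>r\<close> the preceding lemma
applies, outside it the kernel is at most \<open>r\<^bsup>1-n\<^esup>\<close>.\<close>

lemma kernel_integral_le:
  fixes x :: "real^'n"
  assumes E: "E \<in> sets borel" and r: "0 < r" and n: "2 \<le> CARD('n)"
    and size: "emeasure lborel E \<le> ennreal (r ^ CARD('n))"
  shows "(\<integral>\<^sup>+z\<in>E. ennreal (1 / norm (x - z) ^ (CARD('n) - 1)) \<partial>lborel) \<le> ennreal (kernel_const TYPE('n) * r)"
proof -
  let ?n = "CARD('n)" and ?k = "\<lambda>z. ennreal (1 / norm (x - z) ^ (CARD('n) - 1))"
  let ?V = "unit_ball_vol (real CARD('n))"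
  have m: "(\<lambda>z::real^'n. ennreal (1 / norm z ^ (?n - 1)) * indicator (ball 0 r) z) \<in> borel_measurable borel"
    by (intro borel_measurable_times_ennreal borel_measurable_indicator, measurable)
  have near: "(\<integral>\<^sup>+z. ?k z * indicator (ball x r) z \<partial>lborel) \<le> ennreal (2 ^ ?n * ?V * r)"
  proof -
    have "(\<integral>\<^sup>+z. ?k z * indicator (ball x r) z \<partial>lborel) =
        (\<integral>\<^sup>+z. ennreal (1 / norm (x - z) ^ (?n - 1)) * indicator (ball 0 r) (x - z) \<partial>lborel)"
      by (rule nn_integral_cong) (simp add: indicator_def dist_norm norm_minus_commute)
    also have "\<dots> = (\<integral>\<^sup>+z. ennreal (1 / norm (z :: real^'n) ^ (?n - 1)) * indicator (ball 0 r) z \<partial>lborel)"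
      by (rule nn_integral_reflect[OF m, of x])
    also have "\<dots> = (\<integral>\<^sup>+z\<in>ball (0::real^'n) r. 1 * ennreal (1 / norm z ^ (?n - 1)) \<partial>lebesgue)"
      by (simp add: nn_integral_completion)
    also have "\<dots> \<le> ennreal (2 ^ ?n * ?V * r)"
    proof (rule singular_integral_ball[OF _ r _ n])
      show "(\<integral>\<^sup>+z\<in>ball (0::real^'n) s. 1 \<partial>lebesgue) \<le> ennreal (?V * s ^ ?n)" if "0 < s" for s
        using that emeasure_ball[of s "0::real^'n"] by (simp add: nn_integral_completion)
    qed (auto simp: unit_ball_vol_nonneg)
    finally show ?thesis .
  qed
  have far: "(\<integral>\<^sup>+z. ennreal (1 / r ^ (?n - 1)) * indicator E z \<partial>lborel) \<le> ennreal r"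
  proof -
    have "(\<integral>\<^sup>+z. ennreal (1 / r ^ (?n - 1)) * indicator E z \<partial>lborel) = ennreal (1 / r ^ (?n - 1)) * emeasure lborel E"
      using E by (simp add: nn_integral_cmult_indicator)
    also have "\<dots> \<le> ennreal (1 / r ^ (?n - 1)) * ennreal (r ^ ?n)" by (intro mult_left_mono size) simp
    also have "\<dots> = ennreal (1 / r ^ (?n - 1) * r ^ ?n)" using r by (intro ennreal_mult[symmetric]) auto
    also have "1 / r ^ (?n - 1) * r ^ ?n = r" using r n by (cases "?n") auto
    finally show ?thesis .
  qed
  have "(\<integral>\<^sup>+z\<in>E. ?k z \<partial>lborel) \<le> (\<integral>\<^sup>+z. ?k z * indicator (ball x r) z + ennreal (1 / r ^ (?n - 1)) * indicator E z \<partial>lborel)"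
  proof (rule nn_integral_mono)
    fix z
    show "?k z * indicator E z \<le> ?k z * indicator (ball x r) z + ennreal (1 / r ^ (?n - 1)) * indicator E z"
    proof (cases "z \<in> ball x r")
      case False
      then have "r \<le> norm (x - z)" by (simp add: dist_norm)
      then have "1 / norm (x - z) ^ (?n - 1) \<le> 1 / r ^ (?n - 1)"
        using r by (intro divide_left_mono power_mono mult_pos_pos zero_less_power) auto
      then show ?thesis using False by (auto intro!: mult_right_mono ennreal_leI)
    qed (auto simp: indicator_def)
  qed
  also have "\<dots> = (\<integral>\<^sup>+z. ?k z * indicator (ball x r) z \<partial>lborel) + (\<integral>\<^sup>+z. ennreal (1 / r ^ (?n - 1)) * indicator E z \<partial>lborel)"
    using E by (intro nn_integral_add borel_measurable_times_ennreal borel_measurable_indicator) auto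
  also have "\<dots> \<le> ennreal (2 ^ ?n * ?V * r) + ennreal r" by (intro add_mono near far)
  also have "\<dots> = ennreal (kernel_const TYPE('n) * r)"
    using r by (simp add: kernel_const_def distrib_right unit_ball_vol_nonneg flip: ennreal_plus)
  finally show ?thesis .
qed

section \<open>Poincare inequalities\<close>

text \<open>The gradient enters only through a continuous bound \<open>g\<close> for the norm of the derivative. Such a pair \<open>(u, g)\<close> is
stable under the smooth truncations needed below, for which the exact gradient would be inconvenient.\<close>

definition dominated_gradient :: "(real^'n \<Rightarrow> 'b::real_normed_vector) \<Rightarrow> (real^'n \<Rightarrow> real) \<Rightarrow> bool" where
  "dominated_gradient u g \<longleftrightarrow> continuous_on UNIV g \<and>
    (\<forall>x. \<exists>u'. (u has_derivative u') (at x) \<and> (\<forall>h. norm (u' h) \<le> g x * norm h))"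

lemma dominated_gradient_nonneg:
  fixes u :: "real^'n \<Rightarrow> 'b::real_normed_vector"
  assumes "dominated_gradient u g"
  shows "0 \<le> g x"
proof -
  have "\<exists>u'. (u has_derivative u') (at x) \<and> (\<forall>h. norm (u' h) \<le> g x * norm h)"
    using assms by (simp add: dominated_gradient_def)
  then obtain u' :: "real^'n \<Rightarrow> 'b" where "\<And>h. norm (u' h) \<le> g x * norm h" by blast
  from order_trans[OF norm_ge_zero this[of "axis undefined 1"]] show ?thesis
    by (simp add: norm_axis_1)
qed

lemma dominated_gradient_continuous:
  assumes "dominated_gradient u g"
  shows "continuous_on UNIV u" "continuous_on UNIV g"
proof -
  show "continuous_on UNIV g" using assms by (simp add: dominated_gradient_def)
  show "continuous_on UNIV u"
    using assms unfolding dominated_gradient_def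
    by (metis continuous_at_imp_continuous_on has_derivative_continuous)
qed

lemma increment_le_line_integral:
  fixes u :: "real^'n \<Rightarrow> 'b::banach"
  assumes u: "dominated_gradient u g" and ab: "a \<le> b"
  shows "ennreal (norm (u (x + b *\<^sub>R v) - u (x + a *\<^sub>R v))) \<le>
    (\<integral>\<^sup>+s. ennreal (g (x + s *\<^sub>R v) * norm v) * indicator {a..b} s \<partial>lborel)"
proof -
  from u obtain u' where u': "\<And>z. (u has_derivative u' z) (at z)" "\<And>z h. norm (u' z h) \<le> g z * norm h"
    unfolding dominated_gradient_def by metis
  let ?\<phi> = "\<lambda>s. u (x + s *\<^sub>R v)" and ?k = "\<lambda>s. g (x + s *\<^sub>R v) * norm v"
  have "(?\<phi> has_vector_derivative u' (x + s *\<^sub>R v) v) (at s within {a..b})" for s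
  proof -
    have "((\<lambda>s. x + s *\<^sub>R v) has_derivative (\<lambda>t. t *\<^sub>R v)) (at s within {a..b})"
      by (auto intro!: derivative_eq_intros)
    from has_derivative_compose[OF this u'(1)]
    have "(?\<phi> has_derivative (\<lambda>t. u' (x + s *\<^sub>R v) (t *\<^sub>R v))) (at s within {a..b})" .
    moreover have "u' (x + s *\<^sub>R v) (t *\<^sub>R v) = t *\<^sub>R u' (x + s *\<^sub>R v) v" for t
      using has_derivative_linear[OF u'(1)] by (simp add: linear_cmul)
    ultimately show ?thesis by (simp add: has_vector_derivative_def)
  qed
  then have I: "((\<lambda>s. u' (x + s *\<^sub>R v) v) has_integral (?\<phi> b - ?\<phi> a)) {a..b}"
    by (intro fundamental_theorem_of_calculus[OF ab]) auto
  have gc: "continuous_on UNIV ?k"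
    by (intro continuous_intros continuous_on_compose2[OF dominated_gradient_continuous(2)[OF u]]) auto
  then have k: "?k integrable_on {a..b}"
    by (intro integrable_continuous_interval) (rule continuous_on_subset, auto)
  have g0: "0 \<le> ?k s" for s using dominated_gradient_nonneg[OF u] by simp
  have "norm (integral {a..b} (\<lambda>s. u' (x + s *\<^sub>R v) v)) \<le> integral {a..b} ?k"
    by (rule integral_norm_bound_integral) (use I k u'(2) in \<open>auto simp: has_integral_integrable\<close>)
  then have "norm (?\<phi> b - ?\<phi> a) \<le> integral {a..b} ?k"
    using integral_unique[OF I] by simp
  moreover have "(\<integral>\<^sup>+s. ennreal (?k s) * indicator {a..b} s \<partial>lborel) = ennreal (integral {a..b} ?k)"
    by (rule nn_integral_has_integral_lebesgue'[OF g0]) (rule integrable_integral[OF k])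
  ultimately show ?thesis by (simp add: ennreal_leI)
qed

text \<open>Integrate \<open>|u(y) - u(x)| \<le> \<integral>\<^sub>0\<^sup>1 g(x + s (y - x)) |y - x| ds\<close> over \<open>y\<close> in the convex set \<open>B\<close> and substitute
\<open>z = x + s (y - x)\<close>, which stays in \<open>B\<close>. For fixed \<open>z\<close> only the \<open>s \<ge> |z - x| / D\<close> contribute, and
integrating \<open>s\<^bsup>-n-1\<^esup>\<close> over them produces the Riesz kernel.\<close>

lemma pointwise_poincare:
  fixes u :: "real^'n \<Rightarrow> 'b::banach"
  assumes u: "dominated_gradient u g" and B: "convex B" "B \<in> sets borel" "x \<in> B"
    and D: "0 < D" "\<And>y. y \<in> B \<Longrightarrow> norm (y - x) \<le> D" and n: "2 \<le> CARD('n)"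
  shows "(\<integral>\<^sup>+y\<in>B. ennreal (norm (u y - u x)) \<partial>lborel) \<le>
    ennreal (D ^ CARD('n) / CARD('n)) * riesz (\<lambda>z. ennreal (g z) * indicator B z) x"
proof -
  let ?n = "CARD('n)"
  have gm[measurable]: "g \<in> borel_measurable borel"
    using dominated_gradient_continuous(2)[OF u] by (rule borel_measurable_continuous_onI)
  note B(2)[measurable]
  have g0: "0 \<le> g z" for z by (rule dominated_gradient_nonneg[OF u])
  let ?F = "\<lambda>s y. ennreal (g (x + s *\<^sub>R (y - x)) * norm (y - x)) * indicator B y"
  let ?G = "\<lambda>s z. ennreal (1 / s ^ Suc ?n) * (if norm (z - x) / D \<le> s then 1 else 0) * (ennreal (g z * norm (z - x)) * indicator B z)"
  have "(\<integral>\<^sup>+y\<in>B. ennreal (norm (u y - u x)) \<partial>lborel) \<le> (\<integral>\<^sup>+y. (\<integral>\<^sup>+s. ?F s y * indicator {0..1} s \<partial>lborel) \<partial>lborel)"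
  proof (rule nn_integral_mono)
    fix y
    show "ennreal (norm (u y - u x)) * indicator B y \<le> (\<integral>\<^sup>+s. ?F s y * indicator {0..1} s \<partial>lborel)"
      using increment_le_line_integral[OF u, of 0 1 x "y - x"] by (cases "y \<in> B") auto
  qed
  also have "\<dots> = (\<integral>\<^sup>+s. (\<integral>\<^sup>+y. ?F s y * indicator {0..1} s \<partial>lborel) \<partial>lborel)"
    by (rule lborel_pair.Fubini') measurable
  also have "\<dots> \<le> (\<integral>\<^sup>+s. (\<integral>\<^sup>+z. ?G s z \<partial>lborel) \<partial>lborel)"
  proof -
    have key: "(\<integral>\<^sup>+y. ?F s y * indicator {0..1} s \<partial>lborel) \<le> (\<integral>\<^sup>+z. ?G s z \<partial>lborel)"
      if "s \<noteq> 0" for s :: real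
    proof (cases "s \<in> {0..1}")
      case True
      then have s: "0 < s" "s \<le> 1" using \<open>s \<noteq> 0\<close> by auto
      \<comment> \<open>The substitution inverse to \<open>z = x + s (y - x)\<close>.\<close>
      let ?y = "\<lambda>z. (x - (1 / s) *\<^sub>R x) + (1 / s) *\<^sub>R z"
      have yx: "?y z - x = (1 / s) *\<^sub>R (z - x)" for z by (simp add: algebra_simps)
      have recover: "x + s *\<^sub>R (?y z - x) = z" for z unfolding yx using s by simp
      have Fm: "?F s \<in> borel_measurable borel" by measurable
      have "(\<integral>\<^sup>+y. ?F s y * indicator {0..1} s \<partial>lborel) = (\<integral>\<^sup>+y. ?F s y \<partial>lborel)"
        using True by simp
      also have "\<dots> = ennreal (\<bar>1 / s\<bar> ^ ?n) * (\<integral>\<^sup>+z. ?F s (?y z) \<partial>lborel)"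
        using nn_integral_affine[OF Fm, of "1 / s" "x - (1 / s) *\<^sub>R x"] s by simp
      also have "\<dots> = (\<integral>\<^sup>+z. ennreal (\<bar>1 / s\<bar> ^ ?n) * ?F s (?y z) \<partial>lborel)"
        by (rule nn_integral_cmult[symmetric]) measurable
      also have "\<dots> \<le> (\<integral>\<^sup>+z. ?G s z \<partial>lborel)"
      proof (rule nn_integral_mono)
        fix z
        show "ennreal (\<bar>1 / s\<bar> ^ ?n) * ?F s (?y z) \<le> ?G s z"
        proof (cases "?y z \<in> B")
          case True
          have "(1 - s) *\<^sub>R x + s *\<^sub>R v = x + s *\<^sub>R (v - x)" for v by (simp add: algebra_simps)
          then have "z = (1 - s) *\<^sub>R x + s *\<^sub>R ?y z" by (simp only: recover)
          then have zB: "z \<in> B" using convexD_alt[OF B(1,3) True] s by (metis less_imp_le)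
          have nz: "norm (?y z - x) = norm (z - x) / s" unfolding yx using s by simp
          then have "norm (z - x) / s \<le> D" using D(2)[OF True] by simp
          then have sD: "norm (z - x) / D \<le> s" using s D by (simp add: field_simps)
          have "ennreal (\<bar>1 / s\<bar> ^ ?n) * ?F s (?y z) = ennreal (\<bar>1 / s\<bar> ^ ?n * (g z * (norm (z - x) / s)))"
            unfolding recover nz using True g0 s by (simp add: ennreal_mult[symmetric])
          also have "\<bar>1 / s\<bar> ^ ?n * (g z * (norm (z - x) / s)) = 1 / s ^ Suc ?n * (g z * norm (z - x))"
            using s by (simp add: power_one_over field_simps)
          also have "ennreal \<dots> = ?G s z" using zB sD s g0 by (simp add: ennreal_mult[symmetric])
          finally show ?thesis by simp
        qed simp
      qed
      finally show ?thesis .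
    qed simp
    show ?thesis
      by (rule nn_integral_mono_AE, rule AE_mp[OF AE_lborel_singleton[of "0::real"]], rule AE_I2) (use key in blast)
  qed
  also have "\<dots> = (\<integral>\<^sup>+z. (\<integral>\<^sup>+s. ?G s z \<partial>lborel) \<partial>lborel)"
    by (rule lborel_pair.Fubini') measurable
  also have "\<dots> = (\<integral>\<^sup>+z. ennreal (D ^ ?n / ?n) * (ennreal (g z) * indicator B z * ennreal (1 / norm (x - z) ^ (?n - 1))) \<partial>lborel)"
  proof (rule nn_integral_cong)
    fix z
    have "(\<integral>\<^sup>+s. ?G s z \<partial>lborel) = (\<integral>\<^sup>+s. ennreal (1 / s ^ Suc ?n) * indicator {norm (z - x) / D..} s \<partial>lborel) *
        (ennreal (g z * norm (z - x)) * indicator B z)"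
      by (subst nn_integral_multc[symmetric], measurable) (auto intro!: nn_integral_cong simp: indicator_def)
    also have "\<dots> = ennreal (D ^ ?n / ?n) * (ennreal (g z) * indicator B z * ennreal (1 / norm (x - z) ^ (?n - 1)))"
    proof (cases "z = x")
      case True
      then show ?thesis using n by (simp add: power_0_left)
    next
      case False
      define r where "r = norm (x - z)"
      have r: "0 < r" using False by (simp add: r_def)
      obtain k where k: "?n = Suc k" using n by (cases "?n") auto
      have "(\<integral>\<^sup>+s. ennreal (1 / s ^ Suc ?n) * indicator {norm (z - x) / D..} s \<partial>lborel) = ennreal (1 / (?n * (r / D) ^ ?n))"
        using nn_integral_tail[of "r / D" ?n] r D n by (simp add: r_def norm_minus_commute)
      moreover have "1 / (?n * (r / D) ^ ?n) * (g z * r) = D ^ ?n / ?n * (g z * (1 / r ^ (?n - 1)))"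
        using r D unfolding k by (simp add: power_divide field_simps del: of_nat_Suc)
      then have "ennreal (1 / (?n * (r / D) ^ ?n)) * ennreal (g z * r) = ennreal (D ^ ?n / ?n) * (ennreal (g z) * ennreal (1 / r ^ (?n - 1)))"
        using r D g0 by (simp only: ennreal_mult[symmetric] zero_le_divide_iff mult_nonneg_nonneg zero_le_power less_imp_le of_nat_0_le_iff zero_le_one simp_thms)
      ultimately show ?thesis by (simp add: r_def norm_minus_commute mult_ac)
    qed
    finally show "(\<integral>\<^sup>+s. ?G s z \<partial>lborel) = ennreal (D ^ ?n / ?n) * (ennreal (g z) * indicator B z * ennreal (1 / norm (x - z) ^ (?n - 1)))" .
  qed
  also have "\<dots> = ennreal (D ^ ?n / ?n) * riesz (\<lambda>z. ennreal (g z) * indicator B z) x"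
    unfolding riesz_def by (rule nn_integral_cmult) measurable
  finally show ?thesis .
qed

text \<open>The potential is symmetric, so it is moved onto the indicator of \<open>E\<close>, where it is at most \<open>C |E|\<^bsup>1/n\<^esup>\<close>. This is the
dual form of the weak-type bound of \<open>I\<close> from \<open>L\<^sup>1\<close> to \<open>L\<^bsup>n'\<^esup>\<close>.\<close>

lemma riesz_integral_le:
  fixes h :: "real^'n \<Rightarrow> ennreal"
  assumes h[measurable]: "h \<in> borel_measurable borel" and E[measurable]: "E \<in> sets borel" and r: "0 < r" and n: "2 \<le> CARD('n)"
    and size: "emeasure lborel E \<le> ennreal (r ^ CARD('n))"
  shows "(\<integral>\<^sup>+x\<in>E. riesz h x \<partial>lborel) \<le> ennreal (kernel_const TYPE('n) * r) * (\<integral>\<^sup>+z. h z \<partial>lborel)"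
proof -
  let ?k = "\<lambda>x z. ennreal (1 / norm (x - z :: real^'n) ^ (CARD('n) - 1))"
  have "(\<integral>\<^sup>+x\<in>E. riesz h x \<partial>lborel) = (\<integral>\<^sup>+x. (\<integral>\<^sup>+z. h z * ?k x z * indicator E x \<partial>lborel) \<partial>lborel)"
    unfolding riesz_def by (intro nn_integral_cong nn_integral_multc[symmetric]) measurable
  also have "\<dots> = (\<integral>\<^sup>+z. (\<integral>\<^sup>+x. h z * ?k x z * indicator E x \<partial>lborel) \<partial>lborel)"
    by (rule lborel_pair.Fubini') measurable
  also have "\<dots> \<le> (\<integral>\<^sup>+z. ennreal (kernel_const TYPE('n) * r) * h z \<partial>lborel)"
  proof (rule nn_integral_mono)
    fix z
    have "(\<integral>\<^sup>+x. h z * ?k x z * indicator E x \<partial>lborel) = h z * (\<integral>\<^sup>+x\<in>E. ?k z x \<partial>lborel)"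
      unfolding mult.assoc norm_minus_commute[of _ z] by (rule nn_integral_cmult) measurable
    also have "\<dots> \<le> h z * ennreal (kernel_const TYPE('n) * r)"
      by (intro mult_left_mono kernel_integral_le E r n size) simp
    finally show "(\<integral>\<^sup>+x. h z * ?k x z * indicator E x \<partial>lborel) \<le> ennreal (kernel_const TYPE('n) * r) * h z"
      by (simp only: mult.commute)
  qed
  also have "\<dots> = ennreal (kernel_const TYPE('n) * r) * (\<integral>\<^sup>+z. h z \<partial>lborel)"
    by (rule nn_integral_cmult) measurable
  finally show ?thesis .
qed

lemma riesz_mono: "(\<And>z. h z \<le> k z) \<Longrightarrow> riesz h x \<le> riesz k x"
  unfolding riesz_def by (intro nn_integral_mono mult_right_mono) auto

lemma riesz_measurable:
  fixes h :: "real^'n \<Rightarrow> ennreal"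
  assumes [measurable]: "h \<in> borel_measurable borel"
  shows "riesz h \<in> borel_measurable borel"
  unfolding riesz_def[abs_def] by measurable

abbreviation "ball_vol \<equiv> \<lambda>n. unit_ball_vol (real n)"

definition ball_mean :: "(real^'n \<Rightarrow> 'b::{banach,second_countable_topology}) \<Rightarrow> real^'n \<Rightarrow> real \<Rightarrow> 'b" where
  "ball_mean u x0 R = (1 / measure lborel (cball x0 R)) *\<^sub>R (LINT y:cball x0 R|lborel. u y)"

lemma measure_cball:
  fixes x0 :: "real^'n"
  assumes "0 \<le> R"
  shows "emeasure lborel (cball x0 R) = ennreal (ball_vol CARD('n) * R ^ CARD('n))"
    "measure lborel (cball x0 R) = ball_vol CARD('n) * R ^ CARD('n)"
  using emeasure_cball[OF assms, of x0] assms by (auto simp: measure_def unit_ball_vol_nonneg)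

lemma ball_vol_pos: "0 < ball_vol CARD('n::finite)"
  by (rule unit_ball_vol_pos) simp

lemma continuous_integrable_cball:
  fixes u :: "real^'n \<Rightarrow> 'b::{banach,second_countable_topology}"
  assumes "continuous_on UNIV u"
  shows "set_integrable lborel (cball x0 R) u"
  unfolding set_integrable_def
  by (rule borel_integrable_compact) (use assms in \<open>auto intro: continuous_on_subset\<close>)

definition mean_const :: "'n::finite itself \<Rightarrow> real" where
  "mean_const _ = 2 ^ CARD('n) / (CARD('n) * ball_vol CARD('n))"

lemma mean_const_pos: "0 < mean_const TYPE('n::finite)"
  unfolding mean_const_def using ball_vol_pos[where 'n = 'n] by simp

lemma diff_ball_mean_le:
  fixes u :: "real^'n \<Rightarrow> 'b::{banach,second_countable_topology}"
  assumes u: "dominated_gradient u g" and R: "0 < R" and x: "x \<in> cball x0 R" and n: "2 \<le> CARD('n)"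
  shows "ennreal (norm (u x - ball_mean u x0 R)) \<le>
    ennreal (mean_const TYPE('n)) * riesz (\<lambda>z. ennreal (g z) * indicator (cball x0 R) z) x"
proof -
  let ?B = "cball x0 R" and ?n = "CARD('n)"
  let ?v = "measure lborel ?B"
  have v: "?v = ball_vol ?n * R ^ ?n" "0 < ?v" using R ball_vol_pos[where 'n='n] by (simp_all add: measure_cball)
  have fin: "emeasure lborel ?B < \<infinity>" using R by (simp add: measure_cball)
  have iu: "set_integrable lborel ?B u"
    by (rule continuous_integrable_cball[OF dominated_gradient_continuous(1)[OF u]])
  have ic: "set_integrable lborel ?B (\<lambda>y. u x)"
    by (rule continuous_integrable_cball) (rule continuous_on_const)
  have "(LINT y:?B|lborel. u y - u x) = (LINT y:?B|lborel. u y) - ?v *\<^sub>R u x"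
    using set_integral_diff(2)[OF iu ic] fin by (simp add: set_lebesgue_integral_def)
  then have "ball_mean u x0 R - u x = (1 / ?v) *\<^sub>R (LINT y:?B|lborel. u y - u x)"
    unfolding ball_mean_def using v(2) by (simp add: scaleR_diff_right)
  then have "ennreal (norm (u x - ball_mean u x0 R)) = ennreal (1 / ?v) * ennreal (norm (LINT y:?B|lborel. u y - u x))"
    using v(2) by (subst norm_minus_commute) (simp add: ennreal_mult[symmetric])
  also have "\<dots> \<le> ennreal (1 / ?v) * (\<integral>\<^sup>+y\<in>?B. ennreal (norm (u y - u x)) \<partial>lborel)"
  proof (intro mult_left_mono)
    have "ennreal (norm (LINT y:?B|lborel. u y - u x)) \<le> (\<integral>\<^sup>+y. ennreal (norm (indicator ?B y *\<^sub>R (u y - u x))) \<partial>lborel)"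
      unfolding set_lebesgue_integral_def
      by (rule integral_norm_bound_ennreal) (use set_integral_diff(1)[OF iu ic] in \<open>simp add: set_integrable_def\<close>)
    also have "\<dots> = (\<integral>\<^sup>+y\<in>?B. ennreal (norm (u y - u x)) \<partial>lborel)"
      by (rule nn_integral_cong) (auto simp: indicator_def)
    finally show "ennreal (norm (LINT y:?B|lborel. u y - u x)) \<le> (\<integral>\<^sup>+y\<in>?B. ennreal (norm (u y - u x)) \<partial>lborel)" .
  qed simp
  also have "\<dots> \<le> ennreal (1 / ?v) * (ennreal ((2 * R) ^ ?n / ?n) * riesz (\<lambda>z. ennreal (g z) * indicator ?B z) x)"
  proof (intro mult_left_mono pointwise_poincare[OF u] n)
    show "norm (y - x) \<le> 2 * R" if "y \<in> ?B" for y
      using that x dist_triangle2[of y x x0] by (simp add: dist_norm norm_minus_commute dist_commute)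
  qed (use R x in auto)
  also have "\<dots> = ennreal (1 / ?v * ((2 * R) ^ ?n / ?n)) * riesz (\<lambda>z. ennreal (g z) * indicator ?B z) x"
    using R v(2) by (intro ennreal_mult_mult) auto
  also have "1 / ?v * ((2 * R) ^ ?n / ?n) = mean_const TYPE('n)"
    unfolding v(1) mean_const_def using R by (simp add: power_mult_distrib)
  finally show ?thesis .
qed

definition osc_const :: "'n::finite itself \<Rightarrow> real" where
  "osc_const _ = mean_const TYPE('n) * (kernel_const TYPE('n) * max 1 (ball_vol CARD('n)))"

lemma cball_size:
  fixes x0 :: "real^'n"
  assumes "0 < R"
  shows "emeasure lborel (cball x0 R) \<le> ennreal ((max 1 (ball_vol CARD('n)) * R) ^ CARD('n))"
proof -
  have "ball_vol CARD('n) \<le> max 1 (ball_vol CARD('n)) ^ 1" by simp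
  also have "\<dots> \<le> max 1 (ball_vol CARD('n)) ^ CARD('n)" by (rule power_increasing) (auto simp: Suc_le_eq)
  finally show ?thesis
    using assms by (auto simp: measure_cball power_mult_distrib intro!: ennreal_leI mult_right_mono)
qed

lemma poincare_ball:
  fixes u :: "real^'n \<Rightarrow> 'b::{banach,second_countable_topology}"
  assumes u: "dominated_gradient u g" and R: "0 < R" and n: "2 \<le> CARD('n)"
  shows "(\<integral>\<^sup>+y\<in>cball x0 R. ennreal (norm (u y - ball_mean u x0 R)) \<partial>lborel) \<le>
    ennreal (osc_const TYPE('n) * R) * (\<integral>\<^sup>+z\<in>cball x0 R. ennreal (g z) \<partial>lborel)"
proof -
  let ?B = "cball x0 R" and ?h = "\<lambda>z. ennreal (g z) * indicator (cball x0 R) z" and ?\<kappa> = "mean_const TYPE('n)"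
  have gm[measurable]: "g \<in> borel_measurable borel"
    using dominated_gradient_continuous(2)[OF u] by (rule borel_measurable_continuous_onI)
  have hm: "?h \<in> borel_measurable borel" by (intro borel_measurable_times_ennreal borel_measurable_indicator) auto
  note riesz_measurable[OF hm, measurable]
  have "(\<integral>\<^sup>+y\<in>?B. ennreal (norm (u y - ball_mean u x0 R)) \<partial>lborel) \<le> (\<integral>\<^sup>+y. ennreal ?\<kappa> * (riesz ?h y * indicator ?B y) \<partial>lborel)"
  proof (rule nn_integral_mono)
    fix y
    show "ennreal (norm (u y - ball_mean u x0 R)) * indicator ?B y \<le> ennreal ?\<kappa> * (riesz ?h y * indicator ?B y)"
      using diff_ball_mean_le[OF u R _ n, of y x0] by (cases "y \<in> ?B") auto
  qed
  also have "\<dots> = ennreal ?\<kappa> * (\<integral>\<^sup>+y\<in>?B. riesz ?h y \<partial>lborel)"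
    by (intro nn_integral_cmult borel_measurable_times_ennreal borel_measurable_indicator) (use riesz_measurable[OF hm] in auto)
  also have "\<dots> \<le> ennreal ?\<kappa> * (ennreal (kernel_const TYPE('n) * (max 1 (ball_vol CARD('n)) * R)) * (\<integral>\<^sup>+z. ?h z \<partial>lborel))"
    by (intro mult_left_mono riesz_integral_le[OF hm] n cball_size R) (use R in auto)
  also have "\<dots> = ennreal (osc_const TYPE('n) * R) * (\<integral>\<^sup>+z. ?h z \<partial>lborel)"
    using mean_const_pos[where 'n='n] kernel_const_pos[where 'n='n] R
    by (subst ennreal_mult_mult) (auto simp: osc_const_def mult_ac)
  finally show ?thesis .
qed

section \<open>The Lorentz-Poincare inequality\<close>

text \<open>The function \<open>|f - c|\<^sup>2 / (t\<^sup>2 + |f - c|\<^sup>2)\<close> is a smooth substitute for the indicator of \<open>|f - c| > t\<close>.\<close>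

lemma dominated_gradient_ratio:
  fixes f :: "real^'n \<Rightarrow> 'b::real_inner"
  assumes f: "dominated_gradient f g" and t: "0 < t"
  shows "dominated_gradient (\<lambda>y. (norm (f y - c))\<^sup>2 / (t\<^sup>2 + (norm (f y - c))\<^sup>2))
    (\<lambda>y. 2 * t\<^sup>2 * norm (f y - c) * g y / (t\<^sup>2 + (norm (f y - c))\<^sup>2)\<^sup>2)"
proof -
  have pos: "0 < t\<^sup>2 + (norm v)\<^sup>2" for v :: 'b using t by (simp add: add_pos_nonneg)
  have "\<exists>u'. ((\<lambda>y. (norm (f y - c))\<^sup>2 / (t\<^sup>2 + (norm (f y - c))\<^sup>2)) has_derivative u') (at x) \<and>
      (\<forall>h. norm (u' h) \<le> 2 * t\<^sup>2 * norm (f x - c) * g x / (t\<^sup>2 + (norm (f x - c))\<^sup>2)\<^sup>2 * norm h)" for x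
  proof -
    from f obtain f' where f': "(f has_derivative f') (at x)" "\<And>h. norm (f' h) \<le> g x * norm h"
      unfolding dominated_gradient_def by metis
    define N where "N y = (f y - c) \<bullet> (f y - c)" for y
    have N: "(norm (f y - c))\<^sup>2 = N y" for y by (simp add: N_def power2_norm_eq_inner)
    let ?D = "t\<^sup>2 / (t\<^sup>2 + N x)\<^sup>2"
    have Np: "0 < t\<^sup>2 + N x" using pos[of "f x - c"] N by simp
    have "((\<lambda>y. f y - c) has_derivative f') (at x)"
      using has_derivative_diff[OF f'(1) has_derivative_const[of c]] by simp
    from has_derivative_inner[OF this this]
    have dN: "(N has_derivative (\<lambda>h. (f x - c) \<bullet> f' h + f' h \<bullet> (f x - c))) (at x)"
      by (simp add: N_def[abs_def])
    have "((\<lambda>s. s / (t\<^sup>2 + s)) has_field_derivative ?D) (at (N x))"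
      by (rule derivative_eq_intros refl | use Np in \<open>simp add: power2_eq_square\<close>)+
    then have "((\<lambda>s. s / (t\<^sup>2 + s)) has_derivative (\<lambda>k. ?D * k)) (at (N x))"
      by (simp only: has_field_derivative_def)
    from has_derivative_compose[OF dN this]
    have "((\<lambda>y. N y / (t\<^sup>2 + N y)) has_derivative (\<lambda>h. ?D * ((f x - c) \<bullet> f' h + f' h \<bullet> (f x - c)))) (at x)" .
    moreover have "norm (?D * ((f x - c) \<bullet> f' h + f' h \<bullet> (f x - c))) \<le>
        2 * t\<^sup>2 * norm (f x - c) * g x / (t\<^sup>2 + N x)\<^sup>2 * norm h" for h
    proof -
      have "\<bar>(f x - c) \<bullet> f' h\<bar> \<le> norm (f x - c) * norm (f' h)" by (rule Cauchy_Schwarz_ineq2)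
      also have "\<dots> \<le> norm (f x - c) * (g x * norm h)" by (intro mult_left_mono f'(2)) simp
      finally have "?D * (2 * \<bar>(f x - c) \<bullet> f' h\<bar>) \<le> ?D * (2 * (norm (f x - c) * (g x * norm h)))"
        by (intro mult_left_mono) auto
      then show ?thesis by (simp add: abs_mult inner_commute[of "f' h"] mult_ac)
    qed
    ultimately show ?thesis unfolding N by blast
  qed
  moreover have "continuous_on UNIV (\<lambda>y. 2 * t\<^sup>2 * norm (f y - c) * g y / (t\<^sup>2 + (norm (f y - c))\<^sup>2)\<^sup>2)"
    using pos by (intro continuous_intros dominated_gradient_continuous[OF f]) (use t in \<open>auto simp: add_nonneg_eq_0_iff\<close>)
  ultimately show ?thesis unfolding dominated_gradient_def by blast
qed

text \<open>At a point with \<open>|f - c| = b\<close> the integrand bounds the derivative of the truncation with respect to \<open>b\<close>. Its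
integral over all levels \<open>t\<close> has a bound that does not depend on \<open>b\<close>, by scaling.\<close>

lemma nn_integral_arctan_density:
  assumes b: "0 \<le> b"
  shows "(\<integral>\<^sup>+t. ennreal (2 * b / (t\<^sup>2 + b\<^sup>2)) * indicator {0..} t \<partial>lborel) \<le> ennreal pi"
proof (cases "b = 0")
  case False
  then have b: "0 < b" using assms by simp
  have D: "DERIV (\<lambda>t. 2 * arctan (t / b)) t :> 2 * b / (t\<^sup>2 + b\<^sup>2)" for t
  proof -
    have "t\<^sup>2 + b\<^sup>2 \<noteq> 0" using b by (simp add: add_nonneg_eq_0_iff)
    moreover have "DERIV (\<lambda>t. 2 * arctan (t / b)) t :> 2 * (inverse (1 + (t / b)\<^sup>2) * (1 / b))"
      by (intro DERIV_cmult DERIV_chain2[OF DERIV_arctan] DERIV_cdivide DERIV_ident)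
    moreover have "2 * (inverse (1 + (t / b)\<^sup>2) * (1 / b)) = 2 * b / (t\<^sup>2 + b\<^sup>2)"
      using b by (simp add: power_divide inverse_eq_divide add_divide_eq_iff power2_eq_square add.commute)
    ultimately show ?thesis by simp
  qed
  have "filterlim (\<lambda>t::real. t / b) at_top at_top"
    using filterlim_tendsto_pos_mult_at_top[OF tendsto_const _ filterlim_ident, of "1 / b"] b by simp
  then have "((\<lambda>t. arctan (t / b)) \<longlongrightarrow> pi / 2) at_top"
    by (rule filterlim_compose[OF tendsto_arctan_at_top])
  then have lim: "((\<lambda>t. 2 * arctan (t / b)) \<longlongrightarrow> 2 * (pi / 2)) at_top"
    by (intro tendsto_mult tendsto_const)
  have "(\<integral>\<^sup>+t. ennreal (2 * b / (t\<^sup>2 + b\<^sup>2)) * indicator {0..} t \<partial>lborel) = ennreal (2 * (pi / 2) - 2 * arctan (0 / b))"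
    by (rule nn_integral_FTC_atLeast[OF _ D _ lim]) (use b in auto)
  then show ?thesis by simp
qed simp

definition lorentz_const :: "'n::finite itself \<Rightarrow> real" where
  "lorentz_const _ = 4 * osc_const TYPE('n) * ball_vol CARD('n) powr (- 1 / CARD('n))
     + 4 * mean_const TYPE('n) * kernel_const TYPE('n) * pi"

lemma osc_const_pos: "0 < osc_const TYPE('n::finite)"
  unfolding osc_const_def using mean_const_pos[where 'n = 'n] kernel_const_pos[where 'n='n]
  by (intro mult_pos_pos) auto

lemma lorentz_const_pos: "0 < lorentz_const TYPE('n::finite)"
  unfolding lorentz_const_def
  using mean_const_pos[where 'n = 'n] kernel_const_pos[where 'n='n] osc_const_pos[where 'n='n]
  by (intro add_nonneg_pos mult_pos_pos mult_nonneg_nonneg) auto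

text \<open>For \<open>t\<close> at least four times the mean of \<open>|f - c|\<close>, the truncation has mean at most \<open>1/4\<close> but is at least \<open>1/2\<close> on
the level set \<open>E\<close>. So the potential of its gradient is bounded below on \<open>E\<close>, and integrating over \<open>E\<close> gives
\<open>|E| \<le> C |E|\<^bsup>1/n\<^esup>\<close> times the integral of that gradient.\<close>

lemma large_level_set:
  fixes f :: "real^'n \<Rightarrow> 'b::euclidean_space"
  assumes f: "dominated_gradient f g" and R: "0 < R" and n: "2 \<le> CARD('n)" and t: "0 < t"
    and large: "4 * (LINT y:cball x0 R|lborel. norm (f y - c)) \<le> t * measure lborel (cball x0 R)"
  shows "ennreal (measure lborel {y\<in>cball x0 R. t < norm (f y - c)} powr (1 - 1 / CARD('n))) \<le>
    ennreal (4 * mean_const TYPE('n) * kernel_const TYPE('n)) *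
    (\<integral>\<^sup>+z\<in>cball x0 R. ennreal (2 * t\<^sup>2 * norm (f z - c) * g z / (t\<^sup>2 + (norm (f z - c))\<^sup>2)\<^sup>2) \<partial>lborel)"
proof -
  let ?n = "CARD('n)" and ?B = "cball x0 R" and ?\<kappa> = "mean_const TYPE('n)" and ?A = "kernel_const TYPE('n)"
  define u where "u y = (norm (f y - c))\<^sup>2 / (t\<^sup>2 + (norm (f y - c))\<^sup>2)" for y
  define k where "k y = 2 * t\<^sup>2 * norm (f y - c) * g y / (t\<^sup>2 + (norm (f y - c))\<^sup>2)\<^sup>2" for y
  let ?h = "\<lambda>z. ennreal (k z) * indicator ?B z"
  have uk: "dominated_gradient u k"
    unfolding u_def[abs_def] k_def[abs_def] by (rule dominated_gradient_ratio[OF f t])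
  have fc: "continuous_on UNIV f" by (rule dominated_gradient_continuous(1)[OF f])
  have [measurable]: "f \<in> borel_measurable borel" "k \<in> borel_measurable borel"
    using fc dominated_gradient_continuous(2)[OF uk] by (auto intro: borel_measurable_continuous_onI)
  have hm: "?h \<in> borel_measurable borel"
    by (intro borel_measurable_times_ennreal borel_measurable_indicator) auto
  define E where "E = {y\<in>?B. t < norm (f y - c)}"
  have E: "E \<in> sets borel"
  proof -
    have "E = ?B \<inter> {y. t < norm (f y - c)}" by (auto simp: E_def)
    also have "\<dots> \<in> sets borel" by measurable
    finally show ?thesis .
  qed
  let ?v = "measure lborel ?B" and ?e = "measure lborel E"
  have v: "0 < ?v" using R ball_vol_pos[where 'n='n] by (simp add: measure_cball)
  have "emeasure lborel E \<le> emeasure lborel ?B" by (rule emeasure_mono) (auto simp: E_def)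
  also have "\<dots> < \<infinity>" using R by (simp add: measure_cball)
  finally have e: "emeasure lborel E = ennreal ?e" by (intro emeasure_eq_ennreal_measure) auto
  have mean: "0 \<le> ball_mean u x0 R" "ball_mean u x0 R \<le> 1 / 4"
  proof -
    have u0: "0 \<le> u y" for y by (simp add: u_def)
    show "0 \<le> ball_mean u x0 R"
      unfolding ball_mean_def set_lebesgue_integral_def using u0
      by (intro scaleR_nonneg_nonneg Bochner_Integration.integral_nonneg) auto
    have ut: "u y \<le> norm (f y - c) / t" for y
    proof -
      let ?b = "norm (f y - c)"
      have p: "0 < t\<^sup>2 + ?b\<^sup>2" using t by (simp add: add_pos_nonneg)
      have "0 \<le> t * ?b" using t by simp
      then have "t * ?b \<le> t\<^sup>2 + ?b\<^sup>2" using sum_squares_bound[of t ?b] by linarith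
      then have "?b * (t * ?b) \<le> ?b * (t\<^sup>2 + ?b\<^sup>2)" by (rule mult_left_mono) simp
      then show ?thesis using t p by (simp add: u_def divide_le_eq le_divide_eq power2_eq_square mult_ac)
    qed
    have "(LINT y:?B|lborel. u y) \<le> (LINT y:?B|lborel. norm (f y - c) / t)"
      by (intro set_integral_mono continuous_integrable_cball ut dominated_gradient_continuous(1)[OF uk] continuous_intros fc) (use t in auto)
    also have "\<dots> = (LINT y:?B|lborel. norm (f y - c)) / t" by simp
    also have "\<dots> \<le> ?v / 4" using large t by (simp add: field_simps)
    finally show "ball_mean u x0 R \<le> 1 / 4" using v by (simp add: ball_mean_def field_simps)
  qed
  have lower: "ennreal (1 / 4) \<le> ennreal ?\<kappa> * riesz ?h y" if y: "y \<in> E" for y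
  proof -
    have "1 / 2 \<le> u y"
    proof -
      have "t\<^sup>2 \<le> (norm (f y - c))\<^sup>2" using y t by (intro power_mono) (auto simp: E_def)
      then show ?thesis using t by (simp add: u_def le_divide_eq add_pos_nonneg)
    qed
    then have "1 / 4 \<le> norm (u y - ball_mean u x0 R)" using mean by simp
    then have "ennreal (1 / 4) \<le> ennreal (norm (u y - ball_mean u x0 R))" by (rule ennreal_leI)
    also have "\<dots> \<le> ennreal ?\<kappa> * riesz ?h y"
      using y by (intro diff_ball_mean_le uk R n) (auto simp: E_def)
    finally show ?thesis .
  qed
  show ?thesis
  proof (cases "?e = 0")
    case True
    then show ?thesis by (simp add: E_def)
  next
    case False
    then have e0: "0 < ?e" by (simp add: measure_nonneg less_le)
    define r where "r = ?e powr (1 / ?n)"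
    have r: "0 < r" "r ^ ?n = ?e"
      using e0 by (auto simp: r_def powr_realpow[symmetric] powr_powr)
    have "ennreal (1 / 4) * ennreal ?e = (\<integral>\<^sup>+y. ennreal (1 / 4) * indicator E y \<partial>lborel)"
      unfolding e[symmetric] using E by (simp add: nn_integral_cmult_indicator)
    also have "\<dots> \<le> (\<integral>\<^sup>+y. ennreal ?\<kappa> * (riesz ?h y * indicator E y) \<partial>lborel)"
    proof (rule nn_integral_mono)
      fix y
      show "ennreal (1 / 4) * indicator E y \<le> ennreal ?\<kappa> * (riesz ?h y * indicator E y)"
        using lower[of y] by (cases "y \<in> E") auto
    qed
    also have "\<dots> = ennreal ?\<kappa> * (\<integral>\<^sup>+y\<in>E. riesz ?h y \<partial>lborel)"
      using E riesz_measurable[OF hm]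
      by (intro nn_integral_cmult borel_measurable_times_ennreal borel_measurable_indicator) auto
    also have "\<dots> \<le> ennreal ?\<kappa> * (ennreal (?A * r) * (\<integral>\<^sup>+z. ?h z \<partial>lborel))"
      using r e by (intro mult_left_mono riesz_integral_le hm E n) auto
    also have "\<dots> = ennreal (?\<kappa> * (?A * r)) * (\<integral>\<^sup>+z. ?h z \<partial>lborel)"
      using mean_const_pos[where 'n='n] kernel_const_pos[where 'n='n] r by (intro ennreal_mult_mult) auto
    finally have main: "ennreal (1 / 4) * ennreal ?e \<le> ennreal (?\<kappa> * (?A * r)) * (\<integral>\<^sup>+z. ?h z \<partial>lborel)" .
    have "ennreal (?e powr (1 - 1 / ?n)) = ennreal (4 / r) * (ennreal (1 / 4) * ennreal ?e)"
      using r e0 by (simp add: ennreal_mult[symmetric] r_def powr_diff)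
    also have "\<dots> \<le> ennreal (4 / r) * (ennreal (?\<kappa> * (?A * r)) * (\<integral>\<^sup>+z. ?h z \<partial>lborel))"
      by (rule mult_left_mono[OF main]) simp
    also have "\<dots> = ennreal (4 / r * (?\<kappa> * (?A * r))) * (\<integral>\<^sup>+z. ?h z \<partial>lborel)"
      using mean_const_pos[where 'n='n] kernel_const_pos[where 'n='n] r by (intro ennreal_mult_mult) auto
    also have "4 / r * (?\<kappa> * (?A * r)) = 4 * ?\<kappa> * ?A" using r by simp
    finally show ?thesis by (simp only: E_def k_def)
  qed
qed

text \<open>Levels below four times the mean oscillation are handled by the Poincare inequality in \<open>L\<^sup>1\<close>. For the higher
levels the previous lemma is integrated in \<open>t\<close>, a continuous form of Maz'ya's truncation method: at each
point the densities of all truncations add up to at most a multiple of \<open>g\<close>.\<close>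

theorem lorentz_poincare:
  fixes f :: "real^'n \<Rightarrow> 'b::euclidean_space"
  assumes f: "dominated_gradient f g" and R: "0 < R" and n: "2 \<le> CARD('n)"
  shows "(\<integral>\<^sup>+t\<in>{0<..}. ennreal (measure lborel {y\<in>cball x0 R. t < norm (f y - ball_mean f x0 R)} powr (1 - 1 / CARD('n))) \<partial>lborel)
    \<le> ennreal (lorentz_const TYPE('n)) * (\<integral>\<^sup>+z\<in>cball x0 R. ennreal (g z) \<partial>lborel)"
proof -
  let ?n = "CARD('n)" and ?B = "cball x0 R" and ?c = "ball_mean f x0 R" and ?V = "ball_vol CARD('n)"
  let ?K = "4 * mean_const TYPE('n) * kernel_const TYPE('n)" and ?p = "1 - 1 / real CARD('n)"
  let ?I = "\<integral>\<^sup>+z\<in>?B. ennreal (g z) \<partial>lborel" and ?v = "measure lborel ?B"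
  define J where "J = (LINT y:?B|lborel. norm (f y - ?c))"
  let ?k = "\<lambda>t z. 2 * t\<^sup>2 * norm (f z - ?c) * g z / (t\<^sup>2 + (norm (f z - ?c))\<^sup>2)\<^sup>2"
  have fc: "continuous_on UNIV f" by (rule dominated_gradient_continuous(1)[OF f])
  have [measurable]: "f \<in> borel_measurable borel" "g \<in> borel_measurable borel"
    using fc dominated_gradient_continuous(2)[OF f] by (auto intro: borel_measurable_continuous_onI)
  have [measurable]: "?B \<in> sets borel" by simp
  have g0: "0 \<le> g z" for z by (rule dominated_gradient_nonneg[OF f])
  have v: "?v = ?V * R ^ ?n" "0 < ?v" using R ball_vol_pos[where 'n='n] by (simp_all add: measure_cball)
  have J0: "0 \<le> J" unfolding J_def set_lebesgue_integral_def by (intro Bochner_Integration.integral_nonneg) auto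
  have "ennreal J = (\<integral>\<^sup>+y\<in>?B. ennreal (norm (f y - ?c)) \<partial>lborel)"
  proof -
    have "set_integrable lborel ?B (\<lambda>y. norm (f y - ?c))"
      by (intro continuous_integrable_cball continuous_intros fc)
    then have "(\<integral>\<^sup>+y. ennreal (indicator ?B y *\<^sub>R norm (f y - ?c)) \<partial>lborel) = ennreal J"
      unfolding J_def set_lebesgue_integral_def set_integrable_def by (intro nn_integral_eq_integral) auto
    moreover have "(\<integral>\<^sup>+y. ennreal (indicator ?B y *\<^sub>R norm (f y - ?c)) \<partial>lborel) = (\<integral>\<^sup>+y\<in>?B. ennreal (norm (f y - ?c)) \<partial>lborel)"
      by (rule nn_integral_cong) (auto simp: indicator_def)
    ultimately show ?thesis by simp
  qed
  also have "\<dots> \<le> ennreal (osc_const TYPE('n) * R) * ?I" by (rule poincare_ball[OF f R n])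
  finally have J: "ennreal J \<le> ennreal (osc_const TYPE('n) * R) * ?I" .
  have "(\<integral>\<^sup>+t\<in>{0<..}. ennreal (measure lborel {y\<in>?B. t < norm (f y - ?c)} powr ?p) \<partial>lborel) \<le>
    (\<integral>\<^sup>+t. ennreal (?v powr ?p) * indicator {0..4 * J / ?v} t + ennreal ?K * (\<integral>\<^sup>+z\<in>?B. ennreal (?k t z) * indicator {0..} t \<partial>lborel) \<partial>lborel)"
  proof (rule nn_integral_mono)
    fix t :: real
    show "ennreal (measure lborel {y\<in>?B. t < norm (f y - ?c)} powr ?p) * indicator {0<..} t \<le>
      ennreal (?v powr ?p) * indicator {0..4 * J / ?v} t + ennreal ?K * (\<integral>\<^sup>+z\<in>?B. ennreal (?k t z) * indicator {0..} t \<partial>lborel)"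
    proof (cases "0 < t")
      case t: True
      show ?thesis
      proof (cases "t \<le> 4 * J / ?v")
        case True
        have "measure lborel {y\<in>?B. t < norm (f y - ?c)} \<le> ?v"
        proof (rule measure_mono_fmeasurable)
          have "{y\<in>?B. t < norm (f y - ?c)} = ?B \<inter> {y. t < norm (f y - ?c)}" by auto
          also have "\<dots> \<in> sets borel" by measurable
          finally show "{y\<in>?B. t < norm (f y - ?c)} \<in> sets lborel" by simp
          show "?B \<in> fmeasurable lborel" by (intro fmeasurableI) (use R in \<open>auto simp: measure_cball\<close>)
        qed auto
        then have "measure lborel {y\<in>?B. t < norm (f y - ?c)} powr ?p \<le> ?v powr ?p"
          using n by (intro powr_mono2) auto
        then have "ennreal (measure lborel {y\<in>?B. t < norm (f y - ?c)} powr ?p) \<le> ennreal (?v powr ?p)"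
          by (rule ennreal_leI)
        then show ?thesis using True t by (simp add: add_increasing2)
      next
        case False
        then have "4 * (LINT y:?B|lborel. norm (f y - ?c)) \<le> t * ?v" using v by (simp add: J_def field_simps)
        from large_level_set[OF f R n t this] show ?thesis using t False by simp
      qed
    qed simp
  qed
  also have "\<dots> = ennreal (?v powr ?p) * ennreal (4 * J / ?v) +
      ennreal ?K * (\<integral>\<^sup>+t. (\<integral>\<^sup>+z\<in>?B. ennreal (?k t z) * indicator {0..} t \<partial>lborel) \<partial>lborel)"
  proof -
    have 1: "(\<lambda>t. \<integral>\<^sup>+z\<in>?B. ennreal (?k t z) * indicator {0..} t \<partial>lborel) \<in> borel_measurable lborel"
      by measurable
    have 2: "(\<integral>\<^sup>+t. ennreal (?v powr ?p) * indicator {0..4 * J / ?v} t \<partial>lborel) = ennreal (?v powr ?p) * ennreal (4 * J / ?v)"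
      using J0 v by (subst nn_integral_cmult_indicator) auto
    show ?thesis using 1 by (subst nn_integral_add) (auto simp: 2 nn_integral_cmult)
  qed
  also have "(\<integral>\<^sup>+t. (\<integral>\<^sup>+z\<in>?B. ennreal (?k t z) * indicator {0..} t \<partial>lborel) \<partial>lborel) =
      (\<integral>\<^sup>+z. (\<integral>\<^sup>+t. ennreal (?k t z) * indicator {0..} t * indicator ?B z \<partial>lborel) \<partial>lborel)"
    by (rule lborel_pair.Fubini') measurable
  also have "\<dots> \<le> (\<integral>\<^sup>+z. ennreal pi * (ennreal (g z) * indicator ?B z) \<partial>lborel)"
  proof (rule nn_integral_mono)
    fix z
    let ?b = "norm (f z - ?c)"
    have "(\<integral>\<^sup>+t. ennreal (?k t z) * indicator {0..} t * indicator ?B z \<partial>lborel) \<le>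
      (\<integral>\<^sup>+t. ennreal (2 * ?b / (t\<^sup>2 + ?b\<^sup>2)) * indicator {0..} t * (ennreal (g z) * indicator ?B z) \<partial>lborel)"
    proof (rule nn_integral_mono)
      fix t :: real
      have "?k t z \<le> 2 * ?b / (t\<^sup>2 + ?b\<^sup>2) * g z"
      proof (cases "t\<^sup>2 + ?b\<^sup>2 = 0")
        case False
        then have p: "0 < t\<^sup>2 + ?b\<^sup>2" by (simp add: less_le)
        have "?k t z = 2 * ?b / (t\<^sup>2 + ?b\<^sup>2) * g z * (t\<^sup>2 / (t\<^sup>2 + ?b\<^sup>2))"
          by (simp add: power2_eq_square[of "t\<^sup>2 + ?b\<^sup>2"])
        also have "\<dots> \<le> 2 * ?b / (t\<^sup>2 + ?b\<^sup>2) * g z * 1"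
          using p g0 by (intro mult_left_mono) auto
        finally show ?thesis by simp
      qed simp
      then have "ennreal (?k t z) \<le> ennreal (2 * ?b / (t\<^sup>2 + ?b\<^sup>2)) * ennreal (g z)"
        using g0 by (subst ennreal_mult[symmetric]) (auto intro: ennreal_leI)
      then show "ennreal (?k t z) * indicator {0..} t * indicator ?B z \<le>
         ennreal (2 * ?b / (t\<^sup>2 + ?b\<^sup>2)) * indicator {0..} t * (ennreal (g z) * indicator ?B z)"
        by (auto simp: indicator_def)
    qed
    also have "\<dots> = (\<integral>\<^sup>+t. ennreal (2 * ?b / (t\<^sup>2 + ?b\<^sup>2)) * indicator {0..} t \<partial>lborel) * (ennreal (g z) * indicator ?B z)"
      by (rule nn_integral_multc) measurable
    also have "\<dots> \<le> ennreal pi * (ennreal (g z) * indicator ?B z)"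
      by (intro mult_right_mono nn_integral_arctan_density) auto
    finally show "(\<integral>\<^sup>+t. ennreal (?k t z) * indicator {0..} t * indicator ?B z \<partial>lborel) \<le> ennreal pi * (ennreal (g z) * indicator ?B z)" .
  qed
  also have "\<dots> = ennreal pi * ?I"
    by (intro nn_integral_cmult borel_measurable_times_ennreal borel_measurable_indicator) auto
  finally have "(\<integral>\<^sup>+t\<in>{0<..}. ennreal (measure lborel {y\<in>?B. t < norm (f y - ?c)} powr ?p) \<partial>lborel) \<le>
    ennreal (?v powr ?p) * ennreal (4 * J / ?v) + ennreal ?K * (ennreal pi * ?I)"
    by (simp add: add_left_mono mult_left_mono)
  also have "ennreal (?v powr ?p) * ennreal (4 * J / ?v) = ennreal (4 * ?v powr ?p / ?v) * ennreal J"
    using J0 v(2) by (simp add: ennreal_mult[symmetric] mult_ac)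
  also have "\<dots> \<le> ennreal (4 * ?v powr ?p / ?v) * (ennreal (osc_const TYPE('n) * R) * ?I)"
    by (intro mult_left_mono J) simp
  also have "\<dots> = ennreal (4 * ?v powr ?p / ?v * (osc_const TYPE('n) * R)) * ?I"
    using v(2) R osc_const_pos[where 'n='n] by (intro ennreal_mult_mult) auto
  also have "4 * ?v powr ?p / ?v * (osc_const TYPE('n) * R) = 4 * osc_const TYPE('n) * ?V powr (- 1 / ?n)"
  proof -
    have "?v powr ?p / ?v = ?v powr (- 1 / ?n)"
      using v(2) by (simp add: powr_diff powr_minus divide_inverse)
    also have "\<dots> = ?V powr (- 1 / ?n) * (R ^ ?n) powr (- 1 / ?n)"
      unfolding v(1) by (simp add: powr_mult)
    also have "(R ^ ?n) powr (- 1 / ?n) = 1 / R"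
      using R by (simp add: powr_realpow[symmetric] powr_powr powr_minus_divide)
    finally have "?v powr ?p / ?v * R = ?V powr (- 1 / ?n)" using R by simp
    moreover have "4 * a / ?v * (b * R) = 4 * b * (a / ?v * R)" for a b by simp
    ultimately show ?thesis by (simp only:)
  qed
  also have "ennreal ?K * (ennreal pi * ?I) = ennreal (?K * pi) * ?I"
    using mean_const_pos[where 'n='n] kernel_const_pos[where 'n='n] by (intro ennreal_mult_mult) auto
  also have "ennreal (4 * osc_const TYPE('n) * ?V powr (- 1 / ?n)) * ?I + ennreal (?K * pi) * ?I = ennreal (lorentz_const TYPE('n)) * ?I"
    unfolding lorentz_const_def distrib_right[symmetric]
    using mean_const_pos[where 'n='n] kernel_const_pos[where 'n='n] osc_const_pos[where 'n='n]
    by (subst ennreal_plus) auto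
  finally show ?thesis by (simp add: add_right_mono)
qed

section \<open>Maximal functions over cubes\<close>

definition vanishes_outside :: "(real^'n \<Rightarrow> 'b::zero) \<Rightarrow> real \<Rightarrow> bool" where
  "vanishes_outside f M \<longleftrightarrow> 0 < M \<and> (\<forall>y. M < norm y \<longrightarrow> f y = 0)"

text \<open>On a ball of twice the radius of the support, wherever it is centred, \<open>f\<close> vanishes on at least half of the
ball; so the mean of \<open>|f(y) - f(x)|\<close> over the ball about \<open>x\<close> already controls \<open>|f(x)|\<close>.\<close>

lemma pointwise_le_riesz:
  fixes f :: "real^'n \<Rightarrow> 'b::banach"
  assumes f: "dominated_gradient f g" and M: "vanishes_outside f M" and n: "2 \<le> CARD('n)"
  shows "ennreal (norm (f x)) \<le> ennreal (mean_const TYPE('n)) * riesz (\<lambda>z. ennreal (g z)) x"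
proof -
  let ?n = "CARD('n)" and ?V = "ball_vol CARD('n)"
  define R where "R = 2 * M"
  have M0: "0 < M" and f0: "\<And>y. M < norm y \<Longrightarrow> f y = 0" using M by (auto simp: vanishes_outside_def)
  have R: "0 < R" using M0 by (simp add: R_def)
  let ?B = "cball x R" and ?v = "?V * R ^ ?n"
  have V: "0 < ?V" by (rule ball_vol_pos)
  have half: "ennreal (?v / 2) \<le> emeasure lborel (?B - cball 0 M)"
  proof -
    obtain k where k: "?n = Suc k" using n by (cases "?n") auto
    have "(2 * M) ^ ?n \<ge> 2 * M ^ ?n"
      using M0 unfolding k power_mult_distrib by (intro mult_right_mono) auto
    then have "?V * M ^ ?n \<le> ?v / 2" using V by (simp add: R_def)
    have "emeasure lborel ?B \<le> emeasure lborel ((?B - cball 0 M) \<union> cball 0 M)"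
      by (rule emeasure_mono) auto
    also have "\<dots> \<le> emeasure lborel (?B - cball 0 M) + emeasure lborel (cball (0::real^'n) M)"
      by (rule emeasure_subadditive) auto
    also have "\<dots> \<le> emeasure lborel (?B - cball 0 M) + ennreal (?v / 2)"
      using \<open>?V * M ^ ?n \<le> ?v / 2\<close> M0 by (intro add_left_mono) (simp add: measure_cball ennreal_leI)
    finally have "ennreal (?v / 2) + ennreal (?v / 2) \<le> ennreal (?v / 2) + emeasure lborel (?B - cball 0 M)"
      using R V by (simp add: measure_cball add.commute flip: ennreal_plus)
    then show ?thesis by (simp only: ennreal_add_left_cancel_le) auto
  qed
  have "ennreal (norm (f x)) * ennreal (?v / 2) \<le> ennreal (norm (f x)) * emeasure lborel (?B - cball 0 M)"
    by (rule mult_left_mono[OF half]) simp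
  also have "\<dots> = (\<integral>\<^sup>+y. ennreal (norm (f x)) * indicator (?B - cball 0 M) y \<partial>lborel)"
    by (rule nn_integral_cmult_indicator[symmetric]) auto
  also have "\<dots> \<le> (\<integral>\<^sup>+y\<in>?B. ennreal (norm (f y - f x)) \<partial>lborel)"
    by (rule nn_integral_mono) (auto simp: indicator_def f0)
  also have "\<dots> \<le> ennreal (R ^ ?n / ?n) * riesz (\<lambda>z. ennreal (g z) * indicator ?B z) x"
    by (rule pointwise_poincare[OF f _ _ _ _ _ n]) (use R in \<open>auto simp: dist_norm norm_minus_commute\<close>)
  also have "\<dots> \<le> ennreal (R ^ ?n / ?n) * riesz (\<lambda>z. ennreal (g z)) x"
    by (intro mult_left_mono riesz_mono) (auto simp: indicator_def)
  finally have "ennreal (2 / ?v) * (ennreal (norm (f x)) * ennreal (?v / 2)) \<le>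
      ennreal (2 / ?v) * (ennreal (R ^ ?n / ?n) * riesz (\<lambda>z. ennreal (g z)) x)"
    by (rule mult_left_mono) simp
  moreover have "ennreal (2 / ?v) * (ennreal (norm (f x)) * ennreal (?v / 2)) = ennreal (norm (f x))"
  proof -
    have "2 / ?v * (norm (f x) * (?v / 2)) = norm (f x)" using R V[THEN less_imp_neq] by simp
    then show ?thesis using R V by (simp only: ennreal_mult[symmetric] norm_ge_zero mult_nonneg_nonneg
        zero_le_divide_iff less_imp_le mult_pos_pos zero_less_power zero_le_numeral simp_thms)
  qed
  moreover have "ennreal (2 / ?v) * (ennreal (R ^ ?n / ?n) * riesz (\<lambda>z. ennreal (g z)) x) =
      ennreal (2 / (?n * ?V)) * riesz (\<lambda>z. ennreal (g z)) x"
    using R V by (subst ennreal_mult_mult) (auto simp: field_simps)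
  moreover have "ennreal (2 / (?n * ?V)) * riesz (\<lambda>z. ennreal (g z)) x \<le> ennreal (mean_const TYPE('n)) * riesz (\<lambda>z. ennreal (g z)) x"
  proof (intro mult_right_mono ennreal_leI)
    have "(2::real) ^ 1 \<le> 2 ^ ?n" by (rule power_increasing) (use n in auto)
    then show "2 / (?n * ?V) \<le> mean_const TYPE('n)"
      unfolding mean_const_def using V by (intro divide_right_mono) auto
  qed simp
  ultimately show ?thesis by simp
qed

lemma ball_mean_le_riesz:
  fixes f :: "real^'n \<Rightarrow> 'b::{banach,second_countable_topology}"
  assumes f: "dominated_gradient f g" and M: "vanishes_outside f M" and R: "0 < R" and n: "2 \<le> CARD('n)"
  shows "ennreal (norm (ball_mean f x R)) \<le> ennreal (2 * mean_const TYPE('n)) * riesz (\<lambda>z. ennreal (g z)) x"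
proof -
  let ?\<kappa> = "mean_const TYPE('n)" and ?I = "riesz (\<lambda>z. ennreal (g z)) x"
  have "ennreal (norm (f x - ball_mean f x R)) \<le> ennreal ?\<kappa> * riesz (\<lambda>z. ennreal (g z) * indicator (cball x R) z) x"
    by (rule diff_ball_mean_le[OF f R _ n]) (use R in simp)
  also have "\<dots> \<le> ennreal ?\<kappa> * ?I"
    by (intro mult_left_mono riesz_mono) (auto simp: indicator_def)
  finally have 1: "ennreal (norm (f x - ball_mean f x R)) \<le> ennreal ?\<kappa> * ?I" .
  have "norm (ball_mean f x R) \<le> norm (f x) + norm (f x - ball_mean f x R)"
    by (metis norm_minus_commute norm_triangle_sub)
  then have "ennreal (norm (ball_mean f x R)) \<le> ennreal (norm (f x)) + ennreal (norm (f x - ball_mean f x R))"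
    by (simp add: ennreal_leI flip: ennreal_plus)
  also have "\<dots> \<le> ennreal ?\<kappa> * ?I + ennreal ?\<kappa> * ?I"
    by (intro add_mono pointwise_le_riesz[OF f M n] 1)
  also have "\<dots> = ennreal (2 * ?\<kappa>) * ?I"
    using mean_const_pos[where 'n='n] by (simp add: distrib_right[symmetric] flip: ennreal_plus)
  finally show ?thesis .
qed

lemma ball_integral_le_riesz:
  fixes x :: "real^'n" and g :: "real^'n \<Rightarrow> ennreal"
  assumes g: "g \<in> borel_measurable borel" and R: "0 < R"
  shows "(\<integral>\<^sup>+z\<in>cball x R. g z \<partial>lborel) \<le> ennreal (R ^ (CARD('n) - 1)) * riesz g x"
proof -
  let ?k = "CARD('n) - 1"
  have "(\<integral>\<^sup>+z\<in>cball x R. g z \<partial>lborel) \<le> (\<integral>\<^sup>+z. ennreal (R ^ ?k) * (g z * ennreal (1 / norm (x - z) ^ ?k)) \<partial>lborel)"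
  proof (rule nn_integral_mono_AE, rule AE_mp[OF AE_lborel_singleton[of x]], rule AE_I2, rule impI)
    fix z :: "real^'n" assume "z \<noteq> x"
    show "g z * indicator (cball x R) z \<le> ennreal (R ^ ?k) * (g z * ennreal (1 / norm (x - z) ^ ?k))"
    proof (cases "z \<in> cball x R")
      case True
      then have "norm (x - z) ^ ?k \<le> R ^ ?k" by (intro power_mono) (auto simp: dist_norm)
      moreover have "0 < norm (x - z) ^ ?k" using \<open>z \<noteq> x\<close> by simp
      ultimately have "1 \<le> R ^ ?k * (1 / norm (x - z) ^ ?k)" by simp
      then have "ennreal 1 \<le> ennreal (R ^ ?k * (1 / norm (x - z) ^ ?k))" by (rule ennreal_leI)
      also have "\<dots> = ennreal (R ^ ?k) * ennreal (1 / norm (x - z) ^ ?k)" using R by (intro ennreal_mult) auto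
      finally have "g z * 1 \<le> g z * (ennreal (R ^ ?k) * ennreal (1 / norm (x - z) ^ ?k))"
        by (intro mult_left_mono) auto
      then show ?thesis using True by (simp add: mult.left_commute)
    qed simp
  qed
  also have "\<dots> = ennreal (R ^ ?k) * riesz g x"
    unfolding riesz_def by (rule nn_integral_cmult) (use g in measurable)
  finally show ?thesis .
qed

lemma cube_diameter:
  fixes x y :: "real^'n" and l :: real
  assumes "x \<in> cube c l" "y \<in> cube c l"
  shows "norm (y - x) \<le> CARD('n) * l"
proof -
  have "norm (y - x) \<le> (\<Sum>i\<in>UNIV. \<bar>(y - x) $ i\<bar>)" by (rule norm_le_l1_cart)
  also have "\<dots> \<le> (\<Sum>i\<in>(UNIV::'n set). l)"
  proof (rule sum_mono)
    fix i
    have "c$i \<le> x$i" "x$i \<le> c$i + l" "c$i \<le> y$i" "y$i \<le> c$i + l"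
      using assms by (auto simp: cube_def mem_box_cart)
    then show "\<bar>(y - x) $ i\<bar> \<le> l" by simp
  qed
  finally show ?thesis by simp
qed

lemma cube_borel: "cube c l \<in> sets borel"
  by (simp add: cube_def)

definition hl_const :: "'n::finite itself \<Rightarrow> real" where
  "hl_const _ = kernel_const TYPE('n) * (2 * CARD('n)) ^ (CARD('n) - 1)"

lemma hl_const_pos: "0 < hl_const TYPE('n::finite)"
  unfolding hl_const_def using kernel_const_pos[where 'n='n] by (intro mult_pos_pos) auto

text \<open>The Riesz kernel is an \<open>A\<^sub>1\<close> weight: if \<open>z\<close> is far from the cube, the kernel is nearly constant on it; if \<open>z\<close> is
close, the mean is largest when \<open>z\<close> lies in the cube.\<close>

lemma kernel_mean_le:
  fixes x z :: "real^'n"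
  assumes l: "0 < l" and x: "x \<in> cube c l" and z: "z \<noteq> x" and n: "2 \<le> CARD('n)"
  shows "(\<integral>\<^sup>+y\<in>cube c l. ennreal (1 / norm (z - y) ^ (CARD('n) - 1)) \<partial>lborel) \<le>
    ennreal (hl_const TYPE('n) * l ^ CARD('n) * (1 / norm (x - z) ^ (CARD('n) - 1)))"
proof (cases "norm (x - z) \<le> 2 * CARD('n) * l")
  case True
  let ?n = "CARD('n)"
  obtain k where k: "?n = Suc k" using n by (cases "?n") auto
  have "(\<integral>\<^sup>+y\<in>cube c l. ennreal (1 / norm (z - y) ^ (?n - 1)) \<partial>lborel) \<le> ennreal (kernel_const TYPE('n) * l)"
    by (rule kernel_integral_le[OF cube_borel l n]) (simp add: emeasure_cube l)
  also have "kernel_const TYPE('n) * l \<le> hl_const TYPE('n) * l ^ ?n * (1 / norm (x - z) ^ (?n - 1))"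
  proof -
    have p: "0 < norm (x - z) ^ k" using z by simp
    have "norm (x - z) ^ k \<le> (2 * ?n * l) ^ k" using True by (intro power_mono) auto
    then have "1 \<le> (2 * ?n * l) ^ k * (1 / norm (x - z) ^ k)" using p by simp
    then have "kernel_const TYPE('n) * l * 1 \<le> kernel_const TYPE('n) * l * ((2 * ?n * l) ^ k * (1 / norm (x - z) ^ k))"
      using kernel_const_pos[where 'n='n] l by (intro mult_left_mono) auto
    moreover have "kernel_const TYPE('n) * l * ((2 * ?n * l) ^ k * (1 / norm (x - z) ^ k)) =
        hl_const TYPE('n) * l ^ ?n * (1 / norm (x - z) ^ (?n - 1))"
      by (simp add: hl_const_def k power_mult_distrib)
    ultimately show ?thesis by (simp only: mult_1_right)
  qed
  finally show ?thesis by (simp add: ennreal_leI)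
next
  case False
  let ?n = "CARD('n)" and ?d = "norm (x - z)"
  have d: "0 < ?d" using z by simp
  have "(\<integral>\<^sup>+y\<in>cube c l. ennreal (1 / norm (z - y) ^ (?n - 1)) \<partial>lborel) \<le>
      (\<integral>\<^sup>+y. ennreal (2 ^ (?n - 1) / ?d ^ (?n - 1)) * indicator (cube c l) y \<partial>lborel)"
  proof (rule nn_integral_mono)
    fix y
    show "ennreal (1 / norm (z - y) ^ (?n - 1)) * indicator (cube c l) y \<le> ennreal (2 ^ (?n - 1) / ?d ^ (?n - 1)) * indicator (cube c l) y"
    proof (cases "y \<in> cube c l")
      case True
      then have "norm (y - x) \<le> ?n * l" using x cube_diameter by blast
      moreover have "?d \<le> norm (z - y) + norm (y - x)"
        using norm_triangle_ineq[of "z - y" "y - x"] by (simp add: norm_minus_commute)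
      ultimately have "?d / 2 \<le> norm (z - y)" using False by simp
      then have "1 / norm (z - y) ^ (?n - 1) \<le> 1 / (?d / 2) ^ (?n - 1)"
        using d by (intro divide_left_mono power_mono mult_pos_pos zero_less_power) auto
      then show ?thesis by (simp add: True power_divide ennreal_leI)
    qed simp
  qed
  also have "\<dots> = ennreal (2 ^ (?n - 1) / ?d ^ (?n - 1)) * ennreal (l ^ ?n)"
    using cube_borel l by (subst nn_integral_cmult_indicator) (auto simp: emeasure_cube)
  also have "\<dots> = ennreal (2 ^ (?n - 1) / ?d ^ (?n - 1) * l ^ ?n)" using l by (intro ennreal_mult[symmetric]) auto
  also have "\<dots> \<le> ennreal (hl_const TYPE('n) * l ^ ?n * (1 / ?d ^ (?n - 1)))"
  proof (rule ennreal_leI)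
    have "1 * (2::real) ^ (?n - 1) \<le> kernel_const TYPE('n) * (2 * ?n) ^ (?n - 1)"
      using kernel_const_pos[where 'n='n] n by (intro mult_mono power_mono) auto
    then have "2 ^ (?n - 1) * (l ^ ?n * (1 / ?d ^ (?n - 1))) \<le> hl_const TYPE('n) * (l ^ ?n * (1 / ?d ^ (?n - 1)))"
      unfolding hl_const_def using l by (intro mult_right_mono) auto
    then show "2 ^ (?n - 1) / ?d ^ (?n - 1) * l ^ ?n \<le> hl_const TYPE('n) * l ^ ?n * (1 / ?d ^ (?n - 1))"
      by (simp add: mult_ac)
  qed
  finally show ?thesis .
qed

lemma hl_maximal_riesz:
  fixes g h :: "real^'n \<Rightarrow> ennreal"
  assumes g[measurable]: "g \<in> borel_measurable borel" and n: "2 \<le> CARD('n)" and K: "0 \<le> K"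
    and h: "\<And>y. h y \<le> ennreal K * riesz g y"
  shows "hl_maximal h x \<le> ennreal (K * hl_const TYPE('n)) * riesz g x"
  unfolding hl_maximal_def
proof (rule SUP_least, clarify)
  fix c l assume "(c, l) \<in> cubes_at x"
  then have l: "0 < l" and x: "x \<in> cube c l" by (auto simp: cubes_at_def)
  let ?n = "CARD('n)" and ?k = "\<lambda>y z. ennreal (1 / norm (y - z :: real^'n) ^ (CARD('n) - 1))" and ?H = "hl_const TYPE('n)"
  have [measurable]: "cube c l \<in> sets borel" by (rule cube_borel)
  note [measurable] = riesz_measurable[OF g]
  have "(\<integral>\<^sup>+y\<in>cube c l. h y \<partial>lebesgue) \<le> (\<integral>\<^sup>+y. ennreal K * (riesz g y * indicator (cube c l) y) \<partial>lborel)"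
    unfolding nn_integral_completion by (rule nn_integral_mono) (auto simp: indicator_def h)
  also have "\<dots> = ennreal K * (\<integral>\<^sup>+y\<in>cube c l. riesz g y \<partial>lborel)"
    by (rule nn_integral_cmult) measurable
  also have "(\<integral>\<^sup>+y\<in>cube c l. riesz g y \<partial>lborel) = (\<integral>\<^sup>+y. (\<integral>\<^sup>+z. g z * ?k y z * indicator (cube c l) y \<partial>lborel) \<partial>lborel)"
    unfolding riesz_def by (intro nn_integral_cong nn_integral_multc[symmetric]) measurable
  also have "\<dots> = (\<integral>\<^sup>+z. (\<integral>\<^sup>+y. g z * ?k y z * indicator (cube c l) y \<partial>lborel) \<partial>lborel)"
    by (rule lborel_pair.Fubini') measurable
  also have "\<dots> \<le> (\<integral>\<^sup>+z. ennreal (?H * l ^ ?n) * (g z * ?k x z) \<partial>lborel)"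
  proof (rule nn_integral_mono_AE, rule AE_mp[OF AE_lborel_singleton[of x]], rule AE_I2, rule impI)
    fix z :: "real^'n" assume z: "z \<noteq> x"
    have "(\<integral>\<^sup>+y. g z * ?k y z * indicator (cube c l) y \<partial>lborel) = g z * (\<integral>\<^sup>+y\<in>cube c l. ?k z y \<partial>lborel)"
      unfolding mult.assoc norm_minus_commute[of _ z] by (rule nn_integral_cmult) measurable
    also have "\<dots> \<le> g z * ennreal (?H * l ^ ?n * (1 / norm (x - z) ^ (?n - 1)))"
      by (intro mult_left_mono kernel_mean_le l x z n) simp
    also have "\<dots> = ennreal (?H * l ^ ?n) * (g z * ?k x z)"
      using hl_const_pos[where 'n='n] l by (subst ennreal_mult) (auto simp: mult_ac)
    finally show "(\<integral>\<^sup>+y. g z * ?k y z * indicator (cube c l) y \<partial>lborel) \<le> ennreal (?H * l ^ ?n) * (g z * ?k x z)" .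
  qed
  also have "\<dots> = ennreal (?H * l ^ ?n) * riesz g x"
    unfolding riesz_def by (rule nn_integral_cmult) measurable
  finally have "(\<integral>\<^sup>+y\<in>cube c l. h y \<partial>lebesgue) \<le> ennreal K * (ennreal (?H * l ^ ?n) * riesz g x)"
    by (simp add: mult_left_mono)
  also have "\<dots> = ennreal (l ^ ?n) * (ennreal (K * ?H) * riesz g x)"
    using K l hl_const_pos[where 'n='n] by (subst (1 2) ennreal_mult_mult) (auto simp: mult_ac)
  finally have I: "(\<integral>\<^sup>+y\<in>cube c l. h y \<partial>lebesgue) \<le> ennreal (l ^ ?n) * (ennreal (K * ?H) * riesz g x)" .
  have "emeasure lebesgue (cube c l) = ennreal (l ^ ?n)"
    using l by (simp add: emeasure_cube cube_def[symmetric] emeasure_completion)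
  then show "(\<integral>\<^sup>+y\<in>cube c l. h y \<partial>lebesgue) / emeasure lebesgue (cube c l) \<le> ennreal (K * ?H) * riesz g x"
    using I l by (simp add: divide_le_posI_ennreal)
qed

lemma iterated_maximal_riesz:
  fixes f :: "real^'n \<Rightarrow> complex"
  assumes f: "dominated_gradient f g" and M: "vanishes_outside f M" and n: "2 \<le> CARD('n)"
  shows "iterated_maximal k f x \<le> ennreal (mean_const TYPE('n) * hl_const TYPE('n) ^ k) * riesz (\<lambda>z. ennreal (g z)) x"
  unfolding iterated_maximal_def
proof (induction k arbitrary: x)
  case 0
  then show ?case using pointwise_le_riesz[OF f M n] by simp
next
  case (Suc k)
  have [measurable]: "g \<in> borel_measurable borel"
    using dominated_gradient_continuous(2)[OF f] by (rule borel_measurable_continuous_onI)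
  have "hl_maximal ((hl_maximal ^^ k) (\<lambda>x. ennreal (norm (f x)))) x \<le>
      ennreal (mean_const TYPE('n) * hl_const TYPE('n) ^ k * hl_const TYPE('n)) * riesz (\<lambda>z. ennreal (g z)) x"
    using Suc.IH mean_const_pos[where 'n='n] hl_const_pos[where 'n='n] by (intro hl_maximal_riesz n) auto
  then show ?case by (simp add: mult_ac)
qed

lemma antimono_measurable:
  fixes F :: "real \<Rightarrow> real"
  assumes "\<And>s t. s \<le> t \<Longrightarrow> F t \<le> F s"
  shows "F \<in> borel_measurable borel"
proof -
  have "mono (\<lambda>t. - F t)" using assms by (auto simp: mono_def)
  then have "(\<lambda>t. - F t) \<in> borel_measurable borel" by (rule borel_measurable_mono)
  then have "(\<lambda>t. - (- F t)) \<in> borel_measurable borel" by (rule borel_measurable_uminus)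
  then show ?thesis by simp
qed

lemma level_set_borel:
  fixes f :: "real^'n \<Rightarrow> 'b::real_normed_vector"
  assumes f: "continuous_on UNIV f" and B: "B \<in> sets borel"
  shows "{y\<in>B. t < norm (f y)} \<in> sets borel"
proof -
  have "{y. t < norm (f y)} \<in> sets borel"
    by (intro borel_open open_Collect_less continuous_intros f)
  then have "B \<inter> {y. t < norm (f y)} \<in> sets borel" using B by auto
  moreover have "{y\<in>B. t < norm (f y)} = B \<inter> {y. t < norm (f y)}" by auto
  ultimately show ?thesis by simp
qed

lemma level_set_fmeasurable:
  fixes f :: "real^'n \<Rightarrow> 'b::real_normed_vector"
  assumes f: "continuous_on UNIV f" and R: "0 \<le> R"
  shows "{y\<in>cball x0 R. t < norm (f y)} \<in> fmeasurable lborel"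
proof (rule fmeasurableI2)
  show "cball x0 R \<in> fmeasurable lborel" by (intro fmeasurableI) (use R in \<open>auto simp: measure_cball\<close>)
  show "{y\<in>cball x0 R. t < norm (f y)} \<in> sets lborel" using level_set_borel[OF f, of "cball x0 R"] by simp
qed auto

definition lorentz_max_const :: "'n::finite itself \<Rightarrow> real" where
  "lorentz_max_const _ = conj_exponent TYPE('n) *
     (2 * lorentz_const TYPE('n) * CARD('n) ^ (CARD('n) - 1) + 4 * mean_const TYPE('n))"

lemma conj_exponent_inverse:
  assumes "2 \<le> CARD('n::finite)"
  shows "1 / conj_exponent TYPE('n) = 1 - 1 / CARD('n)" "0 < conj_exponent TYPE('n)"
  using assms by (auto simp: conj_exponent_def field_simps)

text \<open>Every cube containing \<open>x\<close> lies in a ball centred at \<open>x\<close> of comparable size. The mean \<open>m\<close> over that ball is bounded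
by the potential at \<open>x\<close>, and \<open>f - m\<close> is controlled by the Lorentz-Poincare inequality: for \<open>t > 2 |m|\<close> the set
\<open>|f| > t\<close> is contained in \<open>|f - m| > t / 2\<close>.\<close>

lemma lorentz_maximal_riesz:
  fixes f :: "real^'n \<Rightarrow> complex"
  assumes f: "dominated_gradient f g" and M: "vanishes_outside f M" and n: "2 \<le> CARD('n)"
  shows "lorentz_maximal f x \<le> ennreal (lorentz_max_const TYPE('n)) * riesz (\<lambda>z. ennreal (g z)) x"
  unfolding lorentz_maximal_def
proof (rule SUP_least, clarify)
  fix c l assume "(c, l) \<in> cubes_at x"
  then have l: "0 < l" and x: "x \<in> cube c l" by (auto simp: cubes_at_def)
  let ?n = "CARD('n)" and ?Q = "cube c l" and ?p = "1 - 1 / real CARD('n)" and ?e = "conj_exponent TYPE('n)"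
  let ?I = "riesz (\<lambda>z. ennreal (g z)) x"
  obtain k where k: "?n = Suc k" using n by (cases "?n") auto
  define R where "R = ?n * l"
  have R: "0 < R" using l by (simp add: R_def k)
  define m where "m = ball_mean f x R"
  have fc: "continuous_on UNIV f" by (rule dominated_gradient_continuous(1)[OF f])
  have fm: "continuous_on UNIV (\<lambda>y. f y - m)" by (intro continuous_intros fc)
  have gm[measurable]: "g \<in> borel_measurable borel"
    using dominated_gradient_continuous(2)[OF f] by (rule borel_measurable_continuous_onI)
  have QB: "?Q \<subseteq> cball x R"
    using cube_diameter[OF x] by (auto simp: R_def dist_norm norm_minus_commute)
  have Qs: "?Q \<in> sets borel" by (rule cube_borel)
  have Qf: "emeasure lborel ?Q = ennreal (l ^ ?n)" using emeasure_cube[where 'n='n] l by blast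
  have mQ: "measure lborel ?Q = l ^ ?n" using Qf l by (simp add: measure_def)
  define F where "F s = measure lborel {y\<in>cball x R. s < norm (f y - m)} powr ?p" for s
  have p: "0 \<le> ?p" using n by (simp add: divide_le_eq)
  have Fm[measurable]: "F \<in> borel_measurable borel"
  proof (rule antimono_measurable)
    fix s t :: real assume "s \<le> t"
    then have "measure lborel {y\<in>cball x R. t < norm (f y - m)} \<le> measure lborel {y\<in>cball x R. s < norm (f y - m)}"
      using R by (intro measure_mono_fmeasurable[OF _ fmeasurableD[OF level_set_fmeasurable[OF fm]] level_set_fmeasurable[OF fm]]) auto
    then show "F t \<le> F s" unfolding F_def by (intro powr_mono2 p) auto
  qed
  have "(\<integral>\<^sup>+t\<in>{0<..}. ennreal (measure lebesgue {y\<in>?Q. t < norm (f y)} powr (1 / ?e)) \<partial>lborel) \<le>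
    (\<integral>\<^sup>+t. ennreal (F (t / 2)) * indicator {0<..} (t / 2) + ennreal ((l ^ ?n) powr ?p) * indicator {0..2 * norm m} t \<partial>lborel)"
  proof (rule nn_integral_mono)
    fix t :: real
    have E: "{y\<in>?Q. t < norm (f y)} \<in> sets lborel" using level_set_borel[OF fc Qs] by simp
    have bnd: "measure lborel {y\<in>?Q. t < norm (f y)} powr ?p \<le> F (t / 2) + (l ^ ?n) powr ?p * indicator {0..2 * norm m} t" if t: "0 < t"
    proof (cases "t \<le> 2 * norm m")
      case True
      have "measure lborel {y\<in>?Q. t < norm (f y)} \<le> measure lborel ?Q"
        by (rule measure_mono_fmeasurable[OF _ E]) (use Qf Qs in \<open>auto intro: fmeasurableI\<close>)
      then have "measure lborel {y\<in>?Q. t < norm (f y)} powr ?p \<le> (l ^ ?n) powr ?p"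
        unfolding mQ by (intro powr_mono2 p) auto
      then show ?thesis using True t by (simp add: F_def add_increasing)
    next
      case False
      have "{y\<in>?Q. t < norm (f y)} \<subseteq> {y\<in>cball x R. t / 2 < norm (f y - m)}"
      proof safe
        fix y assume y: "y \<in> ?Q" "t < norm (f y)"
        have "norm (f y) \<le> norm (f y - m) + norm m" using norm_triangle_ineq[of "f y - m" m] by simp
        then show "t / 2 < norm (f y - m)" using y False by simp
      qed (use QB in auto)
      then have "measure lborel {y\<in>?Q. t < norm (f y)} \<le> measure lborel {y\<in>cball x R. t / 2 < norm (f y - m)}"
        using R by (intro measure_mono_fmeasurable E level_set_fmeasurable fm) auto
      then have "measure lborel {y\<in>?Q. t < norm (f y)} powr ?p \<le> F (t / 2)"
        unfolding F_def by (intro powr_mono2 p) auto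
      then show ?thesis using False by simp
    qed
    have meas: "measure lebesgue {y\<in>?Q. t < norm (f y)} = measure lborel {y\<in>?Q. t < norm (f y)}"
      by (rule measure_completion[OF E])
    show "ennreal (measure lebesgue {y\<in>?Q. t < norm (f y)} powr (1 / ?e)) * indicator {0<..} t \<le>
      ennreal (F (t / 2)) * indicator {0<..} (t / 2) + ennreal ((l ^ ?n) powr ?p) * indicator {0..2 * norm m} t"
    proof (cases "0 < t")
      case True
      have "ennreal (measure lborel {y\<in>?Q. t < norm (f y)} powr ?p) \<le>
          ennreal (F (t / 2) + (l ^ ?n) powr ?p * indicator {0..2 * norm m} t)"
        by (rule ennreal_leI) (rule bnd[OF True])
      also have "\<dots> = ennreal (F (t / 2)) + ennreal ((l ^ ?n) powr ?p) * indicator {0..2 * norm m} t"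
        by (subst ennreal_plus) (auto simp: F_def indicator_def)
      finally show ?thesis using True unfolding meas conj_exponent_inverse(1)[OF n] by simp
    qed simp
  qed
  also have "\<dots> = (\<integral>\<^sup>+t. ennreal (F (t / 2)) * indicator {0<..} (t / 2) \<partial>lborel) + (\<integral>\<^sup>+t. ennreal ((l ^ ?n) powr ?p) * indicator {0..2 * norm m} t \<partial>lborel)"
    by (rule nn_integral_add) measurable
  also have "(\<integral>\<^sup>+t. ennreal (F (t / 2)) * indicator {0<..} (t / 2) \<partial>lborel) = 2 * (\<integral>\<^sup>+s\<in>{0<..}. ennreal (F s) \<partial>lborel)"
    by (subst nn_integral_real_affine[where c = 2 and t = 0]) auto
  also have "(\<integral>\<^sup>+t. ennreal ((l ^ ?n) powr ?p) * indicator {0..2 * norm m} t \<partial>lborel) = ennreal (l ^ k) * ennreal (2 * norm m)"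
  proof -
    have "(l ^ ?n) powr ?p = l ^ k"
    proof -
      have "(l ^ ?n) powr ?p = l powr (?n * ?p)"
        using l by (simp add: powr_realpow[symmetric] powr_powr)
      also have "?n * ?p = real k" by (simp add: k field_simps)
      finally show ?thesis using l by (simp add: powr_realpow)
    qed
    then show ?thesis by (subst nn_integral_cmult_indicator) auto
  qed
  finally have A: "(\<integral>\<^sup>+t\<in>{0<..}. ennreal (measure lebesgue {y\<in>?Q. t < norm (f y)} powr (1 / ?e)) \<partial>lborel) \<le>
    2 * (\<integral>\<^sup>+s\<in>{0<..}. ennreal (F s) \<partial>lborel) + ennreal (l ^ k) * ennreal (2 * norm m)" .
  have "(\<integral>\<^sup>+s\<in>{0<..}. ennreal (F s) \<partial>lborel) \<le> ennreal (lorentz_const TYPE('n)) * (\<integral>\<^sup>+z\<in>cball x R. ennreal (g z) \<partial>lborel)"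
    unfolding F_def m_def by (rule lorentz_poincare[OF f R n])
  also have "\<dots> \<le> ennreal (lorentz_const TYPE('n)) * (ennreal (R ^ (?n - 1)) * ?I)"
    by (intro mult_left_mono ball_integral_le_riesz R) auto
  also have "\<dots> = ennreal (l ^ k) * (ennreal (lorentz_const TYPE('n) * ?n ^ k) * ?I)"
    using l lorentz_const_pos[where 'n='n]
    by (subst (1 2) ennreal_mult_mult) (auto simp: R_def k power_mult_distrib mult_ac)
  finally have B: "(\<integral>\<^sup>+s\<in>{0<..}. ennreal (F s) \<partial>lborel) \<le> ennreal (l ^ k) * (ennreal (lorentz_const TYPE('n) * ?n ^ k) * ?I)" .
  have "ennreal (norm m) \<le> ennreal (2 * mean_const TYPE('n)) * ?I"
    unfolding m_def by (rule ball_mean_le_riesz[OF f M R n])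
  then have "2 * ennreal (norm m) \<le> 2 * (ennreal (2 * mean_const TYPE('n)) * ?I)" by (rule mult_left_mono) simp
  then have Cm: "ennreal (2 * norm m) \<le> ennreal (4 * mean_const TYPE('n)) * ?I"
    using mean_const_pos[where 'n='n] by (simp add: ennreal_mult mult.assoc[symmetric])
  have "(\<integral>\<^sup>+t\<in>{0<..}. ennreal (measure lebesgue {y\<in>?Q. t < norm (f y)} powr (1 / ?e)) \<partial>lborel) \<le>
      2 * (ennreal (l ^ k) * (ennreal (lorentz_const TYPE('n) * ?n ^ k) * ?I)) + ennreal (l ^ k) * (ennreal (4 * mean_const TYPE('n)) * ?I)"
    by (rule order_trans[OF A]) (intro add_mono mult_left_mono B Cm, auto)
  also have "\<dots> = ennreal (l ^ k) * (ennreal (2 * lorentz_const TYPE('n) * ?n ^ k + 4 * mean_const TYPE('n)) * ?I)"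
    using mean_const_pos[where 'n='n] lorentz_const_pos[where 'n='n]
    by (simp add: ennreal_plus ennreal_mult distrib_left distrib_right mult_ac)
  finally have D: "(\<integral>\<^sup>+t\<in>{0<..}. ennreal (measure lebesgue {y\<in>?Q. t < norm (f y)} powr (1 / ?e)) \<partial>lborel) \<le>
      ennreal (l ^ k) * (ennreal (2 * lorentz_const TYPE('n) * ?n ^ k + 4 * mean_const TYPE('n)) * ?I)" .
  have fac: "measure lebesgue ?Q powr (- 1 / ?e) * ?e = ?e / l ^ k"
  proof -
    have "measure lebesgue ?Q = l ^ ?n" using measure_completion[of ?Q lborel] Qs mQ by simp
    moreover have "(l ^ ?n) powr (- 1 / ?e) = l powr (?n * (- 1 / ?e))"
      using l by (simp add: powr_realpow[symmetric] powr_powr)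
    moreover have "?n * (- 1 / ?e) = - real k"
    proof -
      have "?n * (- 1 / ?e) = - (?n * (1 / ?e))" by simp
      also have "\<dots> = - real k" unfolding conj_exponent_inverse(1)[OF n] by (simp add: k field_simps)
      finally show ?thesis .
    qed
    ultimately show ?thesis using l by (simp add: powr_minus_divide powr_realpow)
  qed
  have "lorentz_norm ?Q f \<le> ennreal (?e / l ^ k) * (ennreal (l ^ k) * (ennreal (2 * lorentz_const TYPE('n) * ?n ^ k + 4 * mean_const TYPE('n)) * ?I))"
    unfolding lorentz_norm_def Let_def fac by (rule mult_left_mono[OF D]) simp
  also have "\<dots> = ennreal (lorentz_max_const TYPE('n)) * ?I"
    using l conj_exponent_inverse(2)[OF n] mean_const_pos[where 'n='n] lorentz_const_pos[where 'n='n]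
    by (subst ennreal_mult_mult, simp, simp, subst ennreal_mult_mult) (auto simp: lorentz_max_const_def k)
  finally show "lorentz_norm ?Q f \<le> ennreal (lorentz_max_const TYPE('n)) * ?I" .
qed

section \<open>Surface measure and the spherical maximal function\<close>

lemma sphere_projection_measurable:
  "(\<lambda>x::real^'n. x /\<^sub>R norm x) \<in> restrict_space lborel (ball 0 1 - {0}) \<rightarrow>\<^sub>M restrict_space borel (sphere 0 1)"
proof (rule measurable_restrict_space2)
  show "(\<lambda>x::real^'n. x /\<^sub>R norm x) \<in> space (restrict_space lborel (ball 0 1 - {0})) \<rightarrow> sphere 0 1"
    by (auto simp: space_restrict_space)
  show "(\<lambda>x::real^'n. x /\<^sub>R norm x) \<in> borel_measurable (restrict_space lborel (ball 0 1 - {0}))"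
    by (rule measurable_restrict_space1) simp
qed

text \<open>The measure \<open>E \<mapsto> |{r y : 0 < r < 1, y \<in> E}|\<close> on the sphere, of which surface measure is \<open>n\<close> times the completion.\<close>

definition cone_measure :: "(real^'n) measure" where
  "cone_measure = distr (restrict_space lborel (ball 0 1 - {0})) (restrict_space borel (sphere 0 1)) (\<lambda>x. x /\<^sub>R norm x)"

lemma sphere_measure_eq: "sphere_measure = completion (scale_measure (of_nat CARD('n)) (cone_measure :: (real^'n) measure))"
  by (simp add: sphere_measure_def cone_measure_def)

lemma cone_measure_nn_integral:
  fixes F :: "real^'n \<Rightarrow> ennreal"
  assumes F: "F \<in> borel_measurable (restrict_space borel (sphere 0 1))"
  shows "(\<integral>\<^sup>+y. F y \<partial>cone_measure) = (\<integral>\<^sup>+y\<in>ball 0 1 - {0}. F (y /\<^sub>R norm y) \<partial>lborel)"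
proof -
  have "(\<integral>\<^sup>+y. F y \<partial>cone_measure) = (\<integral>\<^sup>+y. F (y /\<^sub>R norm y) \<partial>restrict_space lborel (ball 0 1 - {0}))"
    unfolding cone_measure_def by (rule nn_integral_distr[OF sphere_projection_measurable]) (use F in simp)
  also have "\<dots> = (\<integral>\<^sup>+y\<in>ball 0 1 - {0}. F (y /\<^sub>R norm y) \<partial>lborel)"
    by (rule nn_integral_restrict_space) simp
  finally show ?thesis .
qed

lemma sphere_nn_integral:
  fixes F :: "real^'n \<Rightarrow> ennreal"
  assumes F: "F \<in> borel_measurable (restrict_space borel (sphere 0 1))"
  shows "(\<integral>\<^sup>+y. F y \<partial>sphere_measure) = of_nat CARD('n) * (\<integral>\<^sup>+y\<in>ball 0 1 - {0}. F (y /\<^sub>R norm y) \<partial>lborel)"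
proof -
  have "F \<in> borel_measurable cone_measure" using F by (simp add: cone_measure_def)
  then show ?thesis
    unfolding sphere_measure_eq nn_integral_completion
    by (simp add: nn_integral_scale_measure cone_measure_nn_integral[OF F])
qed

text \<open>Bound \<open>f(x - t \<theta>)\<close> by the integral of \<open>g\<close> along the ray from there to infinity. The cone formula for surface
measure averages this over \<open>y\<close> in the unit ball instead of \<open>\<theta>\<close>; on the ray through \<open>y\<close> the substitution \<open>z = s y\<close>
then turns the double integral into the Riesz potential.\<close>

lemma spherical_maximal_riesz:
  fixes f :: "real^'n \<Rightarrow> complex"
  assumes f: "dominated_gradient f g" and M: "vanishes_outside f M" and n: "2 \<le> CARD('n)"
  shows "spherical_maximal f x \<le> riesz (\<lambda>z. ennreal (g z)) x"
  unfolding spherical_maximal_def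
proof (rule SUP_least)
  fix t :: real assume "t \<in> {0<..}"
  then have t: "0 < t" by simp
  let ?n = "CARD('n)"
  have [measurable]: "g \<in> borel_measurable borel"
    using dominated_gradient_continuous(2)[OF f] by (rule borel_measurable_continuous_onI)
  have fm[measurable]: "f \<in> borel_measurable borel"
    using dominated_gradient_continuous(1)[OF f] by (rule borel_measurable_continuous_onI)
  have g0: "0 \<le> g z" for z by (rule dominated_gradient_nonneg[OF f])
  have M0: "0 < M" and f0: "\<And>y. M < norm y \<Longrightarrow> f y = 0" using M by (auto simp: vanishes_outside_def)
  have bB[measurable]: "ball (0::real^'n) 1 - {0} \<in> sets borel" by simp
  let ?K = "\<lambda>s y. ennreal (g (x - s *\<^sub>R y) * norm y) * indicator (ball 0 1 - {0}) y * indicator {0<..} s"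
  have ray: "ennreal (norm (f (x - t *\<^sub>R (y /\<^sub>R norm y)))) * indicator (ball 0 1 - {0}) y \<le> (\<integral>\<^sup>+s. ?K s y \<partial>lborel)" for y
  proof (cases "y \<in> ball 0 1 - {0}")
    case True
    then have y: "0 < norm y" by simp
    define a where "a = t / norm y"
    define b where "b = a + (norm x + M + 1) / norm y"
    have a: "0 < a" using t y by (simp add: a_def)
    have ab: "a \<le> b" using y M0 by (simp add: b_def add_nonneg_pos less_imp_le)
    have "(norm x + M + 1) / norm y \<le> b" using a by (simp add: b_def)
    then have "norm x + M + 1 \<le> b * norm y" using y by (simp add: divide_le_eq)
    also have "\<dots> = norm (b *\<^sub>R y)" using a ab by simp
    also have "\<dots> \<le> norm (x - b *\<^sub>R y) + norm x"
      by (metis norm_minus_commute norm_triangle_sub add.commute)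
    finally have "f (x + b *\<^sub>R (- y)) = 0" by (intro f0) simp
    then have "ennreal (norm (f (x - t *\<^sub>R (y /\<^sub>R norm y)))) \<le> (\<integral>\<^sup>+s. ennreal (g (x + s *\<^sub>R (- y)) * norm (- y)) * indicator {a..b} s \<partial>lborel)"
      using increment_le_line_integral[OF f ab, of x "- y"] by (simp add: a_def divide_inverse)
    also have "\<dots> \<le> (\<integral>\<^sup>+s. ?K s y \<partial>lborel)"
      using True a by (intro nn_integral_mono) (auto simp: indicator_def)
    finally show ?thesis using True by simp
  qed simp
  have "ennreal (norm (LINT y|sphere_measure. f (x - t *\<^sub>R y))) \<le> (\<integral>\<^sup>+y. ennreal (norm (f (x - t *\<^sub>R y))) \<partial>sphere_measure)"
  proof (cases "integrable sphere_measure (\<lambda>y. f (x - t *\<^sub>R y))")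
    case True
    then show ?thesis by (rule integral_norm_bound_ennreal)
  qed (simp add: not_integrable_integral_eq)
  also have "\<dots> = of_nat ?n * (\<integral>\<^sup>+y\<in>ball 0 1 - {0}. ennreal (norm (f (x - t *\<^sub>R (y /\<^sub>R norm y)))) \<partial>lborel)"
    by (rule sphere_nn_integral) (rule measurable_restrict_space1, measurable)
  also have "\<dots> \<le> of_nat ?n * (\<integral>\<^sup>+y. (\<integral>\<^sup>+s. ?K s y \<partial>lborel) \<partial>lborel)"
    by (intro mult_left_mono nn_integral_mono ray) auto
  also have "(\<integral>\<^sup>+y. (\<integral>\<^sup>+s. ?K s y \<partial>lborel) \<partial>lborel) = (\<integral>\<^sup>+s. (\<integral>\<^sup>+y. ?K s y \<partial>lborel) \<partial>lborel)"
    by (rule lborel_pair.Fubini') measurable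
  also have "\<dots> \<le> (\<integral>\<^sup>+s. (\<integral>\<^sup>+z. ennreal (1 / s ^ Suc ?n) * (if norm z \<le> s then 1 else 0) * ennreal (g (x - z) * norm z) \<partial>lborel) \<partial>lborel)"
  proof (rule nn_integral_mono)
    fix s :: real
    show "(\<integral>\<^sup>+y. ?K s y \<partial>lborel) \<le> (\<integral>\<^sup>+z. ennreal (1 / s ^ Suc ?n) * (if norm z \<le> s then 1 else 0) * ennreal (g (x - z) * norm z) \<partial>lborel)"
    proof (cases "0 < s")
      case s: True
      have Km: "?K s \<in> borel_measurable borel" by measurable
      have "(\<integral>\<^sup>+y. ?K s y \<partial>lborel) = ennreal (\<bar>1 / s\<bar> ^ ?n) * (\<integral>\<^sup>+z. ?K s (0 + (1 / s) *\<^sub>R z) \<partial>lborel)"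
        using s by (intro nn_integral_affine[OF Km]) simp
      also have "\<dots> = (\<integral>\<^sup>+z. ennreal (\<bar>1 / s\<bar> ^ ?n) * ?K s (0 + (1 / s) *\<^sub>R z) \<partial>lborel)"
        by (rule nn_integral_cmult[symmetric]) measurable
      also have "\<dots> \<le> (\<integral>\<^sup>+z. ennreal (1 / s ^ Suc ?n) * (if norm z \<le> s then 1 else 0) * ennreal (g (x - z) * norm z) \<partial>lborel)"
      proof (rule nn_integral_mono)
        fix z :: "real^'n"
        show "ennreal (\<bar>1 / s\<bar> ^ ?n) * ?K s (0 + (1 / s) *\<^sub>R z) \<le> ennreal (1 / s ^ Suc ?n) * (if norm z \<le> s then 1 else 0) * ennreal (g (x - z) * norm z)"
        proof (cases "norm z \<le> s")
          case True
          have "ennreal (\<bar>1 / s\<bar> ^ ?n) * ?K s (0 + (1 / s) *\<^sub>R z) \<le> ennreal (\<bar>1 / s\<bar> ^ ?n) * ennreal (g (x - z) * (norm z / s))"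
            using s by (intro mult_left_mono) (auto simp: indicator_def)
          also have "\<dots> = ennreal (1 / s ^ Suc ?n) * ennreal (g (x - z) * norm z)"
            using s g0 by (simp add: ennreal_mult[symmetric] power_one_over)
          finally show ?thesis using True by simp
        next
          case False
          then have "(1 / s) *\<^sub>R z \<notin> ball 0 1" using s by (simp add: field_simps)
          then show ?thesis by simp
        qed
      qed
      finally show ?thesis .
    qed simp
  qed
  also have "\<dots> = (\<integral>\<^sup>+z. (\<integral>\<^sup>+s. ennreal (1 / s ^ Suc ?n) * (if norm z \<le> s then 1 else 0) * ennreal (g (x - z) * norm z) \<partial>lborel) \<partial>lborel)"
    by (rule lborel_pair.Fubini') measurable
  also have "\<dots> = (\<integral>\<^sup>+z. ennreal (1 / ?n) * (ennreal (g (x - z)) * ennreal (1 / norm z ^ (?n - 1))) \<partial>lborel)"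
  proof (rule nn_integral_cong)
    fix z :: "real^'n"
    obtain k where k: "?n = Suc k" using n by (cases "?n") auto
    have "(\<integral>\<^sup>+s. ennreal (1 / s ^ Suc ?n) * (if norm z \<le> s then 1 else 0) * ennreal (g (x - z) * norm z) \<partial>lborel) =
        (\<integral>\<^sup>+s. ennreal (1 / s ^ Suc ?n) * indicator {norm z..} s \<partial>lborel) * ennreal (g (x - z) * norm z)"
      by (subst nn_integral_multc[symmetric], measurable) (auto intro!: nn_integral_cong simp: indicator_def)
    also have "\<dots> = ennreal (1 / ?n) * (ennreal (g (x - z)) * ennreal (1 / norm z ^ (?n - 1)))"
    proof (cases "z = 0")
      case True
      then show ?thesis using n by (simp add: power_0_left)
    next
      case False
      then have "(\<integral>\<^sup>+s. ennreal (1 / s ^ Suc ?n) * indicator {norm z..} s \<partial>lborel) = ennreal (1 / (?n * norm z ^ ?n))"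
        using n by (intro nn_integral_tail) auto
      moreover have "1 / (?n * norm z ^ ?n) * (g (x - z) * norm z) = 1 / ?n * (g (x - z) * (1 / norm z ^ (?n - 1)))"
        using False unfolding k by simp
      ultimately show ?thesis using g0 by (simp only: ennreal_mult[symmetric] zero_le_divide_iff mult_nonneg_nonneg
          zero_le_power norm_ge_zero of_nat_0_le_iff zero_le_one simp_thms)
    qed
    finally show "(\<integral>\<^sup>+s. ennreal (1 / s ^ Suc ?n) * (if norm z \<le> s then 1 else 0) * ennreal (g (x - z) * norm z) \<partial>lborel)
      = ennreal (1 / ?n) * (ennreal (g (x - z)) * ennreal (1 / norm z ^ (?n - 1)))" .
  qed
  also have "\<dots> = ennreal (1 / ?n) * (\<integral>\<^sup>+z. ennreal (g (x - z)) * ennreal (1 / norm z ^ (?n - 1)) \<partial>lborel)"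
    by (rule nn_integral_cmult) measurable
  also have "(\<integral>\<^sup>+z. ennreal (g (x - z)) * ennreal (1 / norm z ^ (?n - 1)) \<partial>lborel) = riesz (\<lambda>z. ennreal (g z)) x"
  proof -
    have "(\<lambda>z. ennreal (g z) * ennreal (1 / norm (x - z) ^ (?n - 1))) \<in> borel_measurable borel" by measurable
    from nn_integral_reflect[OF this, of x] show ?thesis by (simp add: riesz_def)
  qed
  also have "of_nat ?n * (ennreal (1 / ?n) * riesz (\<lambda>z. ennreal (g z)) x) = riesz (\<lambda>z. ennreal (g z)) x"
  proof -
    have "ennreal (real ?n * (1 / ?n)) = 1" using n by simp
    then show ?thesis unfolding ennreal_of_nat_eq_real_of_nat by (subst ennreal_mult_mult) auto
  qed
  finally show "ennreal (norm (LINT y|sphere_measure. f (x - t *\<^sub>R y))) \<le> riesz (\<lambda>z. ennreal (g z)) x"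
    by (simp add: mult_left_mono)
qed

section \<open>Homogeneous kernels in weak Lebesgue spaces\<close>

lemma AE_lborel_scale:
  fixes P :: "real^'n \<Rightarrow> bool"
  assumes P: "AE y in lborel. P y" and c: "c \<noteq> 0"
  shows "AE y in lborel. P (c *\<^sub>R y)"
proof -
  obtain N where N: "{x. \<not> P x} \<subseteq> N" "emeasure lborel N = 0" "N \<in> sets borel"
    using AE_E[OF P] by auto
  have m: "indicator N \<in> borel_measurable borel" using N by simp
  have "ennreal (\<bar>c\<bar> ^ CARD('n)) * (\<integral>\<^sup>+y. indicator N (0 + c *\<^sub>R y) \<partial>lborel) = (\<integral>\<^sup>+z. indicator N z \<partial>lborel)"
    by (rule nn_integral_affine[OF m c, symmetric])
  also have "\<dots> = 0" using N by simp
  finally have "(\<integral>\<^sup>+y. indicator N (c *\<^sub>R y) \<partial>lborel) = 0" using c by simp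
  moreover have "(\<lambda>y. indicator N (c *\<^sub>R y) :: ennreal) \<in> borel_measurable lborel"
    using N(3) by measurable
  ultimately have "AE y in lborel. indicator N (c *\<^sub>R y) = (0 :: ennreal)"
    by (simp add: nn_integral_0_iff_AE)
  then show ?thesis
    by eventually_elim (use N(1) in \<open>auto simp: indicator_def split: if_splits\<close>)
qed

text \<open>A cone is the union of countably many dilates of its part in the unit ball.\<close>

lemma homogeneous_AE:
  fixes \<Omega> G :: "real^'n \<Rightarrow> complex"
  assumes hom: "homogeneous_deg_0 \<Omega>" "homogeneous_deg_0 G"
    and ae: "AE y in lborel. y \<in> ball 0 1 - {0} \<longrightarrow> \<Omega> y = G y"
  shows "AE y in lborel. \<Omega> y = G y"
proof -
  have "AE y in lborel. \<forall>k::nat. (1 / real (Suc k)) *\<^sub>R y \<in> ball 0 1 - {0} \<longrightarrow>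
      \<Omega> ((1 / real (Suc k)) *\<^sub>R y) = G ((1 / real (Suc k)) *\<^sub>R y)"
    unfolding AE_all_countable by (intro allI AE_lborel_scale[OF ae]) simp
  moreover have "AE y in lborel. y \<noteq> (0::real^'n)" by (rule AE_lborel_singleton)
  ultimately show ?thesis
  proof eventually_elim
    fix y :: "real^'n"
    assume *: "\<forall>k::nat. (1 / real (Suc k)) *\<^sub>R y \<in> ball 0 1 - {0} \<longrightarrow>
      \<Omega> ((1 / real (Suc k)) *\<^sub>R y) = G ((1 / real (Suc k)) *\<^sub>R y)" and y: "y \<noteq> 0"
    obtain k where "norm y < real k" using reals_Archimedean2 by blast
    then have "(1 / real (Suc k)) *\<^sub>R y \<in> ball 0 1 - {0}" using y by (simp add: field_simps)
    then have "\<Omega> ((1 / real (Suc k)) *\<^sub>R y) = G ((1 / real (Suc k)) *\<^sub>R y)" using * by blast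
    then show "\<Omega> y = G y" using hom y unfolding homogeneous_deg_0_def by (metis divide_pos_pos of_nat_0_less_iff zero_less_Suc zero_less_one)
  qed
qed

text \<open>Measurability on the sphere is only up to null sets. Replacing \<open>\<Omega>\<close> by a Borel function of the same homogeneity,
almost everywhere equal both on the sphere and in space, makes Tonelli's theorem available.\<close>

lemma sphere_function_regular:
  fixes \<Omega> :: "real^'n \<Rightarrow> complex"
  assumes hom: "homogeneous_deg_0 \<Omega>" and meas: "\<Omega> \<in> borel_measurable sphere_measure"
  obtains G where "G \<in> borel_measurable borel" "homogeneous_deg_0 G"
    "AE y in lborel. \<Omega> y = G y" "AE y in sphere_measure. \<Omega> y = G y"
proof -
  let ?N = "scale_measure (of_nat CARD('n)) (cone_measure :: (real^'n) measure)"
  have sN: "sets ?N = sets (restrict_space borel (sphere 0 1))" by (simp add: cone_measure_def)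
  have spN: "space ?N = sphere 0 1" by (simp add: space_scale_measure cone_measure_def space_restrict_space)
  have \<Omega>N: "\<Omega> \<in> borel_measurable (completion ?N)" using meas by (simp only: sphere_measure_eq)
  have re: "(\<lambda>y. Re (\<Omega> y)) \<in> borel_measurable (completion ?N)"
    by (rule measurable_compose[OF \<Omega>N]) (intro borel_measurable_continuous_onI continuous_intros)
  have im: "(\<lambda>y. Im (\<Omega> y)) \<in> borel_measurable (completion ?N)"
    by (rule measurable_compose[OF \<Omega>N]) (intro borel_measurable_continuous_onI continuous_intros)
  obtain r where r: "r \<in> borel_measurable ?N" "AE y in ?N. Re (\<Omega> y) = r y"
    using completion_ex_borel_measurable_real[OF re] by blast
  obtain i where i: "i \<in> borel_measurable ?N" "AE y in ?N. Im (\<Omega> y) = i y"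
    using completion_ex_borel_measurable_real[OF im] by blast
  define \<Omega>' where "\<Omega>' y = complex_of_real (r y) + \<i> * complex_of_real (i y)" for y
  have \<Omega>'m: "\<Omega>' \<in> borel_measurable (restrict_space borel (sphere 0 1))"
  proof -
    have "\<Omega>' \<in> borel_measurable ?N" unfolding \<Omega>'_def[abs_def] using r(1) i(1) by measurable
    then show ?thesis using measurable_cong_sets[OF sN refl] by blast
  qed
  have aeN: "AE y in ?N. \<Omega> y = \<Omega>' y"
    using r(2) i(2) by eventually_elim (simp add: \<Omega>'_def complex_eq_iff)
  define G where "G y = (if y \<in> - {0} then \<Omega>' (y /\<^sub>R norm y) else 0)" for y
  have Gm: "G \<in> borel_measurable borel"
  proof -
    have "(\<lambda>y::real^'n. y /\<^sub>R norm y) \<in> restrict_space borel (- {0}) \<rightarrow>\<^sub>M restrict_space borel (sphere 0 1)"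
    proof (rule measurable_restrict_space2)
      show "(\<lambda>y::real^'n. y /\<^sub>R norm y) \<in> borel_measurable (restrict_space borel (- {0}))"
        by (rule measurable_restrict_space1) simp
    qed (auto simp: space_restrict_space)
    from measurable_compose[OF this \<Omega>'m]
    have "(\<lambda>y. \<Omega>' (y /\<^sub>R norm y)) \<in> borel_measurable (restrict_space borel (- {0}))" .
    then show ?thesis unfolding G_def[abs_def] by (subst (asm) measurable_restrict_space_iff[where c = 0]) auto
  qed
  have Gh: "homogeneous_deg_0 G"
    unfolding homogeneous_deg_0_def G_def by (auto simp: field_simps)
  have Gs: "G y = \<Omega>' y" if "norm y = 1" for y using that by (auto simp: G_def)
  have "AE y in ?N. \<Omega> y = G y"
    using aeN AE_space by eventually_elim (simp add: spN Gs)
  then have ae_sphere: "AE y in sphere_measure. \<Omega> y = G y"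
    unfolding sphere_measure_eq by (rule AE_completion)
  have "AE y in cone_measure. \<Omega> y = G y"
  proof -
    obtain Z where Z: "{y \<in> space ?N. \<not> \<Omega> y = G y} \<subseteq> Z" "emeasure ?N Z = 0" "Z \<in> sets ?N"
      using AE_E[OF \<open>AE y in ?N. \<Omega> y = G y\<close>] by blast
    show ?thesis
    proof (rule AE_I)
      show "{y \<in> space cone_measure. \<not> \<Omega> y = G y} \<subseteq> Z" using Z(1) by (simp add: space_scale_measure)
      show "emeasure cone_measure Z = 0" using Z(2) by simp
      show "Z \<in> sets cone_measure" using Z(3) by simp
    qed
  qed
  then have "AE y in restrict_space lborel (ball 0 1 - {0}). \<Omega> (y /\<^sub>R norm y) = G (y /\<^sub>R norm y)"
    unfolding cone_measure_def by (rule AE_distrD[OF sphere_projection_measurable])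
  then have "AE y in lborel. y \<in> ball 0 1 - {0} \<longrightarrow> \<Omega> (y /\<^sub>R norm y) = G (y /\<^sub>R norm y)"
    by (subst (asm) AE_restrict_space_iff) auto
  then have "AE y in lborel. y \<in> ball 0 1 - {0} \<longrightarrow> \<Omega> y = G y"
  proof eventually_elim
    fix y :: "real^'n" assume *: "y \<in> ball 0 1 - {0} \<longrightarrow> \<Omega> (y /\<^sub>R norm y) = G (y /\<^sub>R norm y)"
    show "y \<in> ball 0 1 - {0} \<longrightarrow> \<Omega> y = G y"
    proof
      assume y: "y \<in> ball 0 1 - {0}"
      have "F (y /\<^sub>R norm y) = F y" if "homogeneous_deg_0 F" for F :: "real^'n \<Rightarrow> complex"
        using that y by (simp add: homogeneous_deg_0_def)
      from this[OF hom] this[OF Gh] * y show "\<Omega> y = G y" by simp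
    qed
  qed
  then have "AE y in lborel. \<Omega> y = G y" by (rule homogeneous_AE[OF hom Gh])
  then show ?thesis using that Gm Gh ae_sphere by blast
qed

text \<open>The condition \<open>\<Omega> \<in> L\<^bsup>n,\<infinity>\<^esup>\<close> on the sphere, transferred to space: the kernel lies in weak \<open>L\<^sup>n\<close> of every ball
centred at the origin, with a norm proportional to the radius.\<close>

definition rough_kernel :: "(real^'n \<Rightarrow> complex) \<Rightarrow> real \<Rightarrow> bool" where
  "rough_kernel G K \<longleftrightarrow> G \<in> borel_measurable borel \<and> 0 < K \<and>
    (\<forall>R>0. \<forall>s>0. emeasure lborel {y\<in>cball 0 R. s < norm (G y)} \<le> ennreal ((K * R / s) ^ CARD('n)))"

lemma weak_sphere_bound:
  fixes \<Omega> G :: "real^'n \<Rightarrow> complex"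
  assumes weak: "in_weak_Ln_sphere \<Omega>" and G: "G \<in> borel_measurable borel" "homogeneous_deg_0 G"
    and ae: "AE y in sphere_measure. \<Omega> y = G y"
  shows "\<exists>K. rough_kernel G K"
proof -
  let ?n = "CARD('n)" and ?\<sigma> = "sphere_measure :: (real^'n) measure"
  note G(1)[measurable]
  define S where "S = (SUP t\<in>{0<..}. ennreal (t * measure ?\<sigma> {y\<in>sphere 0 1. t < norm (\<Omega> y)} powr (1 / real ?n)))"
  have "S < \<infinity>" using weak by (simp add: in_weak_Ln_sphere_def S_def)
  then obtain A where A: "S = ennreal A" "0 \<le> A" by (cases S) auto
  have sp: "space ?\<sigma> = sphere 0 1"
    by (simp add: sphere_measure_def space_scale_measure space_restrict_space)
  have \<Omega>m: "\<Omega> \<in> borel_measurable ?\<sigma>" using weak by (simp add: in_weak_Ln_sphere_def)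
  have Gr: "G \<in> borel_measurable (restrict_space borel (sphere 0 1))"
    by (rule measurable_restrict_space1) measurable
  have Gm: "G \<in> borel_measurable ?\<sigma>"
    unfolding sphere_measure_eq by (rule measurable_completion) (use Gr in \<open>simp add: cone_measure_def\<close>)
  have unit: "emeasure lborel {y\<in>ball 0 1 - {0}. s < norm (G y)} \<le> ennreal ((A / s) ^ ?n)" if s: "0 < s" for s
  proof -
    let ?E = "{y\<in>sphere 0 1. s < norm (G y)}" and ?B = "{y\<in>ball 0 1 - {0}. s < norm (G y)}"
    have E: "?E \<in> sets ?\<sigma>" using Gm unfolding sp[symmetric] by measurable
    have E\<Omega>: "{y\<in>sphere 0 1. s < norm (\<Omega> y)} \<in> sets ?\<sigma>" using \<Omega>m unfolding sp[symmetric] by measurable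
    have B: "?B \<in> sets borel"
    proof -
      have "?B = (ball 0 1 - {0}) \<inter> {y. s < norm (G y)}" by auto
      also have "\<dots> \<in> sets borel" by measurable
      finally show ?thesis .
    qed
    have "emeasure ?\<sigma> ?E = (\<integral>\<^sup>+y. indicator {y. s < norm (G y)} y \<partial>?\<sigma>)"
      unfolding nn_integral_indicator[OF E, symmetric]
      by (rule nn_integral_cong) (simp add: sp indicator_def)
    also have "\<dots> = of_nat ?n * (\<integral>\<^sup>+y\<in>ball 0 1 - {0}. indicator {y. s < norm (G y)} (y /\<^sub>R norm y) \<partial>lborel)"
      by (rule sphere_nn_integral) (rule measurable_restrict_space1, measurable)
    also have "(\<integral>\<^sup>+y\<in>ball 0 1 - {0}. indicator {y. s < norm (G y)} (y /\<^sub>R norm y) \<partial>lborel) = (\<integral>\<^sup>+y. indicator ?B y \<partial>lborel)"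
    proof (rule nn_integral_cong)
      fix y :: "real^'n"
      have "G (y /\<^sub>R norm y) = G y" if "y \<noteq> 0" using G(2) that by (simp add: homogeneous_deg_0_def)
      then show "indicator {y. s < norm (G y)} (y /\<^sub>R norm y) * indicator (ball 0 1 - {0}) y = (indicator ?B y :: ennreal)"
        by (cases "y = 0") (auto simp: indicator_def)
    qed
    also have "\<dots> = emeasure lborel ?B" using B by simp
    finally have eq: "emeasure ?\<sigma> ?E = of_nat ?n * emeasure lborel ?B" .
    have "emeasure lborel ?B \<le> emeasure lborel (ball (0::real^'n) 1)" by (rule emeasure_mono) auto
    also have "\<dots> < \<infinity>" by (rule emeasure_bounded_finite) simp
    finally have "emeasure ?\<sigma> ?E < \<infinity>" unfolding eq by (simp add: ennreal_mult_less_top ennreal_of_nat_eq_real_of_nat)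
    then have fin: "emeasure ?\<sigma> ?E = ennreal (measure ?\<sigma> ?E)"
      by (intro emeasure_eq_ennreal_measure) auto
    have "measure ?\<sigma> {y\<in>sphere 0 1. s < norm (\<Omega> y)} = measure ?\<sigma> ?E"
      by (rule measure_eq_AE[OF _ E\<Omega> E]) (use ae in \<open>eventually_elim, simp\<close>)
    then have "ennreal (s * measure ?\<sigma> ?E powr (1 / real ?n)) \<le> S"
      unfolding S_def using s by (intro SUP_upper2[of s]) auto
    then have "s * measure ?\<sigma> ?E powr (1 / real ?n) \<le> A" using A by simp
    then have "measure ?\<sigma> ?E powr (1 / real ?n) \<le> A / s" using s by (simp add: field_simps)
    then have "(measure ?\<sigma> ?E powr (1 / real ?n)) ^ ?n \<le> (A / s) ^ ?n" by (rule power_mono) simp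
    moreover have "(measure ?\<sigma> ?E powr (1 / real ?n)) ^ ?n = measure ?\<sigma> ?E"
    proof (cases "measure ?\<sigma> ?E = 0")
      case False
      then show ?thesis by (simp add: powr_realpow[symmetric] powr_powr)
    qed simp
    ultimately have "emeasure ?\<sigma> ?E \<le> ennreal ((A / s) ^ ?n)" unfolding fin by (simp add: ennreal_leI)
    moreover have "1 * emeasure lborel ?B \<le> of_nat ?n * emeasure lborel ?B"
      by (intro mult_right_mono) (auto simp: Suc_le_eq)
    ultimately show ?thesis unfolding eq by simp
  qed
  have "emeasure lborel {y\<in>cball 0 R. s < norm (G y)} \<le> ennreal (((2 * A + 1) * R / s) ^ ?n)" if R: "0 < R" and s: "0 < s" for R s
  proof -
    let ?D = "{y\<in>cball 0 R. s < norm (G y)}" and ?B = "{y\<in>ball 0 1 - {0}. s < norm (G y)}"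
    have D: "?D \<in> sets borel"
    proof -
      have "?D = cball 0 R \<inter> {y. s < norm (G y)}" by auto
      also have "\<dots> \<in> sets borel" by measurable
      finally show ?thesis .
    qed
    have B: "?B \<in> sets borel"
    proof -
      have "?B = (ball 0 1 - {0}) \<inter> {y. s < norm (G y)}" by auto
      also have "\<dots> \<in> sets borel" by measurable
      finally show ?thesis .
    qed
    have iD: "indicator ?D \<in> borel_measurable borel" using D by simp
    have "emeasure lborel ?D = (\<integral>\<^sup>+y. indicator ?D y \<partial>lborel)" using D by simp
    \<comment> \<open>Dilation by \<open>2 R\<close> rather than \<open>R\<close>, so that the closed ball comes from inside the open unit ball.\<close>
    also have "\<dots> = ennreal (\<bar>2 * R\<bar> ^ ?n) * (\<integral>\<^sup>+y. indicator ?D (0 + (2 * R) *\<^sub>R y) \<partial>lborel)"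
      by (rule nn_integral_affine[OF iD]) (use R in simp)
    also have "\<dots> \<le> ennreal (\<bar>2 * R\<bar> ^ ?n) * (\<integral>\<^sup>+y. indicator ?B y \<partial>lborel)"
    proof (rule mult_left_mono, rule nn_integral_mono_AE, rule AE_mp[OF AE_lborel_singleton[of "0::real^'n"]], rule AE_I2, rule impI)
      fix y :: "real^'n" assume y: "y \<noteq> 0"
      then have "G ((2 * R) *\<^sub>R y) = G y" using G(2) R by (simp add: homogeneous_deg_0_def)
      moreover have "norm y < 1" if "norm ((2 * R) *\<^sub>R y) \<le> R" using that R by simp
      ultimately show "indicator ?D (0 + (2 * R) *\<^sub>R y) \<le> (indicator ?B y :: ennreal)"
        using y by (auto simp: indicator_def)
    qed simp
    also have "(\<integral>\<^sup>+y. indicator ?B y \<partial>lborel) = emeasure lborel ?B" using B by simp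
    also have "ennreal (\<bar>2 * R\<bar> ^ ?n) * emeasure lborel ?B \<le> ennreal (\<bar>2 * R\<bar> ^ ?n) * ennreal ((A / s) ^ ?n)"
      by (intro mult_left_mono unit s) simp
    also have "\<dots> = ennreal ((2 * R * (A / s)) ^ ?n)"
      using R s A by (simp only: ennreal_mult[symmetric] zero_le_power abs_ge_zero divide_nonneg_pos
          power_mult_distrib[symmetric]) simp
    also have "\<dots> \<le> ennreal (((2 * A + 1) * R / s) ^ ?n)"
      using R s A by (intro ennreal_leI power_mono) (auto simp: field_simps)
    finally show ?thesis .
  qed
  then have "rough_kernel G (2 * A + 1)" using G(1) A by (simp add: rough_kernel_def)
  then show ?thesis by blast
qed

text \<open>By homogeneity, the mean over the sphere is, up to a factor, the mean over any centred ball.\<close>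

lemma mean_zero_ball:
  fixes \<Omega> G :: "real^'n \<Rightarrow> complex"
  assumes mean: "mean_zero_sphere \<Omega>" and G: "G \<in> borel_measurable borel" "homogeneous_deg_0 G"
    and ae: "AE y in sphere_measure. \<Omega> y = G y" and R: "0 < R"
  shows "(LINT y:cball 0 R|lborel. G y) = 0"
proof -
  let ?n = "CARD('n)" and ?N = "scale_measure (of_nat CARD('n)) (cone_measure :: (real^'n) measure)"
  note G(1)[measurable]
  have Gr: "G \<in> borel_measurable (restrict_space borel (sphere 0 1))"
    by (rule measurable_restrict_space1) measurable
  have Gb: "G \<in> borel_measurable cone_measure" using Gr by (simp add: cone_measure_def)
  have GN: "G \<in> borel_measurable ?N" using Gb by simp
  have G\<sigma>: "G \<in> borel_measurable sphere_measure"
    unfolding sphere_measure_eq by (rule measurable_completion[OF GN])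
  have scale: "?N = density cone_measure (\<lambda>_. ennreal (real ?n))"
    by (rule measure_eqI) (auto simp: emeasure_density nn_integral_cmult_indicator ennreal_of_nat_eq_real_of_nat)
  have "0 = (LINT y|sphere_measure. \<Omega> y)" using mean by (simp add: mean_zero_sphere_def)
  also have "\<dots> = (LINT y|sphere_measure. G y)"
    using mean G\<sigma> ae by (intro integral_cong_AE) (auto simp: mean_zero_sphere_def)
  also have "\<dots> = (LINT y|?N. G y)"
    unfolding sphere_measure_eq by (rule integral_completion[OF GN])
  also have "\<dots> = (LINT y|cone_measure. real ?n *\<^sub>R G y)"
    unfolding scale by (rule integral_density[OF Gb]) auto
  also have "\<dots> = real ?n *\<^sub>R (LINT y|cone_measure. G y)" by simp
  also have "(LINT y|cone_measure. G y) = (LINT y|restrict_space lborel (ball 0 1 - {0}). G (y /\<^sub>R norm y))"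
    unfolding cone_measure_def by (rule integral_distr[OF sphere_projection_measurable Gr])
  also have "\<dots> = (LINT y|lborel. indicator (ball 0 1 - {0}) y *\<^sub>R G (y /\<^sub>R norm y))"
    by (rule integral_restrict_space) simp
  also have "\<dots> = (LINT y|lborel. indicator (ball 0 1 - {0}) y *\<^sub>R G y)"
  proof (rule Bochner_Integration.integral_cong[OF refl])
    fix y :: "real^'n"
    show "indicator (ball 0 1 - {0}) y *\<^sub>R G (y /\<^sub>R norm y) = indicator (ball 0 1 - {0}) y *\<^sub>R G y"
      using G(2) by (cases "y = 0") (auto simp: homogeneous_deg_0_def)
  qed
  finally have "(LINT y|lborel. indicator (ball 0 1 - {0}) y *\<^sub>R G y) = 0" by simp
  also have "(LINT y|lborel. indicator (ball 0 1 - {0}) y *\<^sub>R G y) = (LINT y|lborel. indicator (cball 0 1) y *\<^sub>R G y)"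
  proof (rule integral_cong_AE)
    have "sphere (0::real^'n) 1 \<in> null_sets lborel"
      using negligible_sphere[of "0::real^'n" 1] by (auto simp: null_sets_completion_iff negligible_iff_null_sets)
    then have "AE y in lborel. y \<notin> sphere (0::real^'n) 1" by (rule AE_not_in)
    then show "AE y in lborel. indicator (ball 0 1 - {0}) y *\<^sub>R G y = indicator (cball 0 1) y *\<^sub>R G y"
      using AE_lborel_singleton[of "0::real^'n"] by eventually_elim (auto simp: indicator_def)
    have "(\<lambda>y. indicator A y *\<^sub>R G y) \<in> borel_measurable lborel" if "A \<in> sets borel" for A
      using that by measurable
    from this[of "ball 0 1 - {0}"] this[of "cball 0 1"]
    show "(\<lambda>y. indicator (ball 0 1 - {0}) y *\<^sub>R G y) \<in> borel_measurable lborel"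
      "(\<lambda>y. indicator (cball 0 1) y *\<^sub>R G y) \<in> borel_measurable lborel" by simp_all
  qed
  finally have unit: "(LINT y|lborel. indicator (cball 0 1) y *\<^sub>R G y) = 0" .
  let ?h = "\<lambda>y. indicator (cball 0 R) y *\<^sub>R G y"
  have hm: "?h \<in> borel_measurable borel"
    by (intro borel_measurable_scaleR borel_measurable_indicator G(1)) simp
  have "(LINT y|lborel. ?h y) = (LINT y|density (distr lborel borel (\<lambda>y. 0 + R *\<^sub>R y)) (\<lambda>_. ennreal (\<bar>R\<bar> ^ ?n)). ?h y)"
    using lborel_affine[of R "0::real^'n"] R by simp
  also have "\<dots> = (LINT y|distr lborel borel (\<lambda>y. 0 + R *\<^sub>R y). (\<bar>R\<bar> ^ ?n) *\<^sub>R ?h y)"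
    by (rule integral_density) (use hm in auto)
  also have "\<dots> = (LINT y|lborel. (\<bar>R\<bar> ^ ?n) *\<^sub>R ?h (0 + R *\<^sub>R y))"
    by (rule integral_distr) (use hm in measurable)
  also have "\<dots> = (\<bar>R\<bar> ^ ?n) *\<^sub>R (LINT y|lborel. ?h (R *\<^sub>R y))"
    unfolding add_0_left by (rule integral_scaleR_right)
  also have "(LINT y|lborel. ?h (R *\<^sub>R y)) = (LINT y|lborel. indicator (cball 0 1) y *\<^sub>R G y)"
  proof (rule Bochner_Integration.integral_cong[OF refl])
    fix y :: "real^'n"
    have "G (R *\<^sub>R y) = G y" using G(2) R by (cases "y = 0") (auto simp: homogeneous_deg_0_def)
    then show "?h (R *\<^sub>R y) = indicator (cball 0 1) y *\<^sub>R G y" using R by (auto simp: indicator_def)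
  qed
  finally show ?thesis unfolding set_lebesgue_integral_def unit by simp
qed

section \<open>Rough maximal functions\<close>

text \<open>Integrate the distribution function, cut at the height \<open>s = K R |E|\<^bsup>-1/n\<^esup>\<close> where the bounds \<open>|E|\<close> and
\<open>(K R / s)\<^sup>n\<close> for it agree.\<close>

lemma rough_kernel_set_integral:
  fixes G :: "real^'n \<Rightarrow> complex"
  assumes G: "rough_kernel G K" and E: "E \<in> sets borel" "E \<subseteq> cball 0 R" and R: "0 < R" and n: "2 \<le> CARD('n)"
  shows "(\<integral>\<^sup>+y\<in>E. ennreal (norm (G y)) \<partial>lborel) \<le> ennreal (2 * K * R * measure lborel E powr (1 - 1 / CARD('n)))"
proof -
  let ?n = "CARD('n)" and ?e = "measure lborel E"
  have [measurable]: "G \<in> borel_measurable borel" and K: "0 < K" using G by (auto simp: rough_kernel_def)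
  note E(1)[measurable]
  have "emeasure lborel E \<le> emeasure lborel (cball (0::real^'n) R)" by (rule emeasure_mono) (use E in auto)
  also have "\<dots> < \<infinity>" using R by (simp add: measure_cball)
  finally have e: "emeasure lborel E = ennreal ?e" by (intro emeasure_eq_ennreal_measure) auto
  show ?thesis
  proof (cases "?e = 0")
    case True
    then have "E \<in> null_sets lborel" using e E by (auto simp: null_sets_def)
    then have "AE y in lborel. y \<notin> E" by (rule AE_not_in)
    then have "AE y in lborel. ennreal (norm (G y)) * indicator E y = 0" by eventually_elim simp
    then have "(\<integral>\<^sup>+y\<in>E. ennreal (norm (G y)) \<partial>lborel) = (\<integral>\<^sup>+y. 0 \<partial>(lborel :: (real^'n) measure))" by (rule nn_integral_cong_AE)
    then show ?thesis by simp
  next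
    case False
    then have e0: "0 < ?e" by (simp add: measure_nonneg less_le)
    obtain k where k: "?n = Suc k" "1 \<le> k" using n by (cases "?n") auto
    define r where "r = ?e powr (1 / ?n)"
    have r: "0 < r" "r ^ ?n = ?e"
      using e0 by (auto simp: r_def powr_realpow[symmetric] powr_powr)
    have rp: "?e powr (1 - 1 / ?n) = r ^ k"
    proof -
      have "?e powr (1 - 1 / ?n) = ?e / r" using e0 by (simp add: r_def powr_diff)
      also have "\<dots> = r ^ k" unfolding r(2)[symmetric] k using r by simp
      finally show ?thesis .
    qed
    define s where "s = K * R / r"
    have s: "0 < s" using K R r by (simp add: s_def)
    have "(\<integral>\<^sup>+y\<in>E. ennreal (norm (G y)) \<partial>lborel) \<le>
      (\<integral>\<^sup>+y. ennreal s * indicator E y + (\<integral>\<^sup>+q. (if s \<le> q \<and> q < norm (G y) then 1 else 0) * indicator E y \<partial>lborel) \<partial>lborel)"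
    proof (rule nn_integral_mono)
      fix y
      have "(\<integral>\<^sup>+q. (if s \<le> q \<and> q < norm (G y) then 1 else 0) \<partial>lborel) = (\<integral>\<^sup>+q. indicator {s..<norm (G y)} q \<partial>lborel)"
        by (rule nn_integral_cong) (auto simp: indicator_def)
      also have "\<dots> = ennreal (norm (G y) - s)" by (cases "s \<le> norm (G y)") (simp_all add: ennreal_neg)
      finally have "(\<integral>\<^sup>+q. (if s \<le> q \<and> q < norm (G y) then 1 else 0) \<partial>lborel) = ennreal (norm (G y) - s)" .
      moreover have "ennreal (norm (G y)) \<le> ennreal s + ennreal (norm (G y) - s)"
      proof (cases "s \<le> norm (G y)")
        case True
        then show ?thesis using s by (simp flip: ennreal_plus)
      qed (simp add: ennreal_leI add_increasing2)
      ultimately show "ennreal (norm (G y)) * indicator E y \<le>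
        ennreal s * indicator E y + (\<integral>\<^sup>+q. (if s \<le> q \<and> q < norm (G y) then 1 else 0) * indicator E y \<partial>lborel)"
        by (cases "y \<in> E") auto
    qed
    also have "\<dots> = ennreal s * emeasure lborel E + (\<integral>\<^sup>+y. (\<integral>\<^sup>+q. (if s \<le> q \<and> q < norm (G y) then 1 else 0) * indicator E y \<partial>lborel) \<partial>lborel)"
      by (subst nn_integral_add) (simp_all add: nn_integral_cmult_indicator)
    also have "(\<integral>\<^sup>+y. (\<integral>\<^sup>+q. (if s \<le> q \<and> q < norm (G y) then 1 else 0) * indicator E y \<partial>lborel) \<partial>lborel) =
        (\<integral>\<^sup>+q. (\<integral>\<^sup>+y. (if s \<le> q \<and> q < norm (G y) then 1 else 0) * indicator E y \<partial>lborel) \<partial>lborel)"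
      by (rule lborel_pair.Fubini') measurable
    also have "\<dots> \<le> (\<integral>\<^sup>+q. ennreal ((K * R) ^ ?n) * (ennreal (1 / q ^ Suc k) * indicator {s..} q) \<partial>lborel)"
    proof (rule nn_integral_mono)
      fix q :: real
      show "(\<integral>\<^sup>+y. (if s \<le> q \<and> q < norm (G y) then 1 else 0) * indicator E y \<partial>lborel) \<le>
        ennreal ((K * R) ^ ?n) * (ennreal (1 / q ^ Suc k) * indicator {s..} q)"
      proof (cases "s \<le> q")
        case True
        have "{y\<in>cball 0 R. q < norm (G y)} = cball 0 R \<inter> {y. q < norm (G y)}" by auto
        also have "\<dots> \<in> sets borel" by measurable
        finally have D: "{y\<in>cball 0 R. q < norm (G y)} \<in> sets lborel" by simp
        have "(\<integral>\<^sup>+y. (if s \<le> q \<and> q < norm (G y) then 1 else 0) * indicator E y \<partial>lborel) \<le> (\<integral>\<^sup>+y. indicator {y\<in>cball 0 R. q < norm (G y)} y \<partial>lborel)"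
          using E(2) by (intro nn_integral_mono) (auto simp: indicator_def)
        also have "\<dots> = emeasure lborel {y\<in>cball 0 R. q < norm (G y)}" by (rule nn_integral_indicator[OF D])
        also have "\<dots> \<le> ennreal ((K * R / q) ^ ?n)" using G R s True by (simp add: rough_kernel_def)
        also have "(K * R / q) ^ ?n = (K * R) ^ ?n * (1 / q ^ Suc k)" by (simp add: power_divide k)
        also have "ennreal \<dots> = ennreal ((K * R) ^ ?n) * ennreal (1 / q ^ Suc k)"
          using K R s True by (intro ennreal_mult) auto
        finally show ?thesis using True by simp
      qed simp
    qed
    also have "\<dots> = ennreal ((K * R) ^ ?n) * ennreal (1 / (real k * s ^ k))"
      by (subst nn_integral_cmult) (simp_all add: nn_integral_tail[OF s k(2)] del: power_Suc)
    also have "ennreal s * emeasure lborel E + ennreal ((K * R) ^ ?n) * ennreal (1 / (real k * s ^ k)) =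
        ennreal (s * ?e + (K * R) ^ ?n * (1 / (real k * s ^ k)))"
    proof -
      have nn: "0 \<le> s" "0 \<le> ?e" "0 \<le> (K * R) ^ ?n" "0 \<le> 1 / (real k * s ^ k)" using s K R by auto
      show ?thesis unfolding e by (simp only: ennreal_mult ennreal_plus nn mult_nonneg_nonneg)
    qed
    also have "\<dots> \<le> ennreal (2 * K * R * ?e powr (1 - 1 / ?n))"
    proof (rule ennreal_leI)
      have 1: "s * ?e = K * R * r ^ k" unfolding r(2)[symmetric] s_def using r(1) by (simp add: k)
      have "(K * R) ^ ?n * (1 / s ^ k) = K * R * r ^ k"
        using K R r by (simp add: s_def k power_divide)
      moreover have "(K * R) ^ ?n * (1 / (real k * s ^ k)) \<le> (K * R) ^ ?n * (1 / s ^ k)"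
        using k(2) s K R by (intro mult_left_mono divide_left_mono) auto
      ultimately show "s * ?e + (K * R) ^ ?n * (1 / (real k * s ^ k)) \<le> 2 * K * R * ?e powr (1 - 1 / ?n)"
        unfolding 1 rp by simp
    qed
    finally show ?thesis by (simp add: add_left_mono)
  qed
qed

lemma rough_kernel_ball_integral:
  fixes G :: "real^'n \<Rightarrow> complex"
  assumes G: "rough_kernel G K" and R: "0 < R" and n: "2 \<le> CARD('n)"
  shows "(\<integral>\<^sup>+y\<in>cball 0 R. ennreal (norm (G y)) \<partial>lborel) \<le>
    ennreal (2 * K * ball_vol CARD('n) powr (1 - 1 / CARD('n)) * R ^ CARD('n))"
proof -
  let ?n = "CARD('n)" and ?V = "ball_vol CARD('n)" and ?p = "1 - 1 / real CARD('n)"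
  obtain k where k: "?n = Suc k" using n by (cases "?n") auto
  have "(?V * R ^ ?n) powr ?p = ?V powr ?p * (R ^ ?n) powr ?p" by (rule powr_mult)
  also have "(R ^ ?n) powr ?p = R powr (?n * ?p)"
    using R by (simp add: powr_realpow[symmetric] powr_powr)
  also have "?n * ?p = real k" by (simp add: k field_simps)
  finally have "(?V * R ^ ?n) powr ?p = ?V powr ?p * R ^ k" using R by (simp add: powr_realpow)
  then have eq: "2 * K * R * measure lborel (cball (0::real^'n) R) powr ?p = 2 * K * ?V powr ?p * R ^ ?n"
    using R by (simp add: measure_cball k)
  then show ?thesis
    using rough_kernel_set_integral[OF G borel_closed[OF closed_cball] order_refl R n] by (simp only: eq)
qed

text \<open>Holder's inequality between weak \<open>L\<^sup>n\<close> and the Lorentz space with indices \<open>n'\<close> and \<open>1\<close>: by the layer-cake formula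
for \<open>F\<close> it reduces to indicators.\<close>

lemma rough_holder:
  fixes G :: "real^'n \<Rightarrow> complex" and F :: "real^'n \<Rightarrow> real"
  assumes G: "rough_kernel G K" and F[measurable]: "F \<in> borel_measurable borel" and R: "0 < R" and n: "2 \<le> CARD('n)"
  shows "(\<integral>\<^sup>+y\<in>cball 0 R. ennreal (norm (G y)) * ennreal (F y) \<partial>lborel) \<le>
    ennreal (2 * K * R) * (\<integral>\<^sup>+t\<in>{0<..}. ennreal (measure lborel {y\<in>cball 0 R. t < F y} powr (1 - 1 / CARD('n))) \<partial>lborel)"
proof -
  let ?B = "cball (0::real^'n) R" and ?p = "1 - 1 / real CARD('n)"
  have [measurable]: "G \<in> borel_measurable borel" and K: "0 < K" using G by (auto simp: rough_kernel_def)
  have [measurable]: "?B \<in> sets borel" by simp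
  have "(\<integral>\<^sup>+y\<in>?B. ennreal (norm (G y)) * ennreal (F y) \<partial>lborel) =
      (\<integral>\<^sup>+y. (\<integral>\<^sup>+t. ennreal (norm (G y)) * indicator ?B y * (if 0 < t \<and> t < F y then 1 else 0) \<partial>lborel) \<partial>lborel)"
  proof (rule nn_integral_cong)
    fix y
    have "(\<integral>\<^sup>+t. (if 0 < t \<and> t < F y then 1 else 0) \<partial>lborel) = (\<integral>\<^sup>+t. indicator {0<..<F y} t \<partial>lborel)"
      by (rule nn_integral_cong) (auto simp: indicator_def)
    also have "\<dots> = ennreal (F y)" by (cases "0 \<le> F y") (simp_all add: ennreal_neg)
    finally have "(\<integral>\<^sup>+t. (if 0 < t \<and> t < F y then 1 else 0) \<partial>lborel) = ennreal (F y)" .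
    then show "ennreal (norm (G y)) * ennreal (F y) * indicator ?B y =
      (\<integral>\<^sup>+t. ennreal (norm (G y)) * indicator ?B y * (if 0 < t \<and> t < F y then 1 else 0) \<partial>lborel)"
      by (subst nn_integral_cmult) (auto simp: mult_ac)
  qed
  also have "\<dots> = (\<integral>\<^sup>+t. (\<integral>\<^sup>+y. ennreal (norm (G y)) * indicator ?B y * (if 0 < t \<and> t < F y then 1 else 0) \<partial>lborel) \<partial>lborel)"
    by (rule lborel_pair.Fubini') measurable
  also have "\<dots> \<le> (\<integral>\<^sup>+t\<in>{0<..}. ennreal (2 * K * R * measure lborel {y\<in>?B. t < F y} powr ?p) \<partial>lborel)"
  proof (rule nn_integral_mono)
    fix t :: real
    show "(\<integral>\<^sup>+y. ennreal (norm (G y)) * indicator ?B y * (if 0 < t \<and> t < F y then 1 else 0) \<partial>lborel) \<le>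
      ennreal (2 * K * R * measure lborel {y\<in>?B. t < F y} powr ?p) * indicator {0<..} t"
    proof (cases "0 < t")
      case True
      have "{y\<in>?B. t < F y} = ?B \<inter> {y. t < F y}" by auto
      also have "\<dots> \<in> sets borel" by measurable
      finally have D: "{y\<in>?B. t < F y} \<in> sets borel" .
      have "(\<integral>\<^sup>+y. ennreal (norm (G y)) * indicator ?B y * (if 0 < t \<and> t < F y then 1 else 0) \<partial>lborel) =
          (\<integral>\<^sup>+y\<in>{y\<in>?B. t < F y}. ennreal (norm (G y)) \<partial>lborel)"
        using True by (intro nn_integral_cong) (auto simp: indicator_def)
      also have "\<dots> \<le> ennreal (2 * K * R * measure lborel {y\<in>?B. t < F y} powr ?p)"
        by (rule rough_kernel_set_integral[OF G D _ R n]) auto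
      finally show ?thesis using True by simp
    qed simp
  qed
  also have "\<dots> = (\<integral>\<^sup>+t. ennreal (2 * K * R) * (ennreal (measure lborel {y\<in>?B. t < F y} powr ?p) * indicator {0<..} t) \<partial>lborel)"
    using K R by (intro nn_integral_cong) (simp add: ennreal_mult mult.assoc)
  also have "\<dots> = ennreal (2 * K * R) * (\<integral>\<^sup>+t\<in>{0<..}. ennreal (measure lborel {y\<in>?B. t < F y} powr ?p) \<partial>lborel)"
  proof (rule nn_integral_cmult)
    have "(\<lambda>t. measure lborel {y\<in>?B. t < F y} powr ?p) \<in> borel_measurable borel"
    proof (rule antimono_measurable)
      fix s t :: real assume st: "s \<le> t"
      have D: "{y\<in>?B. t < F y} \<in> sets lborel" for t
      proof -
        have "{y\<in>?B. t < F y} = ?B \<inter> {y. t < F y}" by auto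
        also have "\<dots> \<in> sets borel" by measurable
        finally show ?thesis by simp
      qed
      have "{y\<in>?B. s < F y} \<in> fmeasurable lborel"
        by (rule fmeasurableI2[of ?B]) (use R D in \<open>auto simp: measure_cball intro!: fmeasurableI\<close>)
      then have "measure lborel {y\<in>?B. t < F y} \<le> measure lborel {y\<in>?B. s < F y}"
        using st by (intro measure_mono_fmeasurable D) auto
      then show "measure lborel {y\<in>?B. t < F y} powr ?p \<le> measure lborel {y\<in>?B. s < F y} powr ?p"
        using n by (intro powr_mono2) (auto simp: divide_le_eq)
    qed
    then show "(\<lambda>t. ennreal (measure lborel {y\<in>?B. t < F y} powr ?p) * indicator {0<..} t) \<in> borel_measurable lborel"
      by measurable
  qed
  finally show ?thesis .
qed

text \<open>The estimate through which all operators with a rough kernel are controlled.\<close>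

lemma rough_oscillation:
  fixes G :: "real^'n \<Rightarrow> complex" and f :: "real^'n \<Rightarrow> complex"
  assumes G: "rough_kernel G K" and f: "dominated_gradient f g" and R: "0 < R" and n: "2 \<le> CARD('n)"
  shows "(\<integral>\<^sup>+y\<in>cball 0 R. ennreal (norm (G y)) * ennreal (norm (f (x - y) - ball_mean f x R)) \<partial>lborel) \<le>
    ennreal (2 * K * lorentz_const TYPE('n) * R) * (\<integral>\<^sup>+z\<in>cball x R. ennreal (g z) \<partial>lborel)"
proof -
  let ?m = "ball_mean f x R" and ?p = "1 - 1 / real CARD('n)"
  have K: "0 < K" using G by (auto simp: rough_kernel_def)
  have fc: "continuous_on UNIV f" by (rule dominated_gradient_continuous(1)[OF f])
  have Fm: "(\<lambda>y. norm (f (x - y) - ?m)) \<in> borel_measurable borel"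
    by (intro borel_measurable_continuous_onI continuous_intros continuous_on_compose2[OF fc]) auto
  have refl: "measure lborel {y\<in>cball 0 R. t < norm (f (x - y) - ?m)} = measure lborel {z\<in>cball x R. t < norm (f z - ?m)}" for t
  proof -
    have fm: "continuous_on UNIV (\<lambda>z. f z - ?m)" "continuous_on UNIV (\<lambda>y. f (x - y) - ?m)"
      by (intro continuous_on_diff fc continuous_on_compose2[OF fc] continuous_on_const continuous_on_id; simp)+
    have D: "{z\<in>cball x R. t < norm (f z - ?m)} \<in> sets borel" "{y\<in>cball 0 R. t < norm (f (x - y) - ?m)} \<in> sets borel"
      by (intro level_set_borel fm, simp)+
    have "emeasure lborel {y\<in>cball 0 R. t < norm (f (x - y) - ?m)} =
        (\<integral>\<^sup>+y. indicator {y\<in>cball 0 R. t < norm (f (x - y) - ?m)} y \<partial>lborel)"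
      by (rule nn_integral_indicator[symmetric]) (simp only: sets_lborel D)
    also have "\<dots> = (\<integral>\<^sup>+y. indicator {z\<in>cball x R. t < norm (f z - ?m)} (x - y) \<partial>lborel)"
      by (rule nn_integral_cong) (simp add: indicator_def dist_norm)
    also have "\<dots> = (\<integral>\<^sup>+z. indicator {z\<in>cball x R. t < norm (f z - ?m)} z \<partial>lborel)"
      by (rule nn_integral_reflect) (use D in simp)
    also have "\<dots> = emeasure lborel {z\<in>cball x R. t < norm (f z - ?m)}" using D by simp
    finally show ?thesis by (simp add: measure_def)
  qed
  have "(\<integral>\<^sup>+y\<in>cball 0 R. ennreal (norm (G y)) * ennreal (norm (f (x - y) - ?m)) \<partial>lborel) \<le>
    ennreal (2 * K * R) * (\<integral>\<^sup>+t\<in>{0<..}. ennreal (measure lborel {z\<in>cball x R. t < norm (f z - ?m)} powr ?p) \<partial>lborel)"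
    using rough_holder[OF G Fm R n] unfolding refl .
  also have "\<dots> \<le> ennreal (2 * K * R) * (ennreal (lorentz_const TYPE('n)) * (\<integral>\<^sup>+z\<in>cball x R. ennreal (g z) \<partial>lborel))"
    by (intro mult_left_mono lorentz_poincare f R n) simp
  also have "\<dots> = ennreal (2 * K * lorentz_const TYPE('n) * R) * (\<integral>\<^sup>+z\<in>cball x R. ennreal (g z) \<partial>lborel)"
    using K R lorentz_const_pos[where 'n='n] by (subst ennreal_mult_mult) (auto simp: mult_ac)
  finally show ?thesis .
qed

lemma rough_maximal_riesz:
  fixes \<Omega> G :: "real^'n \<Rightarrow> complex" and f :: "real^'n \<Rightarrow> complex"
  assumes G: "rough_kernel G K" and ae: "AE y in lborel. \<Omega> y = G y"
    and f: "dominated_gradient f g" and M: "vanishes_outside f M" and n: "2 \<le> CARD('n)"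
  shows "rough_maximal \<Omega> f x \<le>
    ennreal (2 * K * lorentz_const TYPE('n) + 4 * mean_const TYPE('n) * K * ball_vol CARD('n) powr (1 - 1 / CARD('n)))
      * riesz (\<lambda>z. ennreal (g z)) x"
  unfolding rough_maximal_def
proof (rule SUP_least)
  fix t :: real assume "t \<in> {0<..}"
  then have t: "0 < t" by simp
  let ?n = "CARD('n)" and ?I = "riesz (\<lambda>z. ennreal (g z)) x" and ?m = "ball_mean f x t" and ?B = "cball (0::real^'n) t"
  let ?VP = "ball_vol CARD('n) powr (1 - 1 / CARD('n))" and ?L = "lorentz_const TYPE('n)" and ?\<kappa> = "mean_const TYPE('n)"
  have [measurable]: "G \<in> borel_measurable borel" and K: "0 < K" using G by (auto simp: rough_kernel_def)
  have [measurable]: "?B \<in> sets borel" by simp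
  have [measurable]: "f \<in> borel_measurable borel" "g \<in> borel_measurable borel"
    using dominated_gradient_continuous[OF f] by (auto intro: borel_measurable_continuous_onI)
  obtain k where k: "?n = Suc k" using n by (cases "?n") auto
  have "(\<integral>\<^sup>+y\<in>ball 0 t. ennreal (norm (\<Omega> y * f (x - y))) \<partial>lebesgue) \<le>
    (\<integral>\<^sup>+y. ennreal (norm (G y)) * ennreal (norm (f (x - y) - ?m)) * indicator ?B y + ennreal (norm ?m) * (ennreal (norm (G y)) * indicator ?B y) \<partial>lborel)"
    unfolding nn_integral_completion
  proof (rule nn_integral_mono_AE, rule AE_mp[OF ae], rule AE_I2, rule impI)
    fix y assume "\<Omega> y = G y"
    have "norm (f (x - y)) \<le> norm (f (x - y) - ?m) + norm ?m"
      using norm_triangle_ineq[of "f (x - y) - ?m" ?m] by simp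
    then have "norm (G y) * norm (f (x - y)) \<le> norm (G y) * (norm (f (x - y) - ?m) + norm ?m)"
      by (rule mult_left_mono) simp
    then have "ennreal (norm (G y * f (x - y))) \<le> ennreal (norm (G y) * norm (f (x - y) - ?m) + norm ?m * norm (G y))"
      by (intro ennreal_leI) (simp add: norm_mult distrib_left mult.commute)
    also have "\<dots> = ennreal (norm (G y)) * ennreal (norm (f (x - y) - ?m)) + ennreal (norm ?m) * ennreal (norm (G y))"
      by (simp add: ennreal_plus ennreal_mult)
    finally show "ennreal (norm (\<Omega> y * f (x - y))) * indicator (ball 0 t) y \<le>
      ennreal (norm (G y)) * ennreal (norm (f (x - y) - ?m)) * indicator ?B y + ennreal (norm ?m) * (ennreal (norm (G y)) * indicator ?B y)"
      unfolding \<open>\<Omega> y = G y\<close> by (auto simp: indicator_def)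
  qed
  also have "\<dots> = (\<integral>\<^sup>+y\<in>?B. ennreal (norm (G y)) * ennreal (norm (f (x - y) - ?m)) \<partial>lborel) +
      ennreal (norm ?m) * (\<integral>\<^sup>+y\<in>?B. ennreal (norm (G y)) \<partial>lborel)"
    by (subst nn_integral_add, measurable) (subst nn_integral_cmult, measurable)
  also have "\<dots> \<le> ennreal (2 * K * ?L * t) * (ennreal (t ^ (?n - 1)) * ?I) + (ennreal (2 * ?\<kappa>) * ?I) * ennreal (2 * K * ?VP * t ^ ?n)"
  proof (intro add_mono mult_mono)
    have "(\<integral>\<^sup>+y\<in>?B. ennreal (norm (G y)) * ennreal (norm (f (x - y) - ?m)) \<partial>lborel) \<le>
      ennreal (2 * K * ?L * t) * (\<integral>\<^sup>+z\<in>cball x t. ennreal (g z) \<partial>lborel)"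
      by (rule rough_oscillation[OF G f t n])
    also have "\<dots> \<le> ennreal (2 * K * ?L * t) * (ennreal (t ^ (?n - 1)) * ?I)"
      by (intro mult_left_mono ball_integral_le_riesz t) auto
    finally show "(\<integral>\<^sup>+y\<in>?B. ennreal (norm (G y)) * ennreal (norm (f (x - y) - ?m)) \<partial>lborel) \<le>
      ennreal (2 * K * ?L * t) * (ennreal (t ^ (?n - 1)) * ?I)" .
    show "ennreal (norm ?m) \<le> ennreal (2 * ?\<kappa>) * ?I" by (rule ball_mean_le_riesz[OF f M t n])
    show "(\<integral>\<^sup>+y\<in>?B. ennreal (norm (G y)) \<partial>lborel) \<le> ennreal (2 * K * ?VP * t ^ ?n)"
      by (rule rough_kernel_ball_integral[OF G t n])
  qed auto
  also have "\<dots> = ennreal (t ^ ?n) * (ennreal (2 * K * ?L + 4 * ?\<kappa> * K * ?VP) * ?I)"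
  proof -
    have 1: "ennreal (2 * K * ?L * t) * (ennreal (t ^ (?n - 1)) * ?I) = ennreal (2 * K * ?L * t ^ ?n) * ?I"
      using K t lorentz_const_pos[where 'n='n] by (subst ennreal_mult_mult) (auto simp: k mult_ac)
    have 2: "(ennreal (2 * ?\<kappa>) * ?I) * ennreal (2 * K * ?VP * t ^ ?n) = ennreal (4 * ?\<kappa> * K * ?VP * t ^ ?n) * ?I"
    proof -
      have "(ennreal (2 * ?\<kappa>) * ?I) * ennreal (2 * K * ?VP * t ^ ?n) = ennreal (2 * ?\<kappa>) * (ennreal (2 * K * ?VP * t ^ ?n) * ?I)"
        by (simp only: mult_ac)
      then show ?thesis using K t mean_const_pos[where 'n='n] by (subst (asm) ennreal_mult_mult) (auto simp: mult_ac)
    qed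
    have 3: "ennreal (t ^ ?n) * (ennreal (2 * K * ?L + 4 * ?\<kappa> * K * ?VP) * ?I) =
        ennreal (2 * K * ?L * t ^ ?n + 4 * ?\<kappa> * K * ?VP * t ^ ?n) * ?I"
      using K t mean_const_pos[where 'n='n] lorentz_const_pos[where 'n='n]
      by (subst ennreal_mult_mult) (auto simp: algebra_simps)
    show ?thesis unfolding 1 2 3
      using K t mean_const_pos[where 'n='n] lorentz_const_pos[where 'n='n] by (subst ennreal_plus) (auto simp: distrib_right)
  qed
  finally have "ennreal (1 / t ^ ?n) * (\<integral>\<^sup>+y\<in>ball 0 t. ennreal (norm (\<Omega> y * f (x - y))) \<partial>lebesgue) \<le>
    ennreal (1 / t ^ ?n) * (ennreal (t ^ ?n) * (ennreal (2 * K * ?L + 4 * ?\<kappa> * K * ?VP) * ?I))"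
    by (rule mult_left_mono) simp
  also have "\<dots> = ennreal (2 * K * ?L + 4 * ?\<kappa> * K * ?VP) * ?I"
    using t by (subst ennreal_mult_mult) auto
  finally show "ennreal (1 / t ^ ?n) * (\<integral>\<^sup>+y\<in>ball 0 t. ennreal (norm (\<Omega> y * f (x - y))) \<partial>lebesgue) \<le>
    ennreal (2 * K * ?L + 4 * ?\<kappa> * K * ?VP) * ?I" .
qed

section \<open>Rough singular integrals\<close>

text \<open>Insert \<open>|y|\<^bsup>-n\<^esup> = \<integral>\<^bsub>|y|\<^esub>\<^bsup>\<infinity>\<^esup> n s\<^bsup>-n-1\<^esup> ds\<close> and interchange the integrals. Cancellation survives, because for each radius
\<open>s\<close> the integral of \<open>H\<close> itself, without the singular weight, remains. If the left-hand integrand is not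
integrable, the Bochner integral has the value \<open>0\<close>.\<close>

lemma radial_average_bound:
  fixes H :: "real^'n \<Rightarrow> complex"
  assumes H[measurable]: "H \<in> borel_measurable borel" and t: "0 < t" and n: "2 \<le> CARD('n)"
  shows "ennreal (norm (LINT y:{y. t < norm y}|lborel. H y / of_real (norm y ^ CARD('n)))) \<le>
    (\<integral>\<^sup>+s\<in>{t..}. ennreal (CARD('n) / s ^ Suc CARD('n)) * ennreal (norm (LINT y:{y. t < norm y \<and> norm y \<le> s}|lborel. H y)) \<partial>lborel)"
proof -
  let ?n = "CARD('n)"
  define A where "A = {y::real^'n. t < norm y}"
  have A[measurable]: "A \<in> sets borel"
    unfolding A_def by (intro borel_open open_Collect_less continuous_intros)
  let ?F = "\<lambda>y. H y / of_real (norm y ^ ?n)"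
  define q where "q r s = (if r \<le> s then real ?n / s ^ Suc ?n else 0)" for r s :: real
  have q0: "0 \<le> q r s" if "0 < r" for r s using that by (simp add: q_def)
  have qm[measurable]: "(\<lambda>p. q (norm (snd p :: real^'n)) (fst p)) \<in> borel_measurable (lborel \<Otimes>\<^sub>M lborel)"
    unfolding q_def by measurable
  have qm1[measurable]: "q r \<in> borel_measurable borel" for r unfolding q_def[abs_def] by measurable
  have qi: "(\<integral>\<^sup>+s. ennreal (q r s) \<partial>lborel) = ennreal (1 / r ^ ?n)" if r: "0 < r" for r
  proof -
    have "(\<integral>\<^sup>+s. ennreal (q r s) \<partial>lborel) = (\<integral>\<^sup>+s. ennreal (real ?n) * (ennreal (1 / s ^ Suc ?n) * indicator {r..} s) \<partial>lborel)"
      using r by (intro nn_integral_cong) (auto simp: q_def indicator_def ennreal_mult[symmetric] simp del: power_Suc)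
    also have "\<dots> = ennreal (real ?n) * ennreal (1 / (real ?n * r ^ ?n))"
      using n r by (subst nn_integral_cmult) (simp_all add: nn_integral_tail del: power_Suc)
    also have "\<dots> = ennreal (1 / r ^ ?n)" using r by (subst ennreal_mult[symmetric]) auto
    finally show ?thesis .
  qed
  show ?thesis
  proof (cases "set_integrable lborel A ?F")
    case False
    then have "(LINT y:A|lborel. ?F y) = 0"
      by (simp add: set_lebesgue_integral_def set_integrable_def not_integrable_integral_eq)
    then show ?thesis by (simp add: A_def)
  next
    case True
    define \<Phi> where "\<Phi> s y = q (norm y) s *\<^sub>R (indicator A y *\<^sub>R H y)" for s and y :: "real^'n"
    have \<Phi>m[measurable]: "case_prod \<Phi> \<in> borel_measurable (lborel \<Otimes>\<^sub>M lborel)"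
      unfolding \<Phi>_def case_prod_beta by measurable
    have ny: "0 < norm y" if "y \<in> A" for y using that t by (auto simp: A_def)
    have int: "integrable (lborel \<Otimes>\<^sub>M lborel) (case_prod \<Phi>)"
    proof (rule integrableI_bounded[OF \<Phi>m])
      have "(\<integral>\<^sup>+p. ennreal (norm (case_prod \<Phi> p)) \<partial>(lborel \<Otimes>\<^sub>M lborel)) = (\<integral>\<^sup>+y. (\<integral>\<^sup>+s. ennreal (norm (\<Phi> s y)) \<partial>lborel) \<partial>lborel)"
        by (subst lborel_pair.nn_integral_snd[symmetric]) (auto simp: case_prod_beta)
      also have "\<dots> = (\<integral>\<^sup>+y. ennreal (norm (indicator A y *\<^sub>R ?F y)) \<partial>lborel)"
      proof (rule nn_integral_cong)
        fix y
        show "(\<integral>\<^sup>+s. ennreal (norm (\<Phi> s y)) \<partial>lborel) = ennreal (norm (indicator A y *\<^sub>R ?F y))"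
        proof (cases "y \<in> A")
          case True
          have "(\<integral>\<^sup>+s. ennreal (norm (\<Phi> s y)) \<partial>lborel) = (\<integral>\<^sup>+s. ennreal (q (norm y) s) * ennreal (norm (H y)) \<partial>lborel)"
            using True q0[OF ny[OF True]] by (intro nn_integral_cong) (simp add: \<Phi>_def ennreal_mult)
          also have "\<dots> = ennreal (1 / norm y ^ ?n) * ennreal (norm (H y))"
            by (subst nn_integral_multc) (simp_all add: qi[OF ny[OF True]])
          also have "\<dots> = ennreal (norm (indicator A y *\<^sub>R ?F y))"
            using True by (simp add: ennreal_mult[symmetric] norm_divide norm_power)
          finally show ?thesis .
        qed (simp add: \<Phi>_def)
      qed
      also have "\<dots> < \<infinity>" using True unfolding set_integrable_def integrable_iff_bounded by blast
      finally show "(\<integral>\<^sup>+p. ennreal (norm (case_prod \<Phi> p)) \<partial>(lborel \<Otimes>\<^sub>M lborel)) < \<infinity>" .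
    qed
    have "(LINT y:A|lborel. ?F y) = (LINT y|lborel. (LINT s|lborel. \<Phi> s y))"
      unfolding set_lebesgue_integral_def
    proof (rule Bochner_Integration.integral_cong[OF refl])
      fix y
      show "indicator A y *\<^sub>R ?F y = (LINT s|lborel. \<Phi> s y)"
      proof (cases "y \<in> A")
        case True
        have "(LINT s|lborel. q (norm y) s) = enn2real (\<integral>\<^sup>+s. ennreal (q (norm y) s) \<partial>lborel)"
          using q0[OF ny[OF True]] by (intro integral_eq_nn_integral) auto
        also have "\<dots> = 1 / norm y ^ ?n" unfolding qi[OF ny[OF True]] by simp
        finally have "(LINT s|lborel. q (norm y) s) = 1 / norm y ^ ?n" .
        then show ?thesis using True by (simp add: \<Phi>_def scaleR_conv_of_real divide_inverse mult.commute)
      qed (simp add: \<Phi>_def)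
    qed
    also have "\<dots> = (LINT s|lborel. (LINT y|lborel. \<Phi> s y))"
      by (rule lborel_pair.Fubini_integral[OF int])
    finally have eq: "(LINT y:A|lborel. ?F y) = (LINT s|lborel. (LINT y|lborel. \<Phi> s y))" .
    have "ennreal (norm (LINT y:A|lborel. ?F y)) \<le> (\<integral>\<^sup>+s. ennreal (norm (LINT y|lborel. \<Phi> s y)) \<partial>lborel)"
      unfolding eq by (rule integral_norm_bound_ennreal) (rule lborel_pair.integrable_fst'[OF int, simplified])
    also have "\<dots> \<le> (\<integral>\<^sup>+s\<in>{t..}. ennreal (?n / s ^ Suc ?n) * ennreal (norm (LINT y:{y. t < norm y \<and> norm y \<le> s}|lborel. H y)) \<partial>lborel)"
    proof (rule nn_integral_mono)
      fix s :: real
      show "ennreal (norm (LINT y|lborel. \<Phi> s y)) \<le>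
        ennreal (?n / s ^ Suc ?n) * ennreal (norm (LINT y:{y. t < norm y \<and> norm y \<le> s}|lborel. H y)) * indicator {t..} s"
      proof (cases "t \<le> s")
        case True
        have "(LINT y|lborel. \<Phi> s y) = (LINT y|lborel. (?n / s ^ Suc ?n) *\<^sub>R (indicator {y. t < norm y \<and> norm y \<le> s} y *\<^sub>R H y))"
          by (rule Bochner_Integration.integral_cong[OF refl]) (auto simp: \<Phi>_def q_def A_def indicator_def)
        also have "\<dots> = (?n / s ^ Suc ?n) *\<^sub>R (LINT y:{y. t < norm y \<and> norm y \<le> s}|lborel. H y)"
          unfolding set_lebesgue_integral_def by (rule integral_scaleR_right)
        finally show ?thesis using True t by (simp add: ennreal_mult[symmetric] del: power_Suc)
      next
        case False
        then have "\<Phi> s y = 0" for y by (auto simp: \<Phi>_def q_def A_def indicator_def)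
        then show ?thesis by simp
      qed
    qed
    finally show ?thesis by (simp only: A_def)
  qed
qed

lemma rough_kernel_integrable_ball:
  fixes G :: "real^'n \<Rightarrow> complex"
  assumes G: "rough_kernel G K" and R: "0 < R" and n: "2 \<le> CARD('n)"
    and b: "b \<in> borel_measurable borel" "\<And>y. norm (b y) \<le> B"
  shows "set_integrable lborel (cball 0 R) (\<lambda>y. G y * b y :: complex)"
  unfolding set_integrable_def
proof (rule integrableI_bounded)
  have [measurable]: "G \<in> borel_measurable borel" using G by (auto simp: rough_kernel_def)
  note b(1)[measurable]
  have [measurable]: "cball (0::real^'n) R \<in> sets borel" by simp
  show "(\<lambda>y. indicator (cball 0 R) y *\<^sub>R (G y * b y)) \<in> borel_measurable lborel" by measurable
  have B: "0 \<le> B" using b(2)[of 0] norm_ge_zero order_trans by blast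
  have "(\<integral>\<^sup>+y. ennreal (norm (indicator (cball 0 R) y *\<^sub>R (G y * b y))) \<partial>lborel) \<le> (\<integral>\<^sup>+y. ennreal B * (ennreal (norm (G y)) * indicator (cball 0 R) y) \<partial>lborel)"
  proof (rule nn_integral_mono)
    fix y
    have "norm (G y) * norm (b y) \<le> norm (G y) * B" by (intro mult_left_mono b) simp
    then show "ennreal (norm (indicator (cball 0 R) y *\<^sub>R (G y * b y))) \<le> ennreal B * (ennreal (norm (G y)) * indicator (cball 0 R) y)"
      using B by (auto simp: indicator_def norm_mult ennreal_mult[symmetric] mult.commute intro: ennreal_leI)
  qed
  also have "\<dots> = ennreal B * (\<integral>\<^sup>+y\<in>cball 0 R. ennreal (norm (G y)) \<partial>lborel)"
    by (rule nn_integral_cmult) measurable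
  also have "\<dots> < \<infinity>"
    using rough_kernel_ball_integral[OF G R n] by (auto simp: ennreal_mult_less_top intro: le_less_trans)
  finally show "(\<integral>\<^sup>+y. ennreal (norm (indicator (cball 0 R) y *\<^sub>R (G y * b y))) \<partial>lborel) < \<infinity>" .
qed

lemma annulus_mean_zero:
  fixes G :: "real^'n \<Rightarrow> complex"
  assumes G: "rough_kernel G K" and zero: "\<And>R. 0 < R \<Longrightarrow> (LINT y:cball 0 R|lborel. G y) = 0"
    and t: "0 < t" "t \<le> s" and n: "2 \<le> CARD('n)"
  shows "(LINT y:{y. t < norm y \<and> norm y \<le> s}|lborel. G y) = 0"
proof -
  have i: "set_integrable lborel (cball 0 R) G" if "0 < R" for R
    using rough_kernel_integrable_ball[OF G that n, of "\<lambda>_. 1" 1] by simp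
  have "(LINT y:{y. t < norm y \<and> norm y \<le> s}|lborel. G y) = (LINT y|lborel. indicator (cball 0 s) y *\<^sub>R G y - indicator (cball 0 t) y *\<^sub>R G y)"
    unfolding set_lebesgue_integral_def
    by (rule Bochner_Integration.integral_cong[OF refl]) (use t in \<open>auto simp: indicator_def\<close>)
  also have "\<dots> = (LINT y:cball 0 s|lborel. G y) - (LINT y:cball 0 t|lborel. G y)"
    unfolding set_lebesgue_integral_def
    by (rule Bochner_Integration.integral_diff) (use i[of s] i[of t] t in \<open>auto simp: set_integrable_def\<close>)
  finally show ?thesis using zero t by simp
qed

lemma vanishes_outside_bounded:
  fixes f :: "real^'n \<Rightarrow> complex"
  assumes f: "continuous_on UNIV f" and M: "vanishes_outside f M"
  obtains B where "\<And>y. norm (f y) \<le> B"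
proof -
  have "compact (f ` cball 0 M)" by (intro compact_continuous_image continuous_on_subset[OF f]) auto
  then obtain B where B: "\<And>z. z \<in> f ` cball 0 M \<Longrightarrow> norm z \<le> B" using compact_imp_bounded bounded_iff by metis
  have "norm (f y) \<le> max B 0" for y
    using B[of "f y"] M by (cases "norm y \<le> M") (auto simp: vanishes_outside_def)
  then show ?thesis using that by blast
qed

text \<open>In the inner integral over \<open>t < |y| \<le> s\<close> the mean of \<open>f\<close> over the ball of radius \<open>s\<close> about \<open>x\<close> can be subtracted
freely, by the mean-zero condition. The oscillation estimate bounds the result by \<open>C s \<integral>\<^bsub>B(x,s)\<^esub> g\<close>, and the
integral of \<open>s \<cdot> s\<^bsup>-n-1\<^esup>\<close> over \<open>s \<ge> |x - z|\<close> is the Riesz kernel. The bound is uniform in \<open>t\<close>, so it serves both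
the maximal operator and the principal value.\<close>

lemma truncated_integral_riesz:
  fixes G f :: "real^'n \<Rightarrow> complex"
  assumes G: "rough_kernel G K" and zero: "\<And>R. 0 < R \<Longrightarrow> (LINT y:cball 0 R|lborel. G y) = 0"
    and f: "dominated_gradient f g" and M: "vanishes_outside f M" and t: "0 < t" and n: "2 \<le> CARD('n)"
  shows "ennreal (norm (LINT y:{y. t < norm y}|lborel. G y / of_real (norm y ^ CARD('n)) * f (x - y))) \<le>
    ennreal (4 * K * lorentz_const TYPE('n) * CARD('n)) * riesz (\<lambda>z. ennreal (g z)) x"
proof -
  let ?n = "CARD('n)" and ?L = "lorentz_const TYPE('n)" and ?I = "riesz (\<lambda>z. ennreal (g z)) x"
  obtain k where k: "?n = Suc k" "1 \<le> k" using n by (cases "?n") auto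
  have [measurable]: "G \<in> borel_measurable borel" and K: "0 < K" using G by (auto simp: rough_kernel_def)
  have fc: "continuous_on UNIV f" by (rule dominated_gradient_continuous(1)[OF f])
  have [measurable]: "f \<in> borel_measurable borel" "g \<in> borel_measurable borel"
    using dominated_gradient_continuous[OF f] by (auto intro: borel_measurable_continuous_onI)
  obtain B where B: "\<And>y. norm (f y) \<le> B" using vanishes_outside_bounded[OF fc M] by blast
  have inner: "ennreal (norm (LINT y:{y. t < norm y \<and> norm y \<le> s}|lborel. G y * f (x - y))) \<le>
      ennreal (2 * K * ?L * s) * (\<integral>\<^sup>+z\<in>cball x s. ennreal (g z) \<partial>lborel)" if s: "t \<le> s" for s
  proof -
    let ?m = "ball_mean f x s" and ?A = "{y::real^'n. t < norm y \<and> norm y \<le> s}"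
    have s0: "0 < s" using s t by simp
    have "?A = {y. t < norm y} \<inter> cball 0 s" by auto
    also have "\<dots> \<in> sets borel" by (intro sets.Int[OF borel_open borel_closed] open_Collect_less continuous_intros) simp
    finally have A: "?A \<in> sets lborel" by simp
    have sub: "?A \<subseteq> cball 0 s" by auto
    have i1: "set_integrable lborel ?A (\<lambda>y. G y * f (x - y))"
      by (rule set_integrable_subset[OF rough_kernel_integrable_ball[OF G s0 n] A sub]) (use B in auto)
    have i2: "set_integrable lborel ?A (\<lambda>y. G y * ?m)"
      by (rule set_integrable_subset[OF rough_kernel_integrable_ball[OF G s0 n, of _ "norm ?m"] A sub]) auto
    have "(LINT y:?A|lborel. G y * (f (x - y) - ?m)) = (LINT y:?A|lborel. G y * f (x - y)) - (LINT y:?A|lborel. G y * ?m)"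
      unfolding right_diff_distrib by (rule set_integral_diff(2)[OF i1 i2])
    also have "(LINT y:?A|lborel. G y * ?m) = 0"
      using annulus_mean_zero[OF G zero t s n] by simp
    finally have "ennreal (norm (LINT y:?A|lborel. G y * f (x - y))) = ennreal (norm (LINT y:?A|lborel. G y * (f (x - y) - ?m)))"
      by simp
    also have "\<dots> \<le> (\<integral>\<^sup>+y. ennreal (norm (indicator ?A y *\<^sub>R (G y * (f (x - y) - ?m)))) \<partial>lborel)"
      unfolding set_lebesgue_integral_def
      by (rule integral_norm_bound_ennreal)
         (use set_integral_diff(1)[OF i1 i2] in \<open>simp add: set_integrable_def right_diff_distrib\<close>)
    also have "\<dots> \<le> (\<integral>\<^sup>+y\<in>cball 0 s. ennreal (norm (G y)) * ennreal (norm (f (x - y) - ?m)) \<partial>lborel)"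
      by (rule nn_integral_mono) (auto simp: indicator_def norm_mult ennreal_mult)
    also have "\<dots> \<le> ennreal (2 * K * ?L * s) * (\<integral>\<^sup>+z\<in>cball x s. ennreal (g z) \<partial>lborel)"
      by (rule rough_oscillation[OF G f s0 n])
    finally show ?thesis .
  qed
  have Hm: "(\<lambda>y. G y * f (x - y)) \<in> borel_measurable borel" by measurable
  have "ennreal (norm (LINT y:{y. t < norm y}|lborel. G y / of_real (norm y ^ ?n) * f (x - y))) =
      ennreal (norm (LINT y:{y. t < norm y}|lborel. (G y * f (x - y)) / of_real (norm y ^ ?n)))"
    by (simp only: times_divide_eq_left)
  also have "\<dots> \<le> (\<integral>\<^sup>+s\<in>{t..}. ennreal (?n / s ^ Suc ?n) * ennreal (norm (LINT y:{y. t < norm y \<and> norm y \<le> s}|lborel. G y * f (x - y))) \<partial>lborel)"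
    by (rule radial_average_bound[OF Hm t n])
  also have "\<dots> \<le> (\<integral>\<^sup>+s. (\<integral>\<^sup>+z. ennreal (2 * K * ?L * ?n) * ennreal (1 / s ^ ?n) * (if 0 < s \<and> norm (x - z) \<le> s then 1 else 0) * ennreal (g z) \<partial>lborel) \<partial>lborel)"
  proof (rule nn_integral_mono)
    fix s :: real
    show "ennreal (?n / s ^ Suc ?n) * ennreal (norm (LINT y:{y. t < norm y \<and> norm y \<le> s}|lborel. G y * f (x - y))) * indicator {t..} s \<le>
      (\<integral>\<^sup>+z. ennreal (2 * K * ?L * ?n) * ennreal (1 / s ^ ?n) * (if 0 < s \<and> norm (x - z) \<le> s then 1 else 0) * ennreal (g z) \<partial>lborel)"
    proof (cases "t \<le> s")
      case True
      then have s: "0 < s" using t by simp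
      have "ennreal (?n / s ^ Suc ?n) * ennreal (norm (LINT y:{y. t < norm y \<and> norm y \<le> s}|lborel. G y * f (x - y))) \<le>
        ennreal (?n / s ^ Suc ?n) * (ennreal (2 * K * ?L * s) * (\<integral>\<^sup>+z\<in>cball x s. ennreal (g z) \<partial>lborel))"
        by (intro mult_left_mono inner True) simp
      also have "\<dots> = ennreal (2 * K * ?L * ?n * (1 / s ^ ?n)) * (\<integral>\<^sup>+z\<in>cball x s. ennreal (g z) \<partial>lborel)"
        using s K lorentz_const_pos[where 'n='n] by (subst ennreal_mult_mult) (auto simp: mult_ac)
      also have "\<dots> = (\<integral>\<^sup>+z. ennreal (2 * K * ?L * ?n * (1 / s ^ ?n)) * (ennreal (g z) * indicator (cball x s) z) \<partial>lborel)"
        by (intro nn_integral_cmult[symmetric] borel_measurable_times_ennreal borel_measurable_indicator) auto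
      also have "\<dots> = (\<integral>\<^sup>+z. ennreal (2 * K * ?L * ?n) * ennreal (1 / s ^ ?n) * (if 0 < s \<and> norm (x - z) \<le> s then 1 else 0) * ennreal (g z) \<partial>lborel)"
      proof (rule nn_integral_cong)
        fix z
        have "ennreal (2 * K * ?L * ?n * (1 / s ^ ?n)) = ennreal (2 * K * ?L * ?n) * ennreal (1 / s ^ ?n)"
          using s K lorentz_const_pos[where 'n='n] by (intro ennreal_mult) auto
        then show "ennreal (2 * K * ?L * ?n * (1 / s ^ ?n)) * (ennreal (g z) * indicator (cball x s) z) =
          ennreal (2 * K * ?L * ?n) * ennreal (1 / s ^ ?n) * (if 0 < s \<and> norm (x - z) \<le> s then 1 else 0) * ennreal (g z)"
          using s by (simp add: indicator_def dist_norm)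
      qed
      finally show ?thesis using True by simp
    qed simp
  qed
  also have "\<dots> = (\<integral>\<^sup>+z. (\<integral>\<^sup>+s. ennreal (2 * K * ?L * ?n) * ennreal (1 / s ^ ?n) * (if 0 < s \<and> norm (x - z) \<le> s then 1 else 0) * ennreal (g z) \<partial>lborel) \<partial>lborel)"
    by (rule lborel_pair.Fubini') measurable
  also have "\<dots> \<le> (\<integral>\<^sup>+z. ennreal (4 * K * ?L * ?n) * (ennreal (g z) * ennreal (1 / norm (x - z) ^ (?n - 1))) \<partial>lborel)"
  proof (rule nn_integral_mono_AE, rule AE_mp[OF AE_lborel_singleton[of x]], rule AE_I2, rule impI)
    fix z :: "real^'n" assume "z \<noteq> x"
    then have z: "0 < norm (x - z)" by simp
    have "(\<integral>\<^sup>+s. ennreal (2 * K * ?L * ?n) * ennreal (1 / s ^ ?n) * (if 0 < s \<and> norm (x - z) \<le> s then 1 else 0) * ennreal (g z) \<partial>lborel) =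
        (\<integral>\<^sup>+s. ennreal (2 * K * ?L * ?n) * (ennreal (1 / s ^ Suc k) * indicator {norm (x - z)..} s) * ennreal (g z) \<partial>lborel)"
      by (rule nn_integral_cong) (use less_le_trans[OF z] in \<open>auto simp: indicator_def k(1)\<close>)
    also have "\<dots> = ennreal (2 * K * ?L * ?n) * ennreal (1 / (real k * norm (x - z) ^ k)) * ennreal (g z)"
      by (subst nn_integral_multc, measurable) (subst nn_integral_cmult, measurable, simp add: nn_integral_tail[OF z k(2)] del: power_Suc)
    also have "\<dots> \<le> ennreal (4 * K * ?L * ?n) * ennreal (1 / norm (x - z) ^ k) * ennreal (g z)"
    proof (rule mult_right_mono[OF mult_mono[OF ennreal_leI ennreal_leI]])
      show "2 * K * ?L * ?n \<le> 4 * K * ?L * ?n" using K lorentz_const_pos[where 'n='n] by simp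
      show "1 / (real k * norm (x - z) ^ k) \<le> 1 / norm (x - z) ^ k"
        using z k(2) by (intro divide_left_mono) auto
    qed auto
    finally show "(\<integral>\<^sup>+s. ennreal (2 * K * ?L * ?n) * ennreal (1 / s ^ ?n) * (if 0 < s \<and> norm (x - z) \<le> s then 1 else 0) * ennreal (g z) \<partial>lborel) \<le>
      ennreal (4 * K * ?L * ?n) * (ennreal (g z) * ennreal (1 / norm (x - z) ^ (?n - 1)))"
      by (simp add: k(1) mult_ac)
  qed
  also have "\<dots> = ennreal (4 * K * ?L * ?n) * ?I"
    unfolding riesz_def by (rule nn_integral_cmult) measurable
  finally show ?thesis .
qed

lemma increment_lipschitz:
  fixes f :: "real^'n \<Rightarrow> 'b::banach"
  assumes f: "dominated_gradient f g"
  obtains L where "0 \<le> L" "\<And>y. norm y \<le> 1 \<Longrightarrow> norm (f (x - y) - f x) \<le> L * norm y"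
proof -
  have "compact (g ` cball x 1)"
    by (intro compact_continuous_image continuous_on_subset[OF dominated_gradient_continuous(2)[OF f]]) auto
  then obtain L where L: "\<And>z. z \<in> g ` cball x 1 \<Longrightarrow> norm z \<le> L" using compact_imp_bounded bounded_iff by metis
  have L0: "0 \<le> L" using L[of "g x"] by (meson centre_in_cball imageI norm_ge_zero order_trans zero_le_one)
  have "norm (f (x - y) - f x) \<le> L * norm y" if y: "norm y \<le> 1" for y
  proof -
    have "ennreal (norm (f (x - y) - f x)) \<le> (\<integral>\<^sup>+s. ennreal (g (x + s *\<^sub>R (- y)) * norm (- y)) * indicator {0..1} s \<partial>lborel)"
      using increment_le_line_integral[OF f, of 0 1 x "- y"] by simp
    also have "\<dots> \<le> (\<integral>\<^sup>+s. ennreal (L * norm y) * indicator {0..1::real} s \<partial>lborel)"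
    proof (rule nn_integral_mono)
      fix s :: real
      show "ennreal (g (x + s *\<^sub>R (- y)) * norm (- y)) * indicator {0..1} s \<le> ennreal (L * norm y) * indicator {0..1} s"
      proof (cases "s \<in> {0..1}")
        case True
        then have "x + s *\<^sub>R (- y) \<in> cball x 1" using y by (auto simp: dist_norm mult_le_one)
        then have "g (x + s *\<^sub>R (- y)) \<le> L" using L[of "g (x + s *\<^sub>R (- y))"] by auto
        then show ?thesis using True by (simp add: ennreal_leI mult_right_mono)
      qed simp
    qed
    also have "\<dots> = ennreal (L * norm y)" by (subst nn_integral_cmult_indicator) auto
    finally show ?thesis using L0 by simp
  qed
  then show ?thesis using that L0 by blast
qed

text \<open>Since the kernel has mean zero on annuli, subtracting \<open>f(x)\<close> inside the unit ball does not change the truncated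
integrals for \<open>t < 1\<close>. The new integrand \<open>h\<close> is absolutely integrable: near the origin the Lipschitz bound leaves
\<open>|\<Omega>(y)| |y|\<^bsup>1-n\<^esup>\<close>.\<close>

lemma truncated_integral_converges:
  fixes G f :: "real^'n \<Rightarrow> complex"
  assumes G: "rough_kernel G K" and zero: "\<And>R. 0 < R \<Longrightarrow> (LINT y:cball 0 R|lborel. G y) = 0"
    and f: "dominated_gradient f g" and M: "vanishes_outside f M" and n: "2 \<le> CARD('n)"
  shows "\<exists>l. ((\<lambda>t. LINT y:{y. t < norm y}|lborel. G y / of_real (norm y ^ CARD('n)) * f (x - y)) \<longlongrightarrow> l) (at_right 0)"
proof -
  let ?n = "CARD('n)" and ?B = "cball (0::real^'n) 1"
  have Gm[measurable]: "G \<in> borel_measurable borel" and K: "0 < K" using G by (auto simp: rough_kernel_def)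
  have fc: "continuous_on UNIV f" by (rule dominated_gradient_continuous(1)[OF f])
  have [measurable]: "f \<in> borel_measurable borel"
    using dominated_gradient_continuous[OF f] by (auto intro: borel_measurable_continuous_onI)
  have [measurable]: "?B \<in> sets borel" by simp
  obtain B where B: "\<And>y. norm (f y) \<le> B" using vanishes_outside_bounded[OF fc M] by blast
  have B0: "0 \<le> B" using B[of 0] norm_ge_zero order_trans by blast
  obtain L where L: "0 \<le> L" "\<And>y. norm y \<le> 1 \<Longrightarrow> norm (f (x - y) - f x) \<le> L * norm y"
    using increment_lipschitz[OF f] by blast
  have M0: "0 < M" and f0: "\<And>y. M < norm y \<Longrightarrow> f y = 0" using M by (auto simp: vanishes_outside_def)
  define R where "R = M + norm x"
  have R: "0 < R" using M0 by (simp add: R_def add_pos_nonneg)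
  \<comment> \<open>\<open>f\<close> vanishes at \<open>x - y\<close> for \<open>|y| > R\<close>, so \<open>h\<close> is supported in a bounded set.\<close>
  define h where "h y = G y / of_real (norm y ^ ?n) * (f (x - y) - indicator ?B y *\<^sub>R f x)" for y
  have hm[measurable]: "h \<in> borel_measurable borel" unfolding h_def[abs_def] by measurable
  define c where "c = 2 * K * ball_vol CARD('n) powr (1 - 1 / CARD('n))"
  have c: "0 \<le> c" using K by (simp add: c_def)
  have growth: "(\<integral>\<^sup>+y\<in>cball 0 r. ennreal (norm (G y)) \<partial>lborel) \<le> ennreal (c * r ^ ?n)" if "0 < r" for r
    unfolding c_def by (rule rough_kernel_ball_integral[OF G that n])
  have hint: "integrable lborel h"
  proof (rule integrableI_bounded)
    have "(\<integral>\<^sup>+y. ennreal (norm (h y)) \<partial>lborel) \<le>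
      (\<integral>\<^sup>+y. ennreal L * (ennreal (norm (G y)) * ennreal (1 / norm y ^ (?n - 1)) * indicator (ball 0 2) y)
         + ennreal B * (ennreal (norm (G y)) * indicator (cball 0 R) y) \<partial>lborel)"
    proof (rule nn_integral_mono)
      fix y :: "real^'n"
      let ?N1 = "ennreal L * (ennreal (norm (G y)) * ennreal (1 / norm y ^ (?n - 1)) * indicator (ball 0 2) y)"
      let ?N2 = "ennreal B * (ennreal (norm (G y)) * indicator (cball 0 R) y)"
      have nh: "norm (h y) = norm (G y) / norm y ^ ?n * norm (f (x - y) - indicator ?B y *\<^sub>R f x)"
        by (simp add: h_def norm_mult norm_divide norm_power)
      show "ennreal (norm (h y)) \<le> ?N1 + ?N2"
      proof (cases "norm y \<le> 1")
        case True
        obtain k where k: "?n = Suc k" using n by (cases "?n") auto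
        have "norm (h y) \<le> norm (G y) / norm y ^ ?n * (L * norm y)"
          unfolding nh using True L(2)[OF True] by (intro mult_left_mono) auto
        also have "\<dots> = L * (norm (G y) * (1 / norm y ^ (?n - 1)))"
          unfolding k using n k by (cases "y = 0") auto
        finally have "ennreal (norm (h y)) \<le> ennreal (L * (norm (G y) * (1 / norm y ^ (?n - 1))))" by (rule ennreal_leI)
        also have "\<dots> = ?N1" using True L(1) by (simp add: ennreal_mult[symmetric])
        finally show ?thesis by (rule order_trans) simp
      next
        case False
        then have y1: "1 < norm y" by simp
        show ?thesis
        proof (cases "norm y \<le> R")
          case True
          have "norm (h y) = norm (G y) / norm y ^ ?n * norm (f (x - y))" using y1 by (simp add: nh)
          also have "\<dots> \<le> norm (G y) * B"
          proof (rule mult_mono[OF _ B])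
            have "norm (G y) * 1 \<le> norm (G y) * norm y ^ ?n" using y1 by (intro mult_left_mono one_le_power) auto
            then show "norm (G y) / norm y ^ ?n \<le> norm (G y)" using y1 by (simp add: divide_le_eq)
          qed (use y1 in auto)
          finally have "ennreal (norm (h y)) \<le> ennreal (norm (G y) * B)" by (rule ennreal_leI)
          also have "\<dots> = ?N2" using True B0 by (simp add: ennreal_mult mult.commute)
          finally show ?thesis by (rule order_trans) simp
        next
          case False
          have "norm y \<le> norm (x - y) + norm x" by (metis norm_minus_commute norm_triangle_sub add.commute)
          then have "f (x - y) = 0" using False by (intro f0) (simp add: R_def)
          then show ?thesis using y1 by (simp add: nh)
        qed
      qed
    qed
    also have "\<dots> = ennreal L * (\<integral>\<^sup>+y\<in>ball 0 2. ennreal (norm (G y)) * ennreal (1 / norm y ^ (?n - 1)) \<partial>lborel)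
        + ennreal B * (\<integral>\<^sup>+y\<in>cball 0 R. ennreal (norm (G y)) \<partial>lborel)"
    proof -
      have b[measurable]: "ball (0::real^'n) 2 \<in> sets borel" "cball (0::real^'n) R \<in> sets borel" by auto
      show ?thesis by (subst nn_integral_add, measurable) (subst nn_integral_cmult, measurable, subst nn_integral_cmult, measurable)
    qed
    also have "\<dots> < \<infinity>"
    proof -
      have "(\<integral>\<^sup>+y\<in>ball 0 2. ennreal (norm (G y)) * ennreal (1 / norm y ^ (?n - 1)) \<partial>lebesgue) \<le> ennreal (2 ^ ?n * c * 2)"
      proof (rule singular_integral_ball[OF _ _ c n])
        show "(\<lambda>y. ennreal (norm (G y))) \<in> borel_measurable lebesgue"
          by (rule borel_lebesgue) measurable
        fix r :: real assume r: "0 < r"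
        have "(\<integral>\<^sup>+z\<in>ball 0 r. ennreal (norm (G z)) \<partial>lebesgue) \<le> (\<integral>\<^sup>+y\<in>cball 0 r. ennreal (norm (G y)) \<partial>lborel)"
          unfolding nn_integral_completion by (rule nn_integral_mono) (auto simp: indicator_def)
        also have "\<dots> \<le> ennreal (c * r ^ ?n)" by (rule growth[OF r])
        finally show "(\<integral>\<^sup>+z\<in>ball 0 r. ennreal (norm (G z)) \<partial>lebesgue) \<le> ennreal (c * r ^ ?n)" .
      qed simp
      then have "(\<integral>\<^sup>+y\<in>ball 0 2. ennreal (norm (G y)) * ennreal (1 / norm y ^ (?n - 1)) \<partial>lborel) < top"
        unfolding nn_integral_completion by (rule le_less_trans) simp
      moreover have "(\<integral>\<^sup>+y\<in>cball 0 R. ennreal (norm (G y)) \<partial>lborel) < top"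
        using growth[OF R] by (rule le_less_trans) simp
      ultimately show ?thesis by (simp add: ennreal_mult_less_top)
    qed
    finally show "(\<integral>\<^sup>+y. ennreal (norm (h y)) \<partial>lborel) < \<infinity>" .
  qed simp
  have trunc: "(LINT y:{y. t < norm y}|lborel. G y / of_real (norm y ^ ?n) * f (x - y)) = (LINT y:{y. t < norm y}|lborel. h y)"
    if t: "0 < t" "t < 1" for t
  proof -
    let ?A = "{y::real^'n. t < norm y}"
    have A[measurable]: "?A \<in> sets borel" by (intro borel_open open_Collect_less continuous_intros)
    let ?F = "\<lambda>y. G y * indicator ?B y / of_real (norm y ^ ?n)"
    have Fm: "(\<lambda>y. G y * indicator ?B y) \<in> borel_measurable borel" by measurable
    have "(LINT y:{y. t < norm y \<and> norm y \<le> s}|lborel. G y * indicator ?B y) = 0" if s: "t \<le> s" for s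
    proof -
      have "(LINT y:{y. t < norm y \<and> norm y \<le> s}|lborel. G y * indicator ?B y) = (LINT y:{y. t < norm y \<and> norm y \<le> min s 1}|lborel. G y)"
        unfolding set_lebesgue_integral_def
        by (rule Bochner_Integration.integral_cong[OF refl]) (auto simp: indicator_def)
      also have "\<dots> = 0" by (rule annulus_mean_zero[OF G zero t(1) _ n]) (use s t in auto)
      finally show ?thesis .
    qed
    then have "ennreal (norm (LINT y:?A|lborel. ?F y)) \<le> (\<integral>\<^sup>+s. 0 \<partial>(lborel :: real measure))"
      by (intro order_trans[OF radial_average_bound[OF Fm t(1) n]] nn_integral_mono) (auto simp: indicator_def)
    then have F0: "(LINT y:?A|lborel. ?F y) = 0" by simp
    have Fi: "set_integrable lborel ?A ?F"
      unfolding set_integrable_def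
    proof (rule Bochner_Integration.integrable_bound)
      show "integrable lborel (\<lambda>y. (1 / t ^ ?n) *\<^sub>R (indicator ?B y *\<^sub>R G y))"
        using rough_kernel_integrable_ball[OF G zero_less_one n, of "\<lambda>_. 1" 1]
        by (intro integrable_scaleR_right) (simp add: set_integrable_def)
      show "(\<lambda>y. indicator ?A y *\<^sub>R ?F y) \<in> borel_measurable lborel" by measurable
      show "AE y in lborel. norm (indicator ?A y *\<^sub>R ?F y) \<le> norm ((1 / t ^ ?n) *\<^sub>R (indicator ?B y *\<^sub>R G y))"
      proof (rule AE_I2)
        fix y :: "real^'n"
        show "norm (indicator ?A y *\<^sub>R ?F y) \<le> norm ((1 / t ^ ?n) *\<^sub>R (indicator ?B y *\<^sub>R G y))"
        proof (cases "y \<in> ?A \<and> y \<in> ?B")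
          case True
          then have "norm (G y) / norm y ^ ?n \<le> norm (G y) / t ^ ?n"
            using t by (intro divide_left_mono power_mono mult_pos_pos zero_less_power) (auto intro: less_trans)
          then show ?thesis using True t by (simp add: norm_divide norm_power)
        qed auto
      qed
    qed
    have hi: "set_integrable lborel ?A h"
      unfolding set_integrable_def by (intro integrable_mult_indicator hint) simp
    have Fi': "set_integrable lborel ?A (\<lambda>y. ?F y * f x)" by (rule set_integrable_mult_left) (rule Fi)
    have "(LINT y:?A|lborel. G y / of_real (norm y ^ ?n) * f (x - y)) = (LINT y:?A|lborel. h y + ?F y * f x)"
    proof -
      have "G y / of_real (norm y ^ ?n) * f (x - y) = h y + ?F y * f x" for y
        by (simp add: h_def indicator_def right_diff_distrib)
      then show ?thesis by simp
    qed
    also have "\<dots> = (LINT y:?A|lborel. h y) + (LINT y:?A|lborel. ?F y * f x)"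
      by (rule set_integral_add(2)[OF hi Fi'])
    also have "(LINT y:?A|lborel. ?F y * f x) = 0" by (simp only: set_integral_mult_left F0 mult_zero_left)
    finally show ?thesis by simp
  qed
  have "((\<lambda>t. LINT y|lborel. indicator {y. inverse t < norm y} y *\<^sub>R h y) \<longlongrightarrow> (LINT y|lborel. h y)) at_top"
  proof (rule integral_dominated_convergence_at_top[where w = "\<lambda>y. norm (h y)"])
    show "(\<lambda>y. indicator {y. inverse t < norm y} y *\<^sub>R h y) \<in> borel_measurable lborel" for t :: real
    proof -
      have [measurable]: "{y::real^'n. inverse t < norm y} \<in> sets borel" by (intro borel_open open_Collect_less continuous_intros)
      show ?thesis by measurable
    qed
    show "AE y in lborel. ((\<lambda>t. indicator {y. inverse t < norm y} y *\<^sub>R h y) \<longlongrightarrow> h y) at_top"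
    proof (rule AE_mp[OF AE_lborel_singleton[of "0::real^'n"]], rule AE_I2, rule impI)
      fix y :: "real^'n" assume y: "y \<noteq> 0"
      have "\<forall>\<^sub>F t in at_top. inverse t < norm y"
        using order_tendstoD(2)[OF tendsto_inverse_0_at_top[OF filterlim_ident], of "norm y"] y by simp
      then have "\<forall>\<^sub>F t in at_top. indicator {y. inverse t < norm y} y *\<^sub>R h y = h y"
        by eventually_elim simp
      then show "((\<lambda>t. indicator {y. inverse t < norm y} y *\<^sub>R h y) \<longlongrightarrow> h y) at_top" by (rule tendsto_eventually)
    qed
    show "\<forall>\<^sub>F t in at_top. AE y in lborel. norm (indicator {y. inverse t < norm y} y *\<^sub>R h y) \<le> norm (h y)"
      by (intro always_eventually allI AE_I2) (simp add: indicator_def)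
  qed (use hint in auto)
  then have "((\<lambda>t. LINT y|lborel. indicator {y. t < norm y} y *\<^sub>R h y) \<longlongrightarrow> (LINT y|lborel. h y)) (at_right 0)"
    unfolding filterlim_at_right_to_top .
  moreover have "\<forall>\<^sub>F t in at_right 0. (LINT y|lborel. indicator {y. t < norm y} y *\<^sub>R h y) =
      (LINT y:{y. t < norm y}|lborel. G y / of_real (norm y ^ ?n) * f (x - y))"
    unfolding eventually_at_right_field by (intro exI[of _ 1]) (use trunc in \<open>auto simp: set_lebesgue_integral_def\<close>)
  ultimately have "((\<lambda>t. LINT y:{y. t < norm y}|lborel. G y / of_real (norm y ^ ?n) * f (x - y)) \<longlongrightarrow> (LINT y|lborel. h y)) (at_right 0)"
    by (rule Lim_transform_eventually)
  then show ?thesis by blast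
qed

lemma truncated_rough_integral_eq:
  fixes \<Omega> G f :: "real^'n \<Rightarrow> complex"
  assumes G: "G \<in> borel_measurable borel" and ae: "AE y in lborel. \<Omega> y = G y" and f: "f \<in> borel_measurable borel"
  shows "truncated_rough_integral \<Omega> t f x = (LINT y:{y. t < norm y}|lborel. G y / of_real (norm y ^ CARD('n)) * f (x - y))"
proof -
  note [measurable] = G f
  have A[measurable]: "{y::real^'n. t < norm y} \<in> sets borel" by (intro borel_open open_Collect_less continuous_intros)
  let ?F = "\<lambda>W y. indicator {y. t < norm y} y *\<^sub>R (W y / of_real (norm y ^ CARD('n)) * f (x - y))"
  have GF: "?F G \<in> borel_measurable borel" by measurable
  have ae': "AE y in lebesgue. ?F \<Omega> y = ?F G y"
    by (rule AE_completion) (use ae in \<open>eventually_elim, simp\<close>)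
  have "(LINT y|lebesgue. ?F \<Omega> y) = (LINT y|lebesgue. ?F G y)"
  proof (rule integral_cong_AE[OF _ borel_lebesgue[OF GF] ae'])
    show "?F \<Omega> \<in> borel_measurable lebesgue"
      by (rule borel_measurable_AE[OF borel_lebesgue[OF GF]]) (rule eventually_mono[OF ae'], rule sym)
  qed
  also have "\<dots> = (LINT y|lborel. ?F G y)"
    by (rule integral_completion) (use GF in simp)
  finally show ?thesis
    unfolding truncated_rough_integral_def set_lebesgue_integral_def .
qed

section \<open>The weighted Sobolev inequality\<close>

text \<open>The derivative in direction \<open>h\<close> is \<open>\<Sum>\<^sub>i h\<^sub>i \<partial>\<^sub>i f\<close>, bounded by the Cauchy-Schwarz inequality.\<close>

lemma test_function_dominated:
  fixes f :: "real^'n \<Rightarrow> complex"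
  assumes "test_function f"
  shows "dominated_gradient f (\<lambda>x. norm (gradient f x))" and "\<exists>M. vanishes_outside f M"
proof -
  have "C_k (Suc 0) f" using assms unfolding test_function_def by blast
  then have d: "\<And>x. f differentiable (at x)" and c: "\<And>i. continuous_on UNIV (partial i f)" by auto
  show "dominated_gradient f (\<lambda>x. norm (gradient f x))"
    unfolding dominated_gradient_def
  proof (intro conjI allI)
    show "continuous_on UNIV (\<lambda>x. norm (gradient f x))"
      unfolding gradient_def by (intro continuous_on_norm continuous_on_vec_lambda c)
    fix x
    let ?f' = "frechet_derivative f (at x)"
    have f': "(f has_derivative ?f') (at x)" using d frechet_derivative_works by blast
    have "norm (?f' h) \<le> norm (gradient f x) * norm h" for h
    proof -
      have "h = (\<Sum>i\<in>UNIV. h$i *\<^sub>R axis i 1)"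
        using basis_expansion[of h] by (simp add: scalar_mult_eq_scaleR)
      then have "?f' h = (\<Sum>i\<in>UNIV. ?f' (h$i *\<^sub>R axis i 1))"
        using linear_sum[OF has_derivative_linear[OF f'], of "\<lambda>i. h$i *\<^sub>R axis i 1" UNIV] by simp
      also have "\<dots> = (\<Sum>i\<in>UNIV. h$i *\<^sub>R partial i f x)"
        by (intro sum.cong refl) (simp add: linear_cmul[OF has_derivative_linear[OF f']] partial_def)
      finally have "norm (?f' h) \<le> (\<Sum>i\<in>UNIV. norm (h$i *\<^sub>R partial i f x))"
        by (simp only: norm_sum)
      also have "\<dots> = (\<Sum>i\<in>UNIV. \<bar>norm (partial i f x)\<bar> * \<bar>norm (h$i)\<bar>)"
        by (simp add: mult.commute)
      also have "\<dots> \<le> L2_set (\<lambda>i. norm (partial i f x)) UNIV * L2_set (\<lambda>i. norm (h$i)) UNIV"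
        by (rule L2_set_mult_ineq)
      also have "\<dots> = norm (gradient f x) * norm h" by (simp add: norm_vec_def gradient_def)
      finally show ?thesis .
    qed
    then show "\<exists>u'. (f has_derivative u') (at x) \<and> (\<forall>h. norm (u' h) \<le> norm (gradient f x) * norm h)"
      using f' by blast
  qed
  have "bounded (closure {x. f x \<noteq> 0})" using assms by (simp add: test_function_def compact_imp_bounded)
  then obtain M where "\<forall>x \<in> closure {x. f x \<noteq> 0}. norm x \<le> M" unfolding bounded_iff ..
  then have M: "\<And>x. x \<in> closure {x. f x \<noteq> 0} \<Longrightarrow> norm x \<le> M" by (rule bspec)
  have "f y = 0" if "max M 1 < norm y" for y
  proof (rule ccontr)
    assume "f y \<noteq> 0"
    then have "y \<in> closure {x. f x \<noteq> 0}" by (intro subsetD[OF closure_subset]) simp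
    from M[OF this] that show False by simp
  qed
  then have "vanishes_outside f (max M 1)" by (simp add: vanishes_outside_def)
  then show "\<exists>M. vanishes_outside f M" by blast
qed

text \<open>The common property of the listed operators from which the theorem follows.\<close>

definition riesz_controlled :: "((real^'n \<Rightarrow> complex) \<Rightarrow> real^'n \<Rightarrow> ennreal) \<Rightarrow> bool" where
  "riesz_controlled T \<longleftrightarrow> (\<exists>c. \<forall>f g M x. dominated_gradient f g \<longrightarrow> vanishes_outside f M \<longrightarrow>
     T f x \<le> ennreal c * riesz (\<lambda>z. ennreal (g z)) x)"

lemma rough_operators_controlled:
  fixes \<Omega> :: "real^'n \<Rightarrow> complex"
  assumes n: "2 \<le> CARD('n)" and hom: "homogeneous_deg_0 \<Omega>" and weak: "in_weak_Ln_sphere \<Omega>"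
  shows "riesz_controlled (rough_maximal \<Omega>)"
    and "mean_zero_sphere \<Omega> \<Longrightarrow> riesz_controlled (\<lambda>f x. ennreal (norm (rough_singular_integral \<Omega> f x)))"
    and "mean_zero_sphere \<Omega> \<Longrightarrow> riesz_controlled (maximal_rough_singular_integral \<Omega>)"
proof -
  have "\<Omega> \<in> borel_measurable sphere_measure" using weak by (simp add: in_weak_Ln_sphere_def)
  then obtain G where G: "G \<in> borel_measurable borel" "homogeneous_deg_0 G"
    and ae: "AE y in lborel. \<Omega> y = G y" and ae\<sigma>: "AE y in sphere_measure. \<Omega> y = G y"
    using sphere_function_regular[OF hom] by blast
  obtain K where K: "rough_kernel G K" using weak_sphere_bound[OF weak G ae\<sigma>] by blast
  show "riesz_controlled (rough_maximal \<Omega>)"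
    unfolding riesz_controlled_def using rough_maximal_riesz[OF K ae _ _ n] by blast
  let ?c = "4 * K * lorentz_const TYPE('n) * CARD('n)"
  assume mean: "mean_zero_sphere \<Omega>"
  note zero = mean_zero_ball[OF mean G ae\<sigma>]
  have trunc: "ennreal (norm (truncated_rough_integral \<Omega> t f x)) \<le> ennreal ?c * riesz (\<lambda>z. ennreal (g z)) x"
    if f: "dominated_gradient f g" and M: "vanishes_outside f M" and t: "0 < t" for f g M t x
  proof -
    have fm: "f \<in> borel_measurable borel"
      using dominated_gradient_continuous(1)[OF f] by (rule borel_measurable_continuous_onI)
    show ?thesis
      unfolding truncated_rough_integral_eq[OF G(1) ae fm] by (rule truncated_integral_riesz[OF K zero f M t n])
  qed
  show "riesz_controlled (maximal_rough_singular_integral \<Omega>)"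
    unfolding riesz_controlled_def maximal_rough_singular_integral_def
    using trunc by (intro exI[of _ ?c] allI impI SUP_least) auto
  have "ennreal (norm (rough_singular_integral \<Omega> f x)) \<le> ennreal ?c * riesz (\<lambda>z. ennreal (g z)) x"
    if f: "dominated_gradient f g" and M: "vanishes_outside f M" for f g M x
  proof -
    have fm: "f \<in> borel_measurable borel"
      using dominated_gradient_continuous(1)[OF f] by (rule borel_measurable_continuous_onI)
    obtain l where l: "((\<lambda>t. truncated_rough_integral \<Omega> t f x) \<longlongrightarrow> l) (at_right 0)"
      using truncated_integral_converges[OF K zero f M n] unfolding truncated_rough_integral_eq[OF G(1) ae fm] by blast
    then have "rough_singular_integral \<Omega> f x = l"
      unfolding rough_singular_integral_def by (intro tendsto_Lim) (auto simp: trivial_limit_at_right_real)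
    moreover have "ennreal (norm l) \<le> ennreal ?c * riesz (\<lambda>z. ennreal (g z)) x"
    proof (rule tendsto_upperbound)
      show "((\<lambda>t. ennreal (norm (truncated_rough_integral \<Omega> t f x))) \<longlongrightarrow> ennreal (norm l)) (at_right 0)"
        by (intro tendsto_ennrealI tendsto_norm l)
      show "\<forall>\<^sub>F t in at_right 0. ennreal (norm (truncated_rough_integral \<Omega> t f x)) \<le> ennreal ?c * riesz (\<lambda>z. ennreal (g z)) x"
        using eventually_at_right_less[of "0::real"] by eventually_elim (rule trunc[OF f M])
    qed (simp add: trivial_limit_at_right_real)
    ultimately show ?thesis by simp
  qed
  then show "riesz_controlled (\<lambda>f x. ennreal (norm (rough_singular_integral \<Omega> f x)))"
    unfolding riesz_controlled_def by blast
qed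

lemma listed_operator_controlled:
  fixes T :: "(real^'n \<Rightarrow> complex) \<Rightarrow> real^'n \<Rightarrow> ennreal"
  assumes n: "2 \<le> CARD('n)" and T: "listed_operator T"
  shows "riesz_controlled T"
  using T
proof cases
  case hardy_littlewood
  have "T f x = iterated_maximal 1 f x" for f x by (simp add: hardy_littlewood iterated_maximal_def)
  then show ?thesis unfolding riesz_controlled_def using iterated_maximal_riesz[OF _ _ n, where k = 1] by metis
next
  case (iterated k)
  then show ?thesis unfolding riesz_controlled_def using iterated_maximal_riesz[OF _ _ n, where k = k] by blast
next
  case lorentz
  then show ?thesis unfolding riesz_controlled_def using lorentz_maximal_riesz[OF _ _ n] by blast
next
  case spherical
  have "T f x \<le> ennreal 1 * riesz (\<lambda>z. ennreal (g z)) x" if "dominated_gradient f g" "vanishes_outside f M" for f g M x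
    using spherical_maximal_riesz[OF that n] by (simp add: spherical)
  then show ?thesis unfolding riesz_controlled_def by blast
next
  case (rough_max \<Omega>)
  then show ?thesis using rough_operators_controlled(1)[OF n] by simp
next
  case (rough_singular \<Omega>)
  then show ?thesis using rough_operators_controlled(2)[OF n] by simp
next
  case (rough_singular_max \<Omega>)
  then show ?thesis using rough_operators_controlled(3)[OF n] by simp
qed

theorem corollary5p3:
  fixes T :: "(real^'n \<Rightarrow> complex) \<Rightarrow> real^'n \<Rightarrow> ennreal"
    and w :: "real^'n \<Rightarrow> real"
    and \<epsilon> :: real
  assumes "2 \<le> CARD('n)"
    and "listed_operator T"
    and "weight w"
    and "0 < \<epsilon>"
  shows "\<exists>C>0. \<forall>f. test_function f \<longrightarrow>
    weak_L1_norm w (T f) \<le> ennreal C *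
      (\<integral>\<^sup>+x. ennreal (norm (gradient f x)) *
         frac_maximal_1 (orlicz_maximal (LlogL_young \<epsilon>) w) x \<partial>lebesgue)"
proof -
  obtain c0 where c0: "\<And>f g M x. dominated_gradient f g \<Longrightarrow> vanishes_outside f M \<Longrightarrow>
      T f x \<le> ennreal c0 * riesz (\<lambda>z. ennreal (g z)) x"
    using listed_operator_controlled[OF assms(1,2)] unfolding riesz_controlled_def by blast
  define c where "c = max c0 1"
  have c: "0 < c" "ennreal c0 \<le> ennreal c" by (auto simp: c_def intro: ennreal_leI)
  let ?W = "frac_maximal_1 (orlicz_maximal (LlogL_young \<epsilon>) w)"
  obtain C where C: "0 < C" and weak: "\<And>g t. g \<in> borel_measurable borel \<Longrightarrow> 0 < t \<Longrightarrow>
      ennreal t * (\<integral>\<^sup>+x\<in>{x. ennreal t < riesz g x}. ennreal (w x) \<partial>lebesgue) \<le> ennreal C * (\<integral>\<^sup>+x. g x * ?W x \<partial>lebesgue)"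
    using riesz_weak_type[OF assms(1,3,4)] by blast
  have "weak_L1_norm w (T f) \<le> ennreal (c * C) * (\<integral>\<^sup>+x. ennreal (norm (gradient f x)) * ?W x \<partial>lebesgue)"
    if f: "test_function f" for f
    unfolding weak_L1_norm_def
  proof (rule SUP_least)
    fix t :: real assume "t \<in> {0<..}"
    then have t: "0 < t" by simp
    let ?g = "\<lambda>x. ennreal (norm (gradient f x))" and ?I = "\<integral>\<^sup>+x. ennreal (norm (gradient f x)) * ?W x \<partial>lebesgue"
    note dom = test_function_dominated(1)[OF f]
    obtain M where M: "vanishes_outside f M" using test_function_dominated(2)[OF f] by blast
    have "(\<lambda>x. norm (gradient f x)) \<in> borel_measurable borel"
      using dominated_gradient_continuous(2)[OF dom] by (rule borel_measurable_continuous_onI)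
    then have gm: "?g \<in> borel_measurable borel" by measurable
    have "ennreal (t / c) < riesz ?g x" if x: "ennreal t < T f x" for x
    proof -
      have "ennreal c * ennreal (t / c) = ennreal t" using c t by (simp add: ennreal_mult[symmetric])
      also have "\<dots> < T f x" by fact
      also have "\<dots> \<le> ennreal c0 * riesz ?g x" by (rule c0[OF dom M])
      also have "\<dots> \<le> ennreal c * riesz ?g x" by (intro mult_right_mono c) simp
      finally show ?thesis by (rule contrapos_pp) (simp add: not_less mult_left_mono)
    qed
    then have "(\<integral>\<^sup>+x\<in>{x. ennreal t < T f x}. ennreal (w x) \<partial>lebesgue) \<le> (\<integral>\<^sup>+x\<in>{x. ennreal (t / c) < riesz ?g x}. ennreal (w x) \<partial>lebesgue)"
      by (intro nn_integral_mono) (auto simp: indicator_def)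
    then have "ennreal t * (\<integral>\<^sup>+x\<in>{x. ennreal t < T f x}. ennreal (w x) \<partial>lebesgue) \<le>
        ennreal t * (\<integral>\<^sup>+x\<in>{x. ennreal (t / c) < riesz ?g x}. ennreal (w x) \<partial>lebesgue)"
      by (rule mult_left_mono) simp
    also have "\<dots> = ennreal c * (ennreal (t / c) * (\<integral>\<^sup>+x\<in>{x. ennreal (t / c) < riesz ?g x}. ennreal (w x) \<partial>lebesgue))"
      using c t by (subst ennreal_mult_mult) auto
    also have "\<dots> \<le> ennreal c * (ennreal C * ?I)"
      by (intro mult_left_mono weak gm) (use c t in auto)
    also have "\<dots> = ennreal (c * C) * ?I" using c C by (intro ennreal_mult_mult) auto
    finally show "ennreal t * (\<integral>\<^sup>+x\<in>{x. ennreal t < T f x}. ennreal (w x) \<partial>lebesgue) \<le> ennreal (c * C) * ?I" .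
  qed
  moreover have "0 < c * C" using c C by simp
  ultimately show ?thesis by blast
qed

end
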